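(* For nonnegative integers $k,r$ with $k+r=n$, let $L(k,r)$ be the closed interval $[e,w]$ of $\mathrm{Abs}(B_n)$ with $w=[1,2,\dots,k][k+1]\cdots[k+r]$, and let $\mathcal{L}_r=L(0,r)$, i.e. the interval $[e,[1][2]\cdots[r]]$ of $\mathrm{Abs}(B_r)$. Let $\alpha_r=|\mathcal{L}_r|$, $\beta_r(m)=Z(\mathcal{L}_r,m)$ and $\mu_r=\mu(\mathcal{L}_r)$, where $\alpha_r=\beta_r(m)=\mu_r=1$ for $r=0,1$. For fixed nonnegative integers $k,r$ such that $k+r=n$, the cardinality, zeta polynomial and Möbius function of $L(k,r)$ are given by $$\#L(k,r)=\binom{2k}{k}\left(\frac{2rk}{k+1}\,\alpha_{r-1}+\alpha_r\right),$$ $$Z(L(k,r),m)=\binom{mk}{k}\left(\frac{2rk}{k+1}(m-1)\,\beta_{r-1}(m)+\beta_r(m)\right),$$ $$\mu(L(k,r))=(-1)^n\binom{2k-1}{k}\left(\frac{4rk}{k+1}\,|\mu_{r-1}|+|\mu_r|\right).$$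
   Context: Hyperoctahedral group: $B_n$ is the group of permutations $w$ of $\{\pm1,\dots,\pm n\}$ with $w(-i)=-w(i)$ for all $i$; $e$ is the identity. For $a_1,\dots,a_k\in\{\pm1,\dots,\pm n\}$ with pairwise distinct absolute values, the paired $k$-cycle $(\!(a_1,\dots,a_k)\!)$ is the permutation with cycle form $(a_1\,a_2\cdots a_k)(-a_1\,-a_2\cdots -a_k)$, and the balanced $k$-cycle $[a_1,\dots,a_k]$ is the permutation with cycle form $(a_1\,a_2\cdots a_k\,-a_1\,-a_2\cdots -a_k)$. The reflections of $B_n$ are $\mathcal{T}=\{[i]:1\le i\le n\}\cup\{(\!(i,j)\!),(\!(i,-j)\!):1\le i<j\le n\}$. Absolute order: the absolute length $\ell_{\mathcal T}(w)$ is the least $k$ such that $w$ is a product of $k$ elements of $\mathcal T$; $\mathrm{Abs}(B_n)$ is the partial order on $B_n$ given by $u\preceq v$ iff $\ell_{\mathcal T}(u)+\ell_{\mathcal T}(u^{-1}v)=\ell_{\mathcal T}(v)$. The zeta polynomial $Z(P,m)$ of a finite poset $P$ is the polynomial in $m$ that counts the multichains $x_1\le x_2\le\cdots\le x_{m-1}$ of $P$. For a finite bounded poset $P$, $\mu(P)=\mu_P(\hat0,\hat1)$ denotes the value of its Möbius function on its minimum and maximum elements.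
   Formalization: The convention α_r = β_r(m) = μ_r = 1 is dropped for r = 1, where it contradicts the definitions and falsifies the formulas (#L(1,1) is 6, not 4); the genuine values α_1 = 2, β_1(m) = m, μ_1 = −1 are used instead. *)

theory Defs
  imports
    Complex_Main
    "HOL-Combinatorics.Cycles"
    "HOL-Computational_Algebra.Polynomial"
begin

section \<open>The hyperoctahedral group and its absolute order\<close>

text \<open>Signed permutations are functions on the integers that fix everything outside
  \<open>{\<plusminus>1, \<dots>, \<plusminus>n}\<close>; the group operation is \<open>\<circ>\<close>, the identity is \<open>id\<close>.\<close>

definition hyperoctahedral :: "nat \<Rightarrow> (int \<Rightarrow> int) set" where
  "hyperoctahedral n = {w. w permutes ({- int n..int n} - {0}) \<and> (\<forall>i. w (- i) = - w i)}"

definition paired_cycle :: "int list \<Rightarrow> int \<Rightarrow> int" where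
  "paired_cycle as = cycle_of_list as \<circ> cycle_of_list (map uminus as)"

text \<open>The balanced cycle of the empty list is \<open>id\<close>.\<close>

definition balanced_cycle :: "int list \<Rightarrow> int \<Rightarrow> int" where
  "balanced_cycle as = cycle_of_list (as @ map uminus as)"

definition reflections :: "nat \<Rightarrow> (int \<Rightarrow> int) set" where
  "reflections n =
     {balanced_cycle [i] | i. 1 \<le> i \<and> i \<le> int n} \<union>
     {paired_cycle [i, j] | i j. 1 \<le> i \<and> i < j \<and> j \<le> int n} \<union>
     {paired_cycle [i, - j] | i j. 1 \<le> i \<and> i < j \<and> j \<le> int n}"

definition absolute_length :: "nat \<Rightarrow> (int \<Rightarrow> int) \<Rightarrow> nat" where
  "absolute_length n w =
     (LEAST k. \<exists>ts. length ts = k \<and> set ts \<subseteq> reflections n \<and> w = foldr (\<circ>) ts id)"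

definition absolute_order :: "nat \<Rightarrow> (int \<Rightarrow> int) rel" where
  "absolute_order n =
     {(u, v). u \<in> hyperoctahedral n \<and> v \<in> hyperoctahedral n \<and>
        absolute_length n u + absolute_length n (inv u \<circ> v) = absolute_length n v}"


section \<open>Zeta polynomial and Moebius function of a finite poset\<close>

text \<open>A poset is given by a carrier \<open>P\<close> and a relation \<open>r\<close>, of which only the restriction to
  \<open>P\<close> matters.\<close>

definition multichains :: "'a set \<Rightarrow> 'a rel \<Rightarrow> nat \<Rightarrow> 'a list set" where
  "multichains P r l =
     {xs. length xs = l \<and> set xs \<subseteq> P \<and> successively (\<lambda>x y. (x, y) \<in> r) xs}"

text \<open>The count of multichains of length \<open>m - 1\<close> is prescribed for \<open>m \<ge> 2\<close> only: for a poset
  that is not bounded, the value of the zeta polynomial at \<open>1\<close> can differ from the number \<open>1\<close>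
  of empty multichains.\<close>

definition zeta_poly :: "'a set \<Rightarrow> 'a rel \<Rightarrow> real poly" where
  "zeta_poly P r =
     (THE p. \<forall>m\<ge>2. poly p (real m) = real (card (multichains P r (m - 1))))"

text \<open>The outer conditional only serves termination; its last branch is a dummy value for
  arguments that are not finite posets.\<close>

function moebius :: "'a set \<Rightarrow> 'a rel \<Rightarrow> 'a \<Rightarrow> 'a \<Rightarrow> int" where
  "moebius P r x y =
     (if finite P \<and> partial_order_on P (Restr r P) \<and> x \<in> P \<and> y \<in> P then
        (if x = y then 1
         else if (x, y) \<in> r then
           - (\<Sum>z \<in> {z \<in> P. (x, z) \<in> r \<and> (z, y) \<in> r \<and> z \<noteq> y}. moebius P r x z)
         else 0)
      else 0)"
  by pat_completeness auto
termination
proof (relation "Wellfounded.measure (\<lambda>(P, r, x, y). card {z \<in> P. (z, y) \<in> r})", goal_cases)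
  case 1
  show ?case by simp
next
  case (2 P r x y z)
  then have po: "refl_on P (Restr r P)" "trans (Restr r P)" "antisym (Restr r P)"
    by (auto simp: partial_order_on_def preorder_on_def)
  have "{u \<in> P. (u, z) \<in> r} \<subseteq> {u \<in> P. (u, y) \<in> r}"
    using 2 transD[OF po(2)] by blast
  moreover have "y \<in> {u \<in> P. (u, y) \<in> r}"
    using 2 refl_onD[OF po(1)] by blast
  moreover have "y \<notin> {u \<in> P. (u, z) \<in> r}"
    using 2 antisymD[OF po(3)] by blast
  ultimately have "{u \<in> P. (u, z) \<in> r} \<subset> {u \<in> P. (u, y) \<in> r}"
    by blast
  with 2 show ?case
    by (simp add: psubset_card_mono)
qed

text \<open>The defining equation loops as a rewrite rule.\<close>

declare moebius.simps [simp del]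


section \<open>The intervals \<open>L(k, r)\<close>\<close>

text \<open>\<open>[1, \<dots>, k] [k + 1] \<cdots> [k + r]\<close>\<close>

definition L_top :: "nat \<Rightarrow> nat \<Rightarrow> int \<Rightarrow> int" where
  "L_top k r =
     balanced_cycle [1..int k] \<circ>
     foldr (\<circ>) (map (\<lambda>i. balanced_cycle [i]) [int k + 1..int k + int r]) id"

definition L_interval :: "nat \<Rightarrow> nat \<Rightarrow> (int \<Rightarrow> int) set" where
  "L_interval k r = {u. (id, u) \<in> absolute_order (k + r) \<and> (u, L_top k r) \<in> absolute_order (k + r)}"

definition L_zeta :: "nat \<Rightarrow> nat \<Rightarrow> real poly" where
  "L_zeta k r = zeta_poly (L_interval k r) (absolute_order (k + r))"

definition L_moebius :: "nat \<Rightarrow> nat \<Rightarrow> int" where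
  "L_moebius k r = moebius (L_interval k r) (absolute_order (k + r)) id (L_top k r)"

text \<open>These are the actual invariants of \<open>[e, [1][2]\<cdots>[r]]\<close> for every \<open>r\<close>; in particular
  \<open>alpha_seq 1 = 2\<close>, \<open>beta_seq 1 m = m\<close> and \<open>mu_seq 1 = -1\<close>, while all three are \<open>1\<close> for \<open>r = 0\<close>.\<close>

definition alpha_seq :: "nat \<Rightarrow> nat" where
  "alpha_seq r = card (L_interval 0 r)"

definition beta_seq :: "nat \<Rightarrow> real \<Rightarrow> real" where
  "beta_seq r m = poly (L_zeta 0 r) m"

definition mu_seq :: "nat \<Rightarrow> int" where
  "mu_seq r = L_moebius 0 r"

end

(* Multichains of length m - 1 in [e, w] are minimal factorizations of w into m factors. Fix a point p
   that w moves. In a factorization whose first s factors fix p and whose next factor moves p, a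
   reflection ((p, z)) can be split off that next factor and moved to the front, which changes z but
   not p. What remains is a factorization of ((p, z)) w whose first s + 1 factors fix p. The product
   ((p, z)) w falls apart into disjoint cycles, and factorizations of a paired cycle times a disjoint
   element split as well. The resulting recursions have solutions in terms of the powers of the
   series T = 1 + x T^m, and for w = [1, ..., k] [k + 1] ... [k + r] they give
     Z (L (k, r), m) = binomial (m k) k * beta r m + 2 r * binomial (m k) (k + 1) * beta (r - 1) m.
   The Moebius function is the value of the zeta polynomial at -1. *)

theory Submission
  imports Defs "HOL-Library.Numeral_Type"
begin

section \<open>Signed permutations and reflections\<close>

text \<open>Counting by s is what closes the recursion. After a split only the cycle through p stays
  constrained; every other piece fixes p, so its m factors are free. With d = m - s, a constrained
  paired cycle contributes a coefficient of T^d and a free one a coefficient of T^m, and the sums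
  over the cutting points become convolutions.

  Splitting over disjoint pieces is not automatic: [1] [2] = ((1, 2)) ((1, -2)), so factors of a
  product of balanced cycles may mix the supports. It works when one piece preserves a set A
  disjoint from -A, as a paired cycle does. Hence only paired cycles are ever factored out, and the
  singletons [k+1], ..., [k+r] are handled by merging p with another balanced cycle.

  That all factors of a minimal factorization preserve A is linear algebra: the fixed space of a
  length-additive product is the intersection of the fixed spaces of its factors. Counting
  colourings with values in Z/3 replaces dimensions, and the odd colouring that is 1 on A and -1 on
  -A transfers A to the factors.\<close>

text \<open>For nonzero p and z this is ((p, z)) if z \<noteq> p, -p, then [p] if z = -p, and the
  identity if z = p. One formula for all reflections lets the later sums range over points z without
  a split by kind.\<close>

definition srefl :: "int \<Rightarrow> int \<Rightarrow> int \<Rightarrow> int" where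
  "srefl p z x = (if x = p then z else if x = z then p else if x = - p then - z else if x = - z then - p else x)"

abbreviation support_set :: "nat \<Rightarrow> int set" where
  "support_set n \<equiv> {- int n..int n} - {0}"

lemma srefl_minus: "p \<noteq> 0 \<Longrightarrow> z \<noteq> 0 \<Longrightarrow> srefl p z (- x) = - srefl p z x"
  by (auto simp: srefl_def)

lemma srefl_srefl [simp]: "p \<noteq> 0 \<Longrightarrow> z \<noteq> 0 \<Longrightarrow> srefl p z (srefl p z x) = x"
  by (auto simp: srefl_def)

lemma srefl_comp_self [simp]: "p \<noteq> 0 \<Longrightarrow> z \<noteq> 0 \<Longrightarrow> srefl p z \<circ> srefl p z = id"
  by auto

lemma srefl_comp_cancel [simp]: "p \<noteq> 0 \<Longrightarrow> z \<noteq> 0 \<Longrightarrow> srefl p z \<circ> (srefl p z \<circ> w) = w"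
  by (auto simp: fun_eq_iff)

lemma srefl_apply [simp]: "srefl p z p = z" "srefl p z z = p"
  by (auto simp: srefl_def)

lemma srefl_commute: "srefl p z = srefl z p"
  by (auto simp: srefl_def fun_eq_iff)

lemma srefl_uminus: "p \<noteq> 0 \<Longrightarrow> z \<noteq> 0 \<Longrightarrow> srefl (- p) (- z) = srefl p z"
  by (auto simp: srefl_def fun_eq_iff)

lemma hyperoctahedralD:
  assumes "w \<in> hyperoctahedral n"
  shows "w permutes support_set n" "w (- x) = - w x" "bij w" "inj w"
  using assms by (auto simp: hyperoctahedral_def permutes_bij permutes_inj)

lemma hyperoctahedral_id [simp]: "id \<in> hyperoctahedral n"
  by (auto simp: hyperoctahedral_def permutes_id)

lemma hyperoctahedral_comp [intro]:
  "u \<in> hyperoctahedral n \<Longrightarrow> v \<in> hyperoctahedral n \<Longrightarrow> u \<circ> v \<in> hyperoctahedral n"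
  by (auto simp: hyperoctahedral_def intro: permutes_compose)

lemma hyperoctahedral_inv [intro]:
  assumes "u \<in> hyperoctahedral n"
  shows "inv u \<in> hyperoctahedral n"
proof -
  note u = hyperoctahedralD[OF assms]
  have "inv u (- x) = - inv u x" for x
  proof -
    have "u (- inv u x) = - x"
      using u(2,3) by (simp add: bij_is_surj surj_f_inv_f)
    then show ?thesis
      using u(4) by (metis inv_f_f)
  qed
  then show ?thesis
    using u(1) by (auto simp: hyperoctahedral_def intro: permutes_inv)
qed

lemma finite_hyperoctahedral: "finite (hyperoctahedral n)"
proof (rule finite_subset)
  show "hyperoctahedral n \<subseteq> {w. w permutes support_set n}"
    by (auto simp: hyperoctahedral_def)
qed (simp add: finite_permutations)

lemma srefl_hyperoctahedral [intro]:
  assumes "p \<in> support_set n" "z \<in> support_set n"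
  shows "srefl p z \<in> hyperoctahedral n"
proof -
  have nz: "p \<noteq> 0" "z \<noteq> 0"
    using assms by auto
  have "bij (srefl p z)"
    using nz by (intro o_bij[of "srefl p z"]) auto
  moreover have "srefl p z x = x" if "x \<notin> support_set n" for x
    using assms that by (auto simp: srefl_def)
  ultimately show ?thesis
    using nz by (auto simp: hyperoctahedral_def permutes_def bij_iff srefl_minus)
qed

lemma hyperoctahedral_apply:
  assumes "w \<in> hyperoctahedral n"
  shows "w x \<in> support_set n \<longleftrightarrow> x \<in> support_set n"
  using permutes_in_image[OF hyperoctahedralD(1)[OF assms]] .

lemma hyperoctahedral_fixes:
  "w \<in> hyperoctahedral n \<Longrightarrow> x \<notin> support_set n \<Longrightarrow> w x = x"
  using permutes_not_in[OF hyperoctahedralD(1)] .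

text \<open>Being odd and injective, \<open>u\<close> carries p, z, -p, -z to the four corresponding
  points. If \<open>u\<close> fixes p, a reflection through p passes \<open>u\<close> and stays a
  reflection through p.\<close>

lemma hyperoctahedral_conj:
  assumes "u \<in> hyperoctahedral n"
  shows "u \<circ> srefl p z = srefl (u p) (u z) \<circ> u"
proof
  fix x
  have inj: "u a = u b \<longleftrightarrow> a = b" for a b
    using hyperoctahedralD(4)[OF assms] by (auto dest: injD)
  have odd: "u (- a) = - u a" for a
    using hyperoctahedralD(2)[OF assms] .
  show "(u \<circ> srefl p z) x = (srefl (u p) (u z) \<circ> u) x"
    by (simp add: srefl_def inj odd flip: odd)
qed

lemma balanced_cycle_singleton: "balanced_cycle [i] = srefl i (- i)"
  by (auto simp: balanced_cycle_def srefl_def transpose_def fun_eq_iff)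

lemma paired_cycle_pair:
  assumes "\<bar>i\<bar> \<noteq> \<bar>j\<bar>" "i \<noteq> 0" "j \<noteq> 0"
  shows "paired_cycle [i, j] = srefl i j"
  using assms by (auto simp: paired_cycle_def srefl_def transpose_def fun_eq_iff)

text \<open>\<open>srefl\<close> is symmetric and unchanged when both arguments are negated, which
  reduces any pair to 0 < p \<le> \<bar>z\<bar>. There the cases z = -p, p < z and p < -z are the
  three families of reflections.\<close>

lemma reflections_eq:
  "reflections n = {srefl p z | p z. p \<in> support_set n \<and> z \<in> support_set n \<and> p \<noteq> z}"
proof (intro equalityI subsetI)
  fix t
  assume "t \<in> reflections n"
  then consider i where "t = srefl i (- i)" "1 \<le> i" "i \<le> int n"
    | i j where "t = srefl i j" "1 \<le> i" "i < j" "j \<le> int n"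
    | i j where "t = srefl i (- j)" "1 \<le> i" "i < j" "j \<le> int n"
    by (auto simp: reflections_def balanced_cycle_singleton paired_cycle_pair)
  then show "t \<in> {srefl p z | p z. p \<in> support_set n \<and> z \<in> support_set n \<and> p \<noteq> z}"
  proof cases
    case 1 then show ?thesis by (intro CollectI exI[of _ i] exI[of _ "- i"]) auto
  next
    case 2 then show ?thesis by (intro CollectI exI[of _ i] exI[of _ j]) auto
  next
    case 3 then show ?thesis by (intro CollectI exI[of _ i] exI[of _ "- j"]) auto
  qed
next
  have pos: "srefl p z \<in> reflections n"
    if "0 < p" "p \<le> \<bar>z\<bar>" "\<bar>z\<bar> \<le> int n" "p \<noteq> z" for p z
  proof -
    have "z = - p \<or> p < z \<or> p < - z"
      using that by arith
    then consider "z = - p" | "p < z" | "p < - z"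
      by blast
    then show ?thesis
    proof cases
      case 1
      then have "srefl p z = balanced_cycle [p]" "1 \<le> p" "p \<le> int n"
        using that by (auto simp: balanced_cycle_singleton)
      then show ?thesis unfolding reflections_def by blast
    next
      case 2
      then have "srefl p z = paired_cycle [p, z]" "1 \<le> p" "p < z" "z \<le> int n"
        using that by (auto simp: paired_cycle_pair)
      then show ?thesis unfolding reflections_def by blast
    next
      case 3
      then have "srefl p z = paired_cycle [p, - (- z)]" "1 \<le> p" "p < - z" "- z \<le> int n"
        using that by (auto simp: paired_cycle_pair)
      then show ?thesis unfolding reflections_def by blast
    qed
  qed
  have le: "srefl p z \<in> reflections n"
    if "p \<noteq> 0" "\<bar>p\<bar> \<le> \<bar>z\<bar>" "\<bar>z\<bar> \<le> int n" "p \<noteq> z" for p z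
  proof (cases "0 < p")
    case True
    with that show ?thesis by (intro pos) auto
  next
    case False
    with that have "srefl (- p) (- z) \<in> reflections n" by (intro pos) auto
    moreover have "z \<noteq> 0" using that by auto
    ultimately show ?thesis using that by (simp add: srefl_uminus)
  qed
  fix t
  assume "t \<in> {srefl p z | p z. p \<in> support_set n \<and> z \<in> support_set n \<and> p \<noteq> z}"
  then obtain p z where t: "t = srefl p z" "p \<in> support_set n" "z \<in> support_set n" "p \<noteq> z"
    by auto
  show "t \<in> reflections n"
  proof (cases "\<bar>p\<bar> \<le> \<bar>z\<bar>")
    case True
    with t show ?thesis by (auto intro!: le)
  next
    case False
    with t have "srefl z p \<in> reflections n" by (intro le) auto
    with t show ?thesis by (simp add: srefl_commute)
  qed
qed

lemma reflections_subset: "reflections n \<subseteq> hyperoctahedral n"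
  by (auto simp: reflections_eq)

section \<open>Products of lists of permutations\<close>

definition comps :: "('a \<Rightarrow> 'a) list \<Rightarrow> 'a \<Rightarrow> 'a" where
  "comps ts = foldr (\<circ>) ts id"

lemma comps_Nil [simp]: "comps [] = id"
  and comps_Cons [simp]: "comps (t # ts) = t \<circ> comps ts"
  by (simp_all add: comps_def)

lemma comps_append: "comps (us @ vs) = comps us \<circ> comps vs"
  by (induction us) auto

lemma comps_hyperoctahedral: "set ts \<subseteq> hyperoctahedral n \<Longrightarrow> comps ts \<in> hyperoctahedral n"
  by (induction ts) auto

lemma comps_fixes: "(\<And>t. t \<in> set ts \<Longrightarrow> t p = p) \<Longrightarrow> comps ts p = p"
  by (induction ts) auto

lemma absolute_length_altdef:
  "absolute_length n w = (LEAST k. \<exists>ts. length ts = k \<and> set ts \<subseteq> reflections n \<and> w = comps ts)"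
  by (simp add: absolute_length_def comps_def)

section \<open>Absolute length and invariant colourings\<close>

text \<open>Colourings stand in for vectors over the field with three elements: the absolute length of
  \<open>w\<close> is the codimension of the space fixed by \<open>w\<close>, which is read off here by counting. Two elements
  would not do, as an odd colouring must be able to tell \<open>i\<close> from \<open>- i\<close>.\<close>

definition colourings :: "nat \<Rightarrow> (int \<Rightarrow> 3) set" where
  "colourings n = {f. (\<forall>i. f (- i) = - f i) \<and> (\<forall>i. i \<notin> support_set n \<longrightarrow> f i = 0)}"

definition invariant_colourings :: "nat \<Rightarrow> (int \<Rightarrow> int) \<Rightarrow> (int \<Rightarrow> 3) set" where
  "invariant_colourings n w = {f \<in> colourings n. f \<circ> w = f}"

lemma double_eq_0_3: "c + c = 0 \<longleftrightarrow> c = (0 :: 3)"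
proof
  assume "c + c = 0"
  moreover have "c + c + c = 3 * c"
    by simp
  moreover have "(3 :: 3) = 0"
    by simp
  ultimately show "c = 0" by simp
qed auto

lemma finite_colourings: "finite (colourings n)"
proof (rule finite_subset)
  show "colourings n \<subseteq> {f. \<forall>i. (i \<in> support_set n \<longrightarrow> f i \<in> UNIV) \<and> (i \<notin> support_set n \<longrightarrow> f i = 0)}"
    by (auto simp: colourings_def)
  show "finite \<dots>"
    by (rule finite_set_of_finite_funs) auto
qed

text \<open>A nonempty fibre of f \<mapsto> f p - f z injects into the kernel by subtracting one of
  its members, and there are three fibres.\<close>

lemma card_le_3_times_kernel:
  fixes U :: "(int \<Rightarrow> 3) set"
  assumes fin: "finite U" and diff: "\<And>f g. f \<in> U \<Longrightarrow> g \<in> U \<Longrightarrow> (\<lambda>x. f x - g x) \<in> U"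
  shows "card U \<le> 3 * card {f \<in> U. f p = f z}"
proof -
  let ?K = "{f \<in> U. f p = f z}"
  let ?fib = "\<lambda>c. {f \<in> U. f p - f z = c}"
  have le: "card (?fib c) \<le> card ?K" for c
  proof (cases "?fib c = {}")
    case False
    then obtain g where g: "g \<in> U" "g p - g z = c"
      by auto
    have "inj_on (\<lambda>f x. f x - g x) (?fib c)"
      by (rule inj_onI) (simp add: fun_eq_iff)
    moreover have "(\<lambda>f x. f x - g x) ` ?fib c \<subseteq> ?K"
      using g diff by (auto simp: algebra_simps)
    ultimately show ?thesis
      using fin by (intro card_inj_on_le) auto
  next
    case True
    show ?thesis
      unfolding True by simp
  qed
  have "card U = card (\<Union>c\<in>UNIV. ?fib c)"
    by (rule arg_cong[of _ _ card]) auto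
  also have "\<dots> \<le> (\<Sum>c\<in>UNIV. card (?fib c))"
    by (rule card_UN_le) simp
  also have "\<dots> \<le> (\<Sum>c\<in>(UNIV :: 3 set). card ?K)"
    by (rule sum_mono) (rule le)
  finally show ?thesis
    by simp
qed

lemma colouring_srefl_iff:
  assumes "f \<in> colourings n"
  shows "f \<circ> srefl p z = f \<longleftrightarrow> f p = f z"
proof
  assume "f \<circ> srefl p z = f"
  then have "(f \<circ> srefl p z) p = f p" by simp
  then show "f p = f z" by simp
next
  assume "f p = f z"
  moreover have "f (- i) = - f i" for i
    using assms by (simp add: colourings_def)
  ultimately show "f \<circ> srefl p z = f"
    by (auto simp: srefl_def fun_eq_iff)
qed

text \<open>Invariance under one reflection is the single equation f p = f z, which costs at most a
  factor 3. The set \<open>U\<close> is general because the bound is applied both to all colourings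
  and to those invariant under a given element.\<close>

lemma card_le_reflections_kernel:
  assumes "set ts \<subseteq> reflections n" "U \<subseteq> colourings n"
    and "\<And>f g. f \<in> U \<Longrightarrow> g \<in> U \<Longrightarrow> (\<lambda>x. f x - g x) \<in> U"
  shows "card U \<le> 3 ^ length ts * card {f \<in> U. \<forall>t\<in>set ts. f \<circ> t = f}"
  using assms
proof (induction ts arbitrary: U)
  case (Cons t ts)
  then obtain p z where t: "t = srefl p z"
    by (auto simp: reflections_eq)
  let ?V = "{f \<in> U. f \<circ> t = f}"
  have V: "?V = {f \<in> U. f p = f z}"
    using colouring_srefl_iff Cons.prems(2) t by blast
  have "finite U"
    using Cons.prems(2) finite_colourings finite_subset by blast
  then have "card U \<le> 3 * card ?V"
    unfolding V using Cons.prems(3) by (intro card_le_3_times_kernel)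
  moreover have "card ?V \<le> 3 ^ length ts * card {f \<in> ?V. \<forall>t\<in>set ts. f \<circ> t = f}"
    using Cons.prems by (intro Cons.IH) (auto simp: V)
  moreover have "card {f \<in> ?V. \<forall>t\<in>set ts. f \<circ> t = f} = card {f \<in> U. \<forall>t\<in>set (t # ts). f \<circ> t = f}"
    by (rule arg_cong[of _ _ card]) auto
  ultimately have "card U \<le> 3 * (3 ^ length ts * card {f \<in> U. \<forall>t\<in>set (t # ts). f \<circ> t = f})"
    by (metis (no_types, lifting) le_trans mult_le_mono2)
  then show ?case
    unfolding length_Cons power_Suc mult.assoc .
qed auto

lemma invariant_comps:
  "\<forall>t\<in>set ts. f \<circ> t = f \<Longrightarrow> f \<circ> comps ts = f"
  by (induction ts) (auto simp flip: comp_assoc)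

lemma card_invariant_colourings_pos: "card (invariant_colourings n w) > 0"
proof -
  have "(\<lambda>_. 0) \<in> invariant_colourings n w"
    by (auto simp: invariant_colourings_def colourings_def)
  then show ?thesis
    using finite_colourings[of n] by (auto simp: card_gt_0_iff invariant_colourings_def)
qed

lemma moved_in_support:
  assumes "w \<in> hyperoctahedral n" "w p \<noteq> p"
  shows "p \<in> support_set n" "w p \<in> support_set n"
  using assms hyperoctahedral_fixes hyperoctahedral_apply by blast+

lemma srefl_comp_hyperoctahedral:
  assumes "w \<in> hyperoctahedral n" "w p \<noteq> p"
  shows "srefl p (w p) \<circ> w \<in> hyperoctahedral n"
  using assms moved_in_support[OF assms] by blast

text \<open>After the multiplication p is a fixed point, so the odd indicator \<open>g\<close> of p
  becomes invariant, and so do all f + c g with f invariant under \<open>w\<close>. These are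
  distinct because \<open>g\<close> separates p from \<open>w p\<close>, whereas f does not.\<close>

lemma card_invariant_srefl_comp:
  assumes w: "w \<in> hyperoctahedral n" and p: "w p \<noteq> p"
  shows "3 * card (invariant_colourings n w) \<le> card (invariant_colourings n (srefl p (w p) \<circ> w))"
proof -
  define z where "z = w p"
  define g :: "int \<Rightarrow> 3" where "g x = (if x = p then 1 else if x = - p then - 1 else 0)" for x
  let ?w' = "srefl p z \<circ> w"
  have pz: "p \<in> support_set n" "z \<in> support_set n" "z \<noteq> p"
    using moved_in_support[OF w p] p by (auto simp: z_def)
  have w': "?w' \<in> hyperoctahedral n"
    using srefl_comp_hyperoctahedral[OF w p] by (simp add: z_def)
  have fx: "?w' p = p" "?w' (- p) = - p"
    using pz by (simp_all add: z_def[symmetric] hyperoctahedralD(2)[OF w] srefl_minus)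
  have "?w' x = p \<longleftrightarrow> x = p" "?w' x = - p \<longleftrightarrow> x = - p" for x
    using fx hyperoctahedralD(4)[OF w'] by (metis injD)+
  then have g: "g (?w' x) = g x" for x
    by (auto simp: g_def simp del: comp_apply)
  have gcol: "g (- x) = - g x" "x \<notin> support_set n \<Longrightarrow> g x = 0" for x
    using pz by (auto simp: g_def)
  let ?add = "\<lambda>(c, f) x. f x + c * g x"
  have fpz: "f p = f z" if "f \<in> invariant_colourings n w" for f
    using that by (auto simp: invariant_colourings_def z_def fun_eq_iff)
  have "inj_on ?add (UNIV \<times> invariant_colourings n w)"
  proof (rule inj_onI, clarify)
    fix c d :: 3 and f h
    assume f: "f \<in> invariant_colourings n w"
      and h: "h \<in> invariant_colourings n w"
      and eq: "(\<lambda>x. f x + c * g x) = (\<lambda>x. h x + d * g x)"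
    then have eq: "f x + c * g x = h x + d * g x" for x
      by meson
    have "(c - d) * (g p - g z) = (f p + c * g p) - (f z + c * g z) - ((h p + d * g p) - (h z + d * g z))"
      by (simp add: fpz[OF f] fpz[OF h] algebra_simps)
    also have "\<dots> = 0"
      by (simp add: eq)
    finally have "(c - d) * (g p - g z) = 0" .
    \<comment> \<open>The second value occurs for z = -p. Both can be cancelled in Z/3, the second
      one by \<open>double_eq_0_3\<close>.\<close>
    moreover have "g p - g z = 1 \<or> g p - g z = 1 + 1"
      using pz by (auto simp: g_def)
    ultimately have "c - d = 0 \<or> (c - d) + (c - d) = 0"
      by (elim disjE) (simp_all only: distrib_left mult_1_right simp_thms)
    then have "c = d"
      by (auto simp only: double_eq_0_3 right_minus_eq)
    with eq show "c = d \<and> f = h"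
      by (auto simp: fun_eq_iff)
  qed
  moreover have "?add ` (UNIV \<times> invariant_colourings n w) \<subseteq> invariant_colourings n ?w'"
  proof clarify
    fix c f
    assume f: "f \<in> invariant_colourings n w"
    then have fcol: "f \<in> colourings n" and fw: "f (w x) = f x" for x
      by (auto simp: invariant_colourings_def fun_eq_iff)
    have "f (srefl p z y) = f y" for y
      using colouring_srefl_iff[OF fcol, of p z] fpz[OF f] by (simp add: fun_eq_iff)
    then have "f (?w' x) + c * g (?w' x) = f x + c * g x" for x
      by (simp add: fw g[unfolded comp_apply])
    moreover have "(\<lambda>x. f x + c * g x) \<in> colourings n"
      using fcol gcol by (auto simp: colourings_def)
    ultimately show "(\<lambda>x. f x + c * g x) \<in> invariant_colourings n ?w'"
      by (auto simp: invariant_colourings_def)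
  qed
  moreover have "finite (invariant_colourings n ?w')"
    using finite_colourings by (simp add: invariant_colourings_def)
  ultimately have "card ((UNIV :: 3 set) \<times> invariant_colourings n w) \<le> card (invariant_colourings n ?w')"
    by (intro card_inj_on_le)
  then show ?thesis
    by (simp add: card_cartesian_product z_def)
qed

text \<open>A fixed point of \<open>w\<close> is none of p, \<open>w p\<close> and their negatives,
  so the reflection leaves it alone, while p becomes a new fixed point.\<close>

lemma moved_srefl_comp:
  assumes w: "w \<in> hyperoctahedral n" and p: "w p \<noteq> p"
  shows "{x. (srefl p (w p) \<circ> w) x \<noteq> x} \<subset> {x. w x \<noteq> x}"
proof -
  have inj: "w x = w y \<longleftrightarrow> x = y" for x y
    using hyperoctahedralD(4)[OF w] by (auto dest: injD)
  have odd: "w (- x) = - w x" for x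
    using hyperoctahedralD(2)[OF w] .
  have "srefl p (w p) x = x" if "w x = x" for x
  proof -
    have "x \<noteq> p" "x \<noteq> w p" "x \<noteq> - p" "x \<noteq> - w p"
      using that p inj[of x p] inj[of x "- p"] odd[of p] by auto
    then show ?thesis
      by (simp add: srefl_def)
  qed
  moreover have "p \<in> {x. w x \<noteq> x}" "p \<notin> {x. (srefl p (w p) \<circ> w) x \<noteq> x}"
    using p by auto
  ultimately show ?thesis
    by fastforce
qed

lemma finite_moved:
  assumes "w \<in> hyperoctahedral n"
  shows "finite {x. w x \<noteq> x}"
proof (rule finite_subset)
  show "{x. w x \<noteq> x} \<subseteq> support_set n"
    using moved_in_support[OF assms] by blast
qed auto

lemma hyperoctahedral_induct [consumes 1, case_names id step]:
  assumes "w \<in> hyperoctahedral n"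
    and "P id"
    and "\<And>w p. w \<in> hyperoctahedral n \<Longrightarrow> w p \<noteq> p \<Longrightarrow> P (srefl p (w p) \<circ> w) \<Longrightarrow> P w"
  shows "P w"
  using assms(1)
proof (induction "card {x. w x \<noteq> x}" arbitrary: w rule: less_induct)
  case less
  show ?case
  proof (cases "\<exists>p. w p \<noteq> p")
    case False
    then have "w = id" by auto
    then show ?thesis using assms(2) by simp
  next
    case True
    then obtain p where p: "w p \<noteq> p" by blast
    have "P (srefl p (w p) \<circ> w)"
      using less.prems p
      by (intro less.hyps psubset_card_mono finite_moved moved_srefl_comp srefl_comp_hyperoctahedral)
    then show ?thesis
      using assms(3) less.prems p by blast
  qed
qed

lemma srefl_in_reflections:
  "p \<in> support_set n \<Longrightarrow> z \<in> support_set n \<Longrightarrow> p \<noteq> z \<Longrightarrow> srefl p z \<in> reflections n"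
  unfolding reflections_eq by blast

section \<open>The absolute length as a codimension\<close>

text \<open>Sending moved points home one by one ends at \<open>id\<close>, under which all
  colourings are invariant, and every reflection used at least triples the number of invariant
  ones.\<close>

lemma ex_reflection_word_invariant:
  assumes "w \<in> hyperoctahedral n"
  shows "\<exists>ts. set ts \<subseteq> reflections n \<and> w = comps ts \<and>
    3 ^ length ts * card (invariant_colourings n w) \<le> card (colourings n)"
  using assms
proof (induction rule: hyperoctahedral_induct)
  case id
  have "invariant_colourings n id \<subseteq> colourings n"
    by (auto simp: invariant_colourings_def)
  then have "card (invariant_colourings n id) \<le> card (colourings n)"
    by (intro card_mono finite_colourings)
  then show ?case
    by (intro exI[of _ "[]"] conjI) (simp_all add: id_def)
next
  case (step w p)
  then obtain ts where ts: "set ts \<subseteq> reflections n" "srefl p (w p) \<circ> w = comps ts"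
    "3 ^ length ts * card (invariant_colourings n (srefl p (w p) \<circ> w)) \<le> card (colourings n)"
    by blast
  have "p \<in> support_set n" "w p \<in> support_set n"
    using moved_in_support step by blast+
  then have "w = comps (srefl p (w p) # ts)" "srefl p (w p) \<in> reflections n"
    using ts(2)[symmetric] step(2) by (auto intro!: srefl_in_reflections)
  moreover have "3 ^ length (srefl p (w p) # ts) * card (invariant_colourings n w)
      \<le> 3 ^ length ts * card (invariant_colourings n (srefl p (w p) \<circ> w))"
    using card_invariant_srefl_comp[OF step(1,2)] by (simp del: comp_apply)
  with ts(3) have "3 ^ length (srefl p (w p) # ts) * card (invariant_colourings n w) \<le> card (colourings n)"
    by linarith
  ultimately show ?case
    using ts(1) by (metis insert_subset list.simps(15))
qed

lemma absolute_length_word: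
  assumes "w \<in> hyperoctahedral n"
  obtains ts where "length ts = absolute_length n w" "set ts \<subseteq> reflections n" "w = comps ts"
proof -
  have "\<exists>k ts. length ts = k \<and> set ts \<subseteq> reflections n \<and> w = comps ts"
    using ex_reflection_word_invariant[OF assms] by blast
  from LeastI_ex[OF this] show thesis
    using that unfolding absolute_length_altdef by blast
qed

lemma absolute_length_le:
  assumes "set ts \<subseteq> reflections n"
  shows "absolute_length n (comps ts) \<le> length ts"
  unfolding absolute_length_altdef using assms by (intro Least_le) blast

lemma colourings_diff:
  "f \<in> colourings n \<Longrightarrow> g \<in> colourings n \<Longrightarrow> (\<lambda>x. f x - g x) \<in> colourings n"
  by (auto simp: colourings_def)

lemma invariant_colourings_diff:
  assumes "f \<in> invariant_colourings n w" "g \<in> invariant_colourings n w"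
  shows "(\<lambda>x. f x - g x) \<in> invariant_colourings n w"
  using assms colourings_diff[of f n g] by (auto simp: invariant_colourings_def fun_eq_iff)

text \<open>A shortest word imposes \<open>absolute_length n w\<close> equations, which bounds the
  invariant colourings from below. The word of \<open>ex_reflection_word_invariant\<close>, which is
  at least that long, bounds them from above.\<close>

lemma card_colourings_eq:
  assumes w: "w \<in> hyperoctahedral n"
  shows "card (colourings n) = 3 ^ absolute_length n w * card (invariant_colourings n w)"
proof (rule antisym)
  obtain ts where ts: "length ts = absolute_length n w" "set ts \<subseteq> reflections n" "w = comps ts"
    using absolute_length_word[OF w] .
  have "card (colourings n) \<le> 3 ^ length ts * card {f \<in> colourings n. \<forall>t\<in>set ts. f \<circ> t = f}"
    using ts colourings_diff by (intro card_le_reflections_kernel) auto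
  also have "card {f \<in> colourings n. \<forall>t\<in>set ts. f \<circ> t = f} \<le> card (invariant_colourings n w)"
    using finite_colourings ts(3) invariant_comps
    by (intro card_mono) (auto simp: invariant_colourings_def)
  finally show "card (colourings n) \<le> 3 ^ absolute_length n w * card (invariant_colourings n w)"
    using ts by simp
next
  obtain ts where ts: "set ts \<subseteq> reflections n" "w = comps ts"
    "3 ^ length ts * card (invariant_colourings n w) \<le> card (colourings n)"
    using ex_reflection_word_invariant[OF w] by blast
  have "3 ^ absolute_length n w * card (invariant_colourings n w) \<le> 3 ^ length ts * card (invariant_colourings n w)"
    using absolute_length_le[OF ts(1)] ts(2) by (intro mult_right_mono power_increasing) auto
  with ts(3) show "3 ^ absolute_length n w * card (invariant_colourings n w) \<le> card (colourings n)"
    by linarith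
qed

lemma absolute_length_comp_le:
  assumes "u \<in> hyperoctahedral n" "v \<in> hyperoctahedral n"
  shows "absolute_length n (u \<circ> v) \<le> absolute_length n u + absolute_length n v"
proof -
  obtain us vs where
    "length us = absolute_length n u" "set us \<subseteq> reflections n" "u = comps us"
    "length vs = absolute_length n v" "set vs \<subseteq> reflections n" "v = comps vs"
    using absolute_length_word assms by metis
  then show ?thesis
    using absolute_length_le[of "us @ vs" n] by (simp add: comps_append)
qed

lemma absolute_length_id [simp]: "absolute_length n id = 0"
  using absolute_length_le[of "[]" n] by simp

lemma absolute_length_eq_0:
  assumes "w \<in> hyperoctahedral n" "absolute_length n w = 0"
  shows "w = id"
  using absolute_length_word[OF assms(1)] assms(2) by (metis comps_Nil length_0_conv)

text \<open>Subadditivity gives one inequality; the other compares exponents of 3, as the number of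
  invariant colourings at least triples. This is the source of all length computations
  below.\<close>

lemma absolute_length_srefl_comp:
  assumes w: "w \<in> hyperoctahedral n" and p: "w p \<noteq> p"
  shows "absolute_length n w = Suc (absolute_length n (srefl p (w p) \<circ> w))"
proof (rule antisym)
  let ?t = "srefl p (w p)"
  have nz: "p \<noteq> 0" "w p \<noteq> 0"
    using moved_in_support[OF w p] by auto
  have t: "?t \<in> reflections n"
    using moved_in_support[OF w p] p by (intro srefl_in_reflections) auto
  then have "absolute_length n ?t \<le> 1"
    using absolute_length_le[of "[?t]" n] by simp
  moreover have "absolute_length n (?t \<circ> (?t \<circ> w)) \<le> absolute_length n ?t + absolute_length n (?t \<circ> w)"
    using t reflections_subset srefl_comp_hyperoctahedral[OF w p]
    by (intro absolute_length_comp_le) auto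
  ultimately show "absolute_length n w \<le> Suc (absolute_length n (?t \<circ> w))"
    using nz by simp
next
  let ?w' = "srefl p (w p) \<circ> w"
  have "3 ^ Suc (absolute_length n ?w') * card (invariant_colourings n w)
      = 3 ^ absolute_length n ?w' * (3 * card (invariant_colourings n w))"
    by simp
  also have "\<dots> \<le> 3 ^ absolute_length n ?w' * card (invariant_colourings n ?w')"
    by (intro mult_left_mono card_invariant_srefl_comp w p) auto
  also have "\<dots> = 3 ^ absolute_length n w * card (invariant_colourings n w)"
    using card_colourings_eq[OF w] card_colourings_eq[OF srefl_comp_hyperoctahedral[OF w p]] by simp
  finally have "(3::nat) ^ Suc (absolute_length n ?w') \<le> 3 ^ absolute_length n w"
    using card_invariant_colourings_pos[of n w] by (simp del: power_Suc)
  then show "Suc (absolute_length n ?w') \<le> absolute_length n w"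
    by (subst (asm) power_increasing_iff) auto
qed

text \<open>The colourings invariant under both factors are invariant under the product. They are
  also numerous enough: a shortest word for \<open>u\<close> cuts those of \<open>v\<close> down by
  at most 3 to the power of the length of \<open>u\<close>, which by additivity leaves at least the
  number invariant under the product.\<close>

lemma invariant_colourings_comp:
  assumes u: "u \<in> hyperoctahedral n" and v: "v \<in> hyperoctahedral n"
    and len: "absolute_length n (u \<circ> v) = absolute_length n u + absolute_length n v"
  shows "invariant_colourings n (u \<circ> v) = invariant_colourings n u \<inter> invariant_colourings n v"
proof -
  let ?I = "invariant_colourings n u \<inter> invariant_colourings n v"
  have sub: "?I \<subseteq> invariant_colourings n (u \<circ> v)"
    by (auto simp: invariant_colourings_def simp flip: comp_assoc)
  obtain us where us: "length us = absolute_length n u" "set us \<subseteq> reflections n" "u = comps us"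
    using absolute_length_word[OF u] .
  have fin: "finite (invariant_colourings n w)" for w
    using finite_colourings by (simp add: invariant_colourings_def)
  have "card (invariant_colourings n v)
      \<le> 3 ^ length us * card {f \<in> invariant_colourings n v. \<forall>t\<in>set us. f \<circ> t = f}"
    using us(2) invariant_colourings_diff
    by (intro card_le_reflections_kernel) (auto simp: invariant_colourings_def)
  also have "card {f \<in> invariant_colourings n v. \<forall>t\<in>set us. f \<circ> t = f} \<le> card ?I"
    using fin us(3) invariant_comps by (intro card_mono) (auto simp: invariant_colourings_def)
  finally have "3 ^ absolute_length n v * card (invariant_colourings n v)
      \<le> 3 ^ absolute_length n v * (3 ^ absolute_length n u * card ?I)"
    using us(1) by (intro mult_left_mono) auto
  also have "\<dots> = 3 ^ absolute_length n (u \<circ> v) * card ?I"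
    by (simp add: len power_add mult_ac)
  finally have "card (colourings n) \<le> 3 ^ absolute_length n (u \<circ> v) * card ?I"
    unfolding card_colourings_eq[OF v, symmetric] .
  then have "3 ^ absolute_length n (u \<circ> v) * card (invariant_colourings n (u \<circ> v))
      \<le> 3 ^ absolute_length n (u \<circ> v) * card ?I"
    unfolding card_colourings_eq[OF hyperoctahedral_comp[OF u v]] .
  then have "card (invariant_colourings n (u \<circ> v)) \<le> card ?I"
    by simp
  with sub fin show ?thesis
    by (intro card_seteq[symmetric]) auto
qed

section \<open>Minimal factorizations\<close>

lemma card_eq_witness:
  assumes "\<And>x. x \<in> A \<Longrightarrow> f x \<in> B \<and> g (f x) = x" "\<And>y. y \<in> B \<Longrightarrow> g y \<in> A \<and> f (g y) = y"
  shows "card A = card B"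
proof (rule bij_betw_same_card)
  show "bij_betw f A B"
    using assms by (intro bij_betw_byWitness[where f' = g]) auto
qed

definition stabilizes :: "('a \<Rightarrow> 'a) \<Rightarrow> 'a set \<Rightarrow> bool" where
  "stabilizes w A \<longleftrightarrow> (\<forall>x. w x \<in> A \<longleftrightarrow> x \<in> A)"

lemma stabilizes_comp: "stabilizes u A \<Longrightarrow> stabilizes v A \<Longrightarrow> stabilizes (u \<circ> v) A"
  by (auto simp: stabilizes_def)

lemma stabilizes_singleton: "inj w \<Longrightarrow> stabilizes w {p} \<longleftrightarrow> w p = p"
  unfolding stabilizes_def inj_def by (metis singletonD singletonI)

text \<open>The odd colouring with values 1 on A, -1 on -A and 0 elsewhere is invariant under the
  product, hence under both factors, and A is where it takes the value 1.\<close>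

lemma stabilizes_factors:
  assumes u: "u \<in> hyperoctahedral n" and v: "v \<in> hyperoctahedral n"
    and len: "absolute_length n (u \<circ> v) = absolute_length n u + absolute_length n v"
    and A: "A \<subseteq> support_set n" "\<And>a. a \<in> A \<Longrightarrow> - a \<notin> A" and stab: "stabilizes (u \<circ> v) A"
  shows "stabilizes u A" "stabilizes v A"
proof -
  define f :: "int \<Rightarrow> 3" where "f x = (if x \<in> A then 1 else if - x \<in> A then - 1 else 0)" for x
  have "(1 :: 3) \<noteq> - 1"
    by simp
  then have f1: "f x = 1 \<longleftrightarrow> x \<in> A" for x
    by (auto simp: f_def)
  have "f \<in> colourings n"
    using A by (auto simp: f_def colourings_def)
  moreover have "f \<circ> (u \<circ> v) = f"
  proof
    fix x
    have "(u \<circ> v) (- x) = - (u \<circ> v) x"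
      using hyperoctahedralD(2)[OF u] hyperoctahedralD(2)[OF v] by simp
    then have "(u \<circ> v) x \<in> A \<longleftrightarrow> x \<in> A" "- (u \<circ> v) x \<in> A \<longleftrightarrow> - x \<in> A"
      using stab unfolding stabilizes_def by metis+
    then show "(f \<circ> (u \<circ> v)) x = f x"
      by (simp add: f_def)
  qed
  ultimately have "f \<in> invariant_colourings n (u \<circ> v)"
    by (simp add: invariant_colourings_def)
  then have "f \<circ> u = f" "f \<circ> v = f"
    unfolding invariant_colourings_comp[OF u v len] by (auto simp: invariant_colourings_def)
  then have "f (u x) = 1 \<longleftrightarrow> f x = 1" "f (v x) = 1 \<longleftrightarrow> f x = 1" for x
    by (metis comp_apply)+
  then show "stabilizes u A" "stabilizes v A"
    unfolding f1 stabilizes_def by blast+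
qed

abbreviation total_length :: "nat \<Rightarrow> (int \<Rightarrow> int) list \<Rightarrow> nat" where
  "total_length n ts \<equiv> sum_list (map (absolute_length n) ts)"

lemma absolute_length_comps_le:
  "set ts \<subseteq> hyperoctahedral n \<Longrightarrow> absolute_length n (comps ts) \<le> total_length n ts"
proof (induction ts)
  case (Cons t ts)
  then have "absolute_length n (t \<circ> comps ts) \<le> absolute_length n t + absolute_length n (comps ts)"
    by (intro absolute_length_comp_le comps_hyperoctahedral) auto
  with Cons show ?case by (simp add: comp_def)
qed simp

lemma minimal_factorization_Cons:
  assumes "set (t # ts) \<subseteq> hyperoctahedral n"
    "total_length n (t # ts) = absolute_length n (comps (t # ts))"
  shows "absolute_length n (t \<circ> comps ts) = absolute_length n t + absolute_length n (comps ts)"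
    "total_length n ts = absolute_length n (comps ts)"
proof -
  have "absolute_length n (t \<circ> comps ts) \<le> absolute_length n t + absolute_length n (comps ts)"
    using assms by (intro absolute_length_comp_le comps_hyperoctahedral) auto
  with assms absolute_length_comps_le[of ts n]
  show "absolute_length n (t \<circ> comps ts) = absolute_length n t + absolute_length n (comps ts)"
    "total_length n ts = absolute_length n (comps ts)"
    by auto
qed

section \<open>Minimal factorizations whose leading factors fix a point\<close>

text \<open>Identity factors are allowed, just as a multichain may repeat an element.\<close>

definition factorizations :: "nat \<Rightarrow> nat \<Rightarrow> (int \<Rightarrow> int) \<Rightarrow> (int \<Rightarrow> int) list set" where
  "factorizations n m w = {ts. length ts = m \<and> set ts \<subseteq> hyperoctahedral n \<and> comps ts = w \<and>
     total_length n ts = absolute_length n w}"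

text \<open>The parameter s interpolates between all factorizations (s = 0) and none (s = m, when
  \<open>w\<close> moves p), so that a count can be assembled step by step in s.\<close>

definition factorizations_fixing ::
    "nat \<Rightarrow> nat \<Rightarrow> int \<Rightarrow> nat \<Rightarrow> (int \<Rightarrow> int) \<Rightarrow> (int \<Rightarrow> int) list set" where
  "factorizations_fixing n m p s w = {ts \<in> factorizations n m w. \<forall>t\<in>set (take s ts). t p = p}"

lemma factorizationsD:
  assumes "ts \<in> factorizations n m w"
  shows "length ts = m" "set ts \<subseteq> hyperoctahedral n" "comps ts = w"
    "total_length n ts = absolute_length n w" "w \<in> hyperoctahedral n"
  using assms comps_hyperoctahedral by (auto simp: factorizations_def)

lemma finite_factorizations: "finite (factorizations n m w)"
proof (rule finite_subset)
  show "factorizations n m w \<subseteq> {ts. set ts \<subseteq> hyperoctahedral n \<and> length ts = m}"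
    by (auto simp: factorizations_def)
qed (simp add: finite_lists_length_eq finite_hyperoctahedral)

lemma finite_factorizations_fixing: "finite (factorizations_fixing n m p s w)"
  using finite_factorizations by (simp add: factorizations_fixing_def)

lemma factorizations_fixing_0: "factorizations_fixing n m p 0 w = factorizations n m w"
  by (simp add: factorizations_fixing_def)

lemma factors_stabilize:
  assumes "ts \<in> factorizations n m w" "t \<in> set ts"
    and A: "A \<subseteq> support_set n" "\<And>a. a \<in> A \<Longrightarrow> - a \<notin> A" and "stabilizes w A"
  shows "stabilizes t A"
proof -
  have "set ts \<subseteq> hyperoctahedral n" "total_length n ts = absolute_length n (comps ts)"
    "stabilizes (comps ts) A"
    using assms(1,5) factorizationsD[OF assms(1)] by auto
  then show ?thesis
    using assms(2)
  proof (induction ts)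
    case (Cons u ts)
    note min = minimal_factorization_Cons[OF Cons.prems(1,2)]
    have uts: "u \<in> hyperoctahedral n" "comps ts \<in> hyperoctahedral n"
      using Cons.prems(1) comps_hyperoctahedral by auto
    have "stabilizes (u \<circ> comps ts) A"
      using Cons.prems(3) by (simp add: comp_def)
    then have "stabilizes u A" "stabilizes (comps ts) A"
      using stabilizes_factors[OF uts min(1) A] by auto
    with Cons min(2) show ?case
      by auto
  qed simp
qed

text \<open>In the support, {p} is disjoint from its negative, so invariance of {p} is inherited by
  the factors; points outside the support are fixed by every element.\<close>

lemma factors_fix:
  assumes ts: "ts \<in> factorizations n m w" "t \<in> set ts" and "w p = p"
  shows "t p = p"
proof (cases "p \<in> support_set n")
  case True
  have t: "t \<in> hyperoctahedral n" "w \<in> hyperoctahedral n"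
    using factorizationsD[OF ts(1)] ts(2) by auto
  have "stabilizes t {p}"
    using True assms(3) stabilizes_singleton[OF hyperoctahedralD(4)[OF t(2)], of p]
    by (intro factors_stabilize[OF ts]) auto
  then show ?thesis
    using stabilizes_singleton[OF hyperoctahedralD(4)[OF t(1)], of p] by simp
next
  case False
  then show ?thesis
    using factorizationsD(2)[OF ts(1)] ts(2) hyperoctahedral_fixes by blast
qed

lemma factorizations_fixing_eq:
  assumes "w p = p"
  shows "factorizations_fixing n m p s w = factorizations n m w"
proof -
  have "t p = p" if "ts \<in> factorizations n m w" "t \<in> set (take s ts)" for t ts
    using factors_fix[OF that(1) in_set_takeD[OF that(2)] assms] .
  then show ?thesis
    unfolding factorizations_fixing_def by auto
qed

lemma factorizations_fixing_all:
  assumes "w p \<noteq> p"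
  shows "factorizations_fixing n m p m w = {}"
proof -
  have "w p = p" if "ts \<in> factorizations n m w" "\<forall>t\<in>set (take m ts). t p = p" for ts
    using comps_fixes[of ts p] factorizationsD[OF that(1)] that(2) by simp
  with assms show ?thesis
    unfolding factorizations_fixing_def by blast
qed

lemma factorizations_id: "factorizations n m id = {replicate m id}"
proof -
  have "ts = replicate m id" if "ts \<in> factorizations n m id" for ts
  proof -
    note ts = factorizationsD[OF that]
    have "t = id" if "t \<in> set ts" for t
      using ts(2,4) that absolute_length_eq_0 by auto
    with ts(1) show ?thesis
      by (metis replicate_eqI)
  qed
  moreover have "comps (replicate m id) = id" "total_length n (replicate m id) = 0"
    by (induction m) auto
  ultimately show ?thesis
    by (auto simp: factorizations_def)
qed

section \<open>Splitting a reflection off a minimal factorization\<close>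

text \<open>These z index the reflections through p that lie below \<open>w\<close> in the absolute
  order.\<close>

definition lowering :: "nat \<Rightarrow> int \<Rightarrow> (int \<Rightarrow> int) \<Rightarrow> int set" where
  "lowering n p w =
     {z \<in> support_set n - {p}. Suc (absolute_length n (srefl p z \<circ> w)) = absolute_length n w}"

lemma finite_lowering: "finite (lowering n p w)"
  by (rule finite_subset[of _ "support_set n"]) (auto simp: lowering_def)

lemma comps_srefl:
  assumes "set us \<subseteq> hyperoctahedral n" "comps us p = p"
  shows "comps (us @ (srefl p y \<circ> t) # vs) = srefl p (comps us y) \<circ> comps (us @ t # vs)"
proof -
  have "comps us \<circ> srefl p y = srefl p (comps us y) \<circ> comps us"
    using hyperoctahedral_conj[OF comps_hyperoctahedral[OF assms(1)], of p y] assms(2) by simp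
  then show ?thesis
    by (simp add: comps_append fun_eq_iff)
qed

text \<open>The total length of the word drops by exactly 1, and multiplying by one reflection
  lowers the length of the product by at most 1. So the new word is again minimal, and the length of
  the product has dropped by 1 as well.\<close>

lemma lower_factorization:
  assumes ts: "us @ t # vs \<in> factorizations n m w"
    and p: "\<forall>u\<in>set us. u p = p" "t p \<noteq> p"
  shows "comps us (t p) \<in> lowering n p w"
    and "us @ (srefl p (t p) \<circ> t) # vs \<in> factorizations n m (srefl p (comps us (t p)) \<circ> w)"
proof -
  let ?t' = "srefl p (t p) \<circ> t" and ?z = "comps us (t p)"
  have us: "set us \<subseteq> hyperoctahedral n" "comps us \<in> hyperoctahedral n" and t: "t \<in> hyperoctahedral n"
    and w: "w \<in> hyperoctahedral n"
    using factorizationsD[OF ts] comps_hyperoctahedral[of us] by auto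
  have cp: "comps us p = p"
    using p(1) by (intro comps_fixes) blast
  have sup: "p \<in> support_set n" "?z \<in> support_set n"
    using moved_in_support[OF t p(2)] hyperoctahedral_apply[OF us(2)] by blast+
  have zp: "?z \<noteq> p"
    using cp p(2) hyperoctahedralD(4)[OF us(2)] by (metis injD)
  have w': "srefl p ?z \<circ> w \<in> hyperoctahedral n"
    using sup w by blast
  have comps: "comps (us @ ?t' # vs) = srefl p ?z \<circ> w"
    using comps_srefl[OF us(1) cp] factorizationsD(3)[OF ts] by simp
  have set: "set (us @ ?t' # vs) \<subseteq> hyperoctahedral n"
    using factorizationsD(2)[OF ts] srefl_comp_hyperoctahedral[OF t p(2)] by auto
  have tl: "Suc (total_length n (us @ ?t' # vs)) = absolute_length n w"
    using absolute_length_srefl_comp[OF t p(2)] factorizationsD(4)[OF ts] by simp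
  have "absolute_length n (srefl p ?z \<circ> (srefl p ?z \<circ> w))
      \<le> absolute_length n (srefl p ?z) + absolute_length n (srefl p ?z \<circ> w)"
    using sup w' by (intro absolute_length_comp_le) blast+
  moreover have "absolute_length n (srefl p ?z) \<le> 1"
    using absolute_length_le[of "[srefl p ?z]" n] srefl_in_reflections[OF sup] zp by simp
  ultimately have "absolute_length n w \<le> Suc (absolute_length n (srefl p ?z \<circ> w))"
    using sup by simp
  moreover have "absolute_length n (srefl p ?z \<circ> w) \<le> total_length n (us @ ?t' # vs)"
    using absolute_length_comps_le[OF set] unfolding comps .
  ultimately have eq: "total_length n (us @ ?t' # vs) = absolute_length n (srefl p ?z \<circ> w)"
    "Suc (absolute_length n (srefl p ?z \<circ> w)) = absolute_length n w"
    using tl by linarith+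
  show "?z \<in> lowering n p w"
    using sup zp eq(2) by (simp add: lowering_def)
  show "us @ ?t' # vs \<in> factorizations n m (srefl p ?z \<circ> w)"
    using set comps eq(1) factorizationsD(1)[OF ts] unfolding factorizations_def by auto
qed

text \<open>The point \<open>inv (comps us) z\<close> undoes the conjugation by the prefix. As
  \<open>t\<close> fixes p, the enlarged factor sends p to this point, which makes it longer than
  \<open>t\<close> by exactly 1.\<close>

lemma raise_factorization:
  assumes ts: "us @ t # vs \<in> factorizations n m (srefl p z \<circ> w)"
    and w: "w \<in> hyperoctahedral n" and z: "z \<in> lowering n p w" and sp: "p \<in> support_set n"
    and p: "\<forall>u\<in>set us. u p = p" "t p = p"
  shows "inv (comps us) z \<noteq> p"
    and "us @ (srefl p (inv (comps us) z) \<circ> t) # vs \<in> factorizations n m w"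
proof -
  let ?y = "inv (comps us) z"
  let ?t' = "srefl p ?y \<circ> t"
  have us: "set us \<subseteq> hyperoctahedral n" "comps us \<in> hyperoctahedral n" and t: "t \<in> hyperoctahedral n"
    using factorizationsD[OF ts] comps_hyperoctahedral[of us] by auto
  have cp: "comps us p = p"
    using p(1) by (intro comps_fixes) blast
  have cy: "comps us ?y = z"
    using hyperoctahedralD(3)[OF us(2)] by (simp add: bij_is_surj surj_f_inv_f)
  have zs: "z \<in> support_set n" "z \<noteq> p" "Suc (absolute_length n (srefl p z \<circ> w)) = absolute_length n w"
    using z by (auto simp: lowering_def)
  show yp: "?y \<noteq> p"
    using cy cp zs(2) by metis
  have sy: "?y \<in> support_set n"
    using hyperoctahedral_apply[OF us(2), of ?y] cy zs(1) by simp
  have t': "?t' \<in> hyperoctahedral n"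
    using sp sy t by blast
  have nz: "p \<noteq> 0" "?y \<noteq> 0" "z \<noteq> 0"
    using sp sy zs(1) by auto
  have t'p: "?t' p = ?y"
    using p(2) by simp
  then have "srefl p (?t' p) \<circ> ?t' = t"
    using nz by simp
  then have "absolute_length n ?t' = Suc (absolute_length n t)"
    using absolute_length_srefl_comp[OF t', of p] t'p yp by simp
  then have "total_length n (us @ ?t' # vs) = absolute_length n w"
    using factorizationsD(4)[OF ts] zs(3) by simp
  moreover have "comps (us @ ?t' # vs) = w"
    using comps_srefl[OF us(1) cp] factorizationsD(3)[OF ts] nz cy by simp
  moreover have "set (us @ ?t' # vs) \<subseteq> hyperoctahedral n"
    using factorizationsD(2)[OF ts] t' by auto
  ultimately show "us @ ?t' # vs \<in> factorizations n m w"
    using factorizationsD(1)[OF ts] unfolding factorizations_def by auto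
qed

text \<open>A reflection through \<open>p\<close> is split off the first factor that moves \<open>p\<close>; it commutes with the
  preceding factors, up to conjugation, because they fix \<open>p\<close>.\<close>

lemma card_factorizations_fixing_rec:
  assumes w: "w \<in> hyperoctahedral n" and sp: "p \<in> support_set n" and "s < m"
  shows "card (factorizations_fixing n m p s w) = card (factorizations_fixing n m p (Suc s) w) +
    (\<Sum>z\<in>lowering n p w. card (factorizations_fixing n m p (Suc s) (srefl p z \<circ> w)))"
proof -
  let ?D = "{ts \<in> factorizations_fixing n m p s w. (ts ! s) p \<noteq> p}"
  let ?S = "SIGMA z:lowering n p w. factorizations_fixing n m p (Suc s) (srefl p z \<circ> w)"
  \<comment> \<open>\<open>?f\<close> records the reflection as it appears at the front of the word.
    Only the factor with index s changes, so \<open>?g\<close> sees the same prefix and can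
    conjugate back.\<close>
  let ?f = "\<lambda>ts. (comps (take s ts) ((ts ! s) p), ts[s := srefl p ((ts ! s) p) \<circ> ts ! s])"
  let ?g = "\<lambda>(z, ts). ts[s := srefl p (inv (comps (take s ts)) z) \<circ> ts ! s]"
  have split: "ts = take s ts @ ts ! s # drop (Suc s) ts" if "length ts = m" for ts :: "(int \<Rightarrow> int) list"
    using that \<open>s < m\<close> by (simp add: id_take_nth_drop)
  have upd: "ts[s := x] = take s ts @ x # drop (Suc s) ts" if "length ts = m" for x and ts :: "(int \<Rightarrow> int) list"
    using that \<open>s < m\<close> by (simp add: upd_conv_take_nth_drop)
  have Suc: "ts \<in> factorizations_fixing n m p (Suc s) v \<longleftrightarrow>
      ts \<in> factorizations_fixing n m p s v \<and> (ts ! s) p = p" for ts v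
    using \<open>s < m\<close> by (auto simp: factorizations_fixing_def factorizations_def take_Suc_conv_app_nth)
  have fD: "?f ts \<in> ?S \<and> ?g (?f ts) = ts" if "ts \<in> ?D" for ts
  proof -
    have ts: "ts \<in> factorizations n m w" "\<forall>u\<in>set (take s ts). u p = p" "(ts ! s) p \<noteq> p"
      using that by (auto simp: factorizations_fixing_def)
    note len = factorizationsD(1)[OF ts(1)]
    have us: "comps (take s ts) \<in> hyperoctahedral n" and t: "ts ! s \<in> hyperoctahedral n"
      using factorizationsD(2)[OF ts(1)] \<open>s < m\<close> len set_take_subset[of s ts]
      by (auto intro!: comps_hyperoctahedral)
    have nz: "p \<noteq> 0" "(ts ! s) p \<noteq> 0"
      using moved_in_support[OF t ts(3)] by auto
    have ts': "take s ts @ ts ! s # drop (Suc s) ts \<in> factorizations n m w"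
      using ts(1) split[OF len] by simp
    note low = lower_factorization[where us = "take s ts" and t = "ts ! s" and vs = "drop (Suc s) ts"
        and p = p and n = n and m = m and w = w, OF ts' ts(2,3)]
    have "ts[s := srefl p ((ts ! s) p) \<circ> ts ! s] \<in>
        factorizations n m (srefl p (comps (take s ts) ((ts ! s) p)) \<circ> w)"
      unfolding upd[OF len] by (rule low(2))
    then have "ts[s := srefl p ((ts ! s) p) \<circ> ts ! s] \<in>
        factorizations_fixing n m p (Suc s) (srefl p (comps (take s ts) ((ts ! s) p)) \<circ> w)"
      unfolding Suc using ts(2) \<open>s < m\<close> len by (simp add: factorizations_fixing_def)
    with low(1) have "?f ts \<in> ?S"
      by blast
    moreover have "?g (?f ts) = ts"
      using \<open>s < m\<close> len nz inv_f_f[OF hyperoctahedralD(4)[OF us]] by simp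
    ultimately show ?thesis ..
  qed
  have gS: "?g x \<in> ?D \<and> ?f (?g x) = x" if xS: "x \<in> ?S" for x
  proof -
    obtain z ts where x: "x = (z, ts)" and z: "z \<in> lowering n p w"
      and "ts \<in> factorizations_fixing n m p (Suc s) (srefl p z \<circ> w)"
      using xS by (elim SigmaE)
    then have ts: "ts \<in> factorizations n m (srefl p z \<circ> w)" "\<forall>u\<in>set (take s ts). u p = p"
      "(ts ! s) p = p"
      by (auto simp: Suc) (auto simp: factorizations_fixing_def)
    note len = factorizationsD(1)[OF ts(1)]
    have us: "comps (take s ts) \<in> hyperoctahedral n"
      using factorizationsD(2)[OF ts(1)] set_take_subset[of s ts] by (auto intro!: comps_hyperoctahedral)
    have cy: "comps (take s ts) (inv (comps (take s ts)) z) = z"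
      using hyperoctahedralD(3)[OF us] by (simp add: bij_is_surj surj_f_inv_f)
    then have nz: "p \<noteq> 0" "inv (comps (take s ts)) z \<noteq> 0"
      using sp z hyperoctahedral_apply[OF us, of "inv (comps (take s ts)) z"] by (auto simp: lowering_def)
    have ts': "take s ts @ ts ! s # drop (Suc s) ts \<in> factorizations n m (srefl p z \<circ> w)"
      using ts(1) split[OF len] by simp
    note up = raise_factorization[where us = "take s ts" and t = "ts ! s" and vs = "drop (Suc s) ts"
        and p = p and n = n and m = m and w = w, OF ts' w z sp ts(2,3)]
    have "?g x \<in> factorizations n m w"
      unfolding x prod.case upd[OF len] by (rule up(2))
    then have "?g x \<in> ?D"
      using up(1) ts(2,3) \<open>s < m\<close> len by (simp add: x factorizations_fixing_def)
    moreover have "?f (?g x) = x"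
      using \<open>s < m\<close> len nz cy ts(3) by (simp add: x)
    ultimately show ?thesis ..
  qed
  have "card ?D = card ?S"
    using fD gS by (rule card_eq_witness)
  also have "\<dots> = (\<Sum>z\<in>lowering n p w. card (factorizations_fixing n m p (Suc s) (srefl p z \<circ> w)))"
    by (simp add: finite_lowering finite_factorizations_fixing)
  finally have D: "card ?D = \<dots>" .
  have fin: "finite (factorizations_fixing n m p (Suc s) w)" "finite ?D"
    using finite_factorizations_fixing by simp_all
  have "card (factorizations_fixing n m p s w) = card (factorizations_fixing n m p (Suc s) w \<union> ?D)"
    by (rule arg_cong[of _ _ card]) (auto simp: Suc)
  also have "\<dots> = card (factorizations_fixing n m p (Suc s) w) + card ?D"
    by (intro card_Un_disjoint fin) (auto simp: Suc)
  finally show ?thesis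
    by (simp only: D)
qed

section \<open>Factorizations of products with disjoint supports\<close>

definition on_part :: "'a set \<Rightarrow> ('a \<Rightarrow> 'a) \<Rightarrow> 'a \<Rightarrow> 'a" where
  "on_part S t x = (if x \<in> S then t x else x)"

lemma stabilizes_Compl: "stabilizes t S \<Longrightarrow> stabilizes t (- S)"
  by (auto simp: stabilizes_def)

lemma on_part_comp: "stabilizes v S \<Longrightarrow> on_part S (u \<circ> v) = on_part S u \<circ> on_part S v"
  by (auto simp: on_part_def stabilizes_def fun_eq_iff)

lemma on_part_id [simp]: "on_part S id = id"
  by (auto simp: on_part_def fun_eq_iff)

lemma on_part_decomp: "stabilizes t S \<Longrightarrow> on_part S t \<circ> on_part (- S) t = t"
  by (auto simp: on_part_def stabilizes_def fun_eq_iff)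

lemma stabilizes_comps: "(\<And>t. t \<in> set ts \<Longrightarrow> stabilizes t S) \<Longrightarrow> stabilizes (comps ts) S"
proof (induction ts)
  case Nil
  show ?case by (simp add: stabilizes_def)
next
  case (Cons t ts)
  then have "stabilizes (t \<circ> comps ts) S"
    by (intro stabilizes_comp) auto
  then show ?case by (simp add: comp_def)
qed

lemma comps_on_part:
  "(\<And>t. t \<in> set ts \<Longrightarrow> stabilizes t S) \<Longrightarrow> comps (map (on_part S) ts) = on_part S (comps ts)"
proof (induction ts)
  case (Cons t ts)
  have "on_part S (t \<circ> comps ts) = on_part S t \<circ> on_part S (comps ts)"
    using Cons.prems by (intro on_part_comp stabilizes_comps) auto
  with Cons show ?case by (simp add: comp_def)
qed simp

lemma on_part_hyperoctahedral:
  assumes t: "t \<in> hyperoctahedral n" and stab: "stabilizes t S" and sym: "\<And>x. - x \<in> S \<longleftrightarrow> x \<in> S"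
  shows "on_part S t \<in> hyperoctahedral n"
proof -
  have surj: "t (inv t x) = x" for x
    using hyperoctahedralD(3)[OF t] by (simp add: bij_is_surj surj_f_inv_f)
  then have "stabilizes (inv t) S"
    using stab unfolding stabilizes_def by metis
  then have "on_part S t \<circ> on_part S (inv t) = on_part S (t \<circ> inv t)"
    "on_part S (inv t) \<circ> on_part S t = on_part S (inv t \<circ> t)"
    using stab by (simp_all only: on_part_comp)
  moreover have "t \<circ> inv t = id" "inv t \<circ> t = id"
    using surj hyperoctahedralD(4)[OF t] by auto
  ultimately have "bij (on_part S t)"
    by (intro o_bij[of "on_part S (inv t)"]) simp_all
  moreover have "on_part S t (- x) = - on_part S t x" for x
    using sym hyperoctahedralD(2)[OF t] by (simp add: on_part_def)
  moreover have "on_part S t x = x" if "x \<notin> support_set n" for x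
    using that hyperoctahedral_fixes[OF t] by (simp add: on_part_def)
  ultimately show ?thesis
    by (auto simp: hyperoctahedral_def permutes_def bij_iff)
qed

lemma stabilizes_supported:
  assumes "inj u" "\<And>x. x \<notin> S \<Longrightarrow> u x = x"
  shows "stabilizes u S"
  unfolding stabilizes_def using assms by (metis injD)

lemma disjoint_commute:
  assumes "inj u" "inj v" "\<And>x. x \<notin> S \<Longrightarrow> u x = x" "\<And>x. x \<in> S \<Longrightarrow> v x = x"
  shows "u \<circ> v = v \<circ> u"
proof
  fix x
  have "stabilizes u S" "stabilizes v (- S)"
    using assms by (auto intro!: stabilizes_supported)
  with assms show "(u \<circ> v) x = (v \<circ> u) x"
    by (cases "x \<in> S") (auto simp: stabilizes_def)
qed

text \<open>If \<open>u\<close> moves p, then p lies in \<open>S\<close>, so \<open>v\<close> fixes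
  p and the composite sends p to \<open>u p\<close>. Hence the same reflection shortens both
  \<open>u\<close> and the composite by 1.\<close>

lemma absolute_length_disjoint:
  assumes u: "u \<in> hyperoctahedral n" and v: "v \<in> hyperoctahedral n"
    and "\<forall>x. x \<notin> S \<longrightarrow> u x = x" and vS: "\<And>x. x \<in> S \<Longrightarrow> v x = x"
  shows "absolute_length n (u \<circ> v) = absolute_length n u + absolute_length n v"
proof -
  \<comment> \<open>The condition on the support of \<open>u\<close> belongs to the predicate, since
    \<open>u\<close> changes during the induction.\<close>
  define P where "P u \<longleftrightarrow> (\<forall>x. x \<notin> S \<longrightarrow> u x = x) \<longrightarrow>
    absolute_length n (u \<circ> v) = absolute_length n u + absolute_length n v" for u
  from u have "P u"
  proof (induction rule: hyperoctahedral_induct)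
    case id
    show ?case by (simp add: P_def flip: id_def)
  next
    case (step u p)
    show ?case
      unfolding P_def
    proof
      assume uS: "\<forall>x. x \<notin> S \<longrightarrow> u x = x"
      then have "p \<in> S"
        using step.hyps(2) by blast
      then have p: "v p = p" "(u \<circ> v) p \<noteq> p"
        using step.hyps(2) vS by simp_all
      have "\<forall>x. x \<notin> S \<longrightarrow> (srefl p (u p) \<circ> u) x = x"
        using uS moved_srefl_comp[OF step.hyps] by blast
      with step.IH have "absolute_length n ((srefl p (u p) \<circ> u) \<circ> v) =
          absolute_length n (srefl p (u p) \<circ> u) + absolute_length n v"
        unfolding P_def by (simp only: simp_thms)
      moreover have "absolute_length n (u \<circ> v) = Suc (absolute_length n (srefl p ((u \<circ> v) p) \<circ> (u \<circ> v)))"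
        using step.hyps v p by (intro absolute_length_srefl_comp) auto
      ultimately show "absolute_length n (u \<circ> v) = absolute_length n u + absolute_length n v"
        using absolute_length_srefl_comp[OF step.hyps] p(1) by (simp add: comp_assoc)
    qed
  qed
  with assms(3) show ?thesis
    by (simp add: P_def)
qed

lemma comps_map2:
  assumes "length us = length vs"
    and "\<And>u. u \<in> set us \<Longrightarrow> inj u \<and> (\<forall>x. x \<notin> S \<longrightarrow> u x = x)"
    and "\<And>v. v \<in> set vs \<Longrightarrow> inj v \<and> (\<forall>x. x \<in> S \<longrightarrow> v x = x)"
  shows "comps (map2 (\<circ>) us vs) = comps us \<circ> comps vs"
  using assms
proof (induction us vs rule: list_induct2)
  case (Cons u us v vs)
  have "inj (comps us)"
    using Cons.prems(1) by (induction us) (auto intro!: inj_compose)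
  moreover have "comps us x = x" if "x \<notin> S" for x
    using Cons.prems(1) that by (intro comps_fixes) auto
  ultimately have "comps us \<circ> v = v \<circ> comps us"
    using Cons.prems(2)[of v] by (intro disjoint_commute[of _ _ S]) auto
  then show ?case
    using Cons by (simp add: fun_eq_iff)
qed simp

text \<open>The product stabilizes A, hence so does each factor of a minimal factorization. Factors
  are odd, so they stabilize the union \<open>S\<close> of A and -A and split into a part on
  \<open>S\<close> and a part off \<open>S\<close>; multiplying factor by factor is inverse to
  this.\<close>

lemma card_factorizations_fixing_disjoint:
  assumes w1: "w1 \<in> hyperoctahedral n" and w2: "w2 \<in> hyperoctahedral n"
    and A: "A \<subseteq> support_set n" "\<And>a. a \<in> A \<Longrightarrow> - a \<notin> A" and stab: "stabilizes w1 A"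
    and w1_fixes: "\<And>x. x \<notin> A \<Longrightarrow> - x \<notin> A \<Longrightarrow> w1 x = x" and w2_fixes: "\<And>x. x \<in> A \<Longrightarrow> w2 x = x"
  shows "card (factorizations_fixing n m p s (w1 \<circ> w2)) =
    card (factorizations_fixing n m p s w1) * card (factorizations_fixing n m p s w2)"
proof -
  define S where "S = {x. x \<in> A \<or> - x \<in> A}"
  have sym: "- x \<in> S \<longleftrightarrow> x \<in> S" for x
    by (auto simp: S_def)
  have w1S: "w1 x = x" if "x \<notin> S" for x
    using that w1_fixes by (simp add: S_def)
  have w2S: "w2 x = x" if "x \<in> S" for x
    using that w2_fixes[of x] w2_fixes[of "- x"] hyperoctahedralD(2)[OF w2, of x] by (auto simp: S_def)
  have len: "absolute_length n (w1 \<circ> w2) = absolute_length n w1 + absolute_length n w2"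
    using w1S w2S by (intro absolute_length_disjoint[OF w1 w2, of S]) auto
  have "stabilizes w2 A"
    unfolding stabilizes_def using w2_fixes hyperoctahedralD(4)[OF w2] by (metis injD)
  with stab have stabw: "stabilizes (w1 \<circ> w2) A"
    by (rule stabilizes_comp)
  let ?f = "\<lambda>(us, vs). map2 (\<circ>) us vs" and ?g = "\<lambda>ts. (map (on_part S) ts, map (on_part (- S)) ts)"
  let ?X = "factorizations_fixing n m p s w1 \<times> factorizations_fixing n m p s w2"
  let ?Y = "factorizations_fixing n m p s (w1 \<circ> w2)"
  have "?f x \<in> ?Y \<and> ?g (?f x) = x" if x: "x \<in> ?X" for x
  proof -
    obtain us vs where x: "x = (us, vs)" and us: "us \<in> factorizations n m w1"
      and vs: "vs \<in> factorizations n m w2"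
      and fx: "\<forall>t\<in>set (take s us). t p = p" "\<forall>t\<in>set (take s vs). t p = p"
      using x by (auto simp: factorizations_fixing_def)
    note D = factorizationsD[OF us] factorizationsD[OF vs]
    have u: "u \<in> hyperoctahedral n" "\<forall>x. x \<notin> S \<longrightarrow> u x = x" if "u \<in> set us" for u
      using that D(2) factors_fix[OF us that] w1S by auto
    have v: "v \<in> hyperoctahedral n" "\<forall>x. x \<in> S \<longrightarrow> v x = x" if "v \<in> set vs" for v
      using that D(7) factors_fix[OF vs that] w2S by auto
    have "comps (map2 (\<circ>) us vs) = comps us \<circ> comps vs"
      using D(1,6) u v by (intro comps_map2[of _ _ S] conjI hyperoctahedralD(4)) simp_all
    then have comps: "comps (map2 (\<circ>) us vs) = w1 \<circ> w2"
      using D by simp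
    have len_uv: "length us = length vs"
      using D by simp
    have mem: "u \<in> set us" "v \<in> set vs" if "(u, v) \<in> set (zip us vs)" for u v
      using that by (auto dest: set_zip_leftD set_zip_rightD)
    have "absolute_length n (u \<circ> v) = absolute_length n u + absolute_length n v"
      if "(u, v) \<in> set (zip us vs)" for u v
      using mem[OF that] u v by (intro absolute_length_disjoint[of _ _ _ S]) auto
    then have "total_length n (map2 (\<circ>) us vs) =
        sum_list (map2 (\<lambda>u v. absolute_length n u + absolute_length n v) us vs)"
      unfolding map_map by (intro arg_cong[of _ _ sum_list] map_cong) auto
    moreover have "sum_list (map2 (\<lambda>u v. absolute_length n u + absolute_length n v) us vs) =
        total_length n us + total_length n vs"
      using len_uv by (induction us vs rule: list_induct2) auto
    ultimately have tl: "total_length n (map2 (\<circ>) us vs) = absolute_length n (w1 \<circ> w2)"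
      using D len by simp
    have set: "set (map2 (\<circ>) us vs) \<subseteq> hyperoctahedral n"
      using mem u v by auto
    have "take s (map2 (\<circ>) us vs) = map2 (\<circ>) (take s us) (take s vs)"
      by (simp add: take_map take_zip)
    moreover have "(a \<circ> b) p = p" if "(a, b) \<in> set (zip (take s us) (take s vs))" for a b
      using bspec[OF fx(1) set_zip_leftD[OF that]] bspec[OF fx(2) set_zip_rightD[OF that]] by simp
    ultimately have "\<forall>t\<in>set (take s (map2 (\<circ>) us vs)). t p = p"
      by auto
    with comps tl set D have Y: "?f x \<in> ?Y"
      by (simp add: x factorizations_fixing_def factorizations_def)
    have "on_part S (u \<circ> v) = u \<and> on_part (- S) (u \<circ> v) = v" if "(u, v) \<in> set (zip us vs)" for u v
    proof -
      note uv = u[OF mem(1)[OF that]] v[OF mem(2)[OF that]]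
      have "stabilizes v (- S)"
        using uv hyperoctahedralD(4) by (intro stabilizes_supported) auto
      with uv show ?thesis
        by (auto simp: on_part_def fun_eq_iff stabilizes_def)
    qed
    then have "map (on_part S) (map2 (\<circ>) us vs) = map fst (zip us vs)"
      "map (on_part (- S)) (map2 (\<circ>) us vs) = map snd (zip us vs)"
      by auto
    with Y show ?thesis
      using len_uv by (simp add: x)
  qed
  moreover have "?g ts \<in> ?X \<and> ?f (?g ts) = ts" if "ts \<in> ?Y" for ts
  proof -
    have ts: "ts \<in> factorizations n m (w1 \<circ> w2)" "\<forall>t\<in>set (take s ts). t p = p"
      using that by (auto simp: factorizations_fixing_def)
    note D = factorizationsD[OF ts(1)]
    have t: "t \<in> hyperoctahedral n" "stabilizes t S" "stabilizes t (- S)" if "t \<in> set ts" for t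
    proof -
      show th: "t \<in> hyperoctahedral n"
        using that D by auto
      have "stabilizes t A"
        using factors_stabilize[OF ts(1) that A stabw] .
      then show "stabilizes t S"
        using hyperoctahedralD(2)[OF th] by (auto simp: stabilizes_def S_def simp flip: hyperoctahedralD(2)[OF th])
      then show "stabilizes t (- S)"
        by (rule stabilizes_Compl)
    qed
    have on: "on_part S t \<in> hyperoctahedral n" "on_part (- S) t \<in> hyperoctahedral n" if "t \<in> set ts" for t
      using t[OF that] sym by (auto intro!: on_part_hyperoctahedral)
    have "stabilizes w2 (- S)"
      using hyperoctahedralD(4)[OF w2] w2S by (intro stabilizes_supported) auto
    then have "on_part S (w1 \<circ> w2) = w1" "on_part (- S) (w1 \<circ> w2) = w2"
      using w1S w2S by (auto simp: on_part_def fun_eq_iff stabilizes_def)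
    then have comps: "comps (map (on_part S) ts) = w1" "comps (map (on_part (- S)) ts) = w2"
      using t D(3) by (simp_all add: comps_on_part)
    have "absolute_length n t = absolute_length n (on_part S t) + absolute_length n (on_part (- S) t)"
      if "t \<in> set ts" for t
    proof -
      have "absolute_length n (on_part S t \<circ> on_part (- S) t) =
          absolute_length n (on_part S t) + absolute_length n (on_part (- S) t)"
        using on[OF that] by (intro absolute_length_disjoint[of _ _ _ S]) (auto simp: on_part_def)
      then show ?thesis
        using on_part_decomp[OF t(2)[OF that]] by simp
    qed
    then have "total_length n ts = total_length n (map (on_part S) ts) + total_length n (map (on_part (- S)) ts)"
      by (induction ts) auto
    \<comment> \<open>The two total lengths sum to the length of the product, and neither can be
      below the length of its own product; so both words are minimal.\<close>
    moreover have "absolute_length n w1 \<le> total_length n (map (on_part S) ts)"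
      "absolute_length n w2 \<le> total_length n (map (on_part (- S)) ts)"
      using absolute_length_comps_le[of "map (on_part S) ts" n]
        absolute_length_comps_le[of "map (on_part (- S)) ts" n] on comps
      by (simp_all add: image_subset_iff)
    ultimately have tl: "total_length n (map (on_part S) ts) = absolute_length n w1"
      "total_length n (map (on_part (- S)) ts) = absolute_length n w2"
      using D(4) len by linarith+
    have "map (on_part S) ts \<in> factorizations n m w1" "map (on_part (- S)) ts \<in> factorizations n m w2"
      using on tl comps D(1) by (auto simp: factorizations_def)
    moreover have "on_part S t p = p" "on_part (- S) t p = p" if "t \<in> set (take s ts)" for t
      using ts(2) that by (auto simp: on_part_def)
    ultimately have "?g ts \<in> ?X"
      by (simp add: factorizations_fixing_def take_map)
    moreover have "map (\<lambda>t. on_part S t \<circ> on_part (- S) t) ts = ts"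
      using on_part_decomp t by (intro map_idI) auto
    then have "?f (?g ts) = ts"
      by (simp add: zip_map_map zip_same_conv_map comp_def)
    ultimately show ?thesis ..
  qed
  ultimately have "card ?X = card ?Y"
    by (rule card_eq_witness)
  then show ?thesis
    by (simp only: card_cartesian_product)
qed

section \<open>Paired and balanced cycles as products of reflections\<close>

definition signed_list :: "nat \<Rightarrow> int list \<Rightarrow> bool" where
  "signed_list n as \<longleftrightarrow> distinct (map abs as) \<and> set as \<subseteq> support_set n"

text \<open>The paired cycle as ((a1, a2)) ((a2, a3)) ..., rightmost reflection first. In this form
  cutting and merging cycles amounts to cancelling reflections.\<close>

fun pcyc :: "int list \<Rightarrow> int \<Rightarrow> int" where
  "pcyc [] = id"
| "pcyc [a] = id"
| "pcyc (a # b # as) = srefl a b \<circ> pcyc (b # as)"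

text \<open>The last entry is negated before it is sent to the first: [a1, ..., ak] = ((a1, ...,
  ak)) [ak].\<close>

definition bcyc :: "int list \<Rightarrow> int \<Rightarrow> int" where
  "bcyc as = (if as = [] then id else pcyc as \<circ> srefl (last as) (- last as))"

definition negate :: "int set \<Rightarrow> int \<Rightarrow> int" where
  "negate B x = (if \<bar>x\<bar> \<in> B then - x else x)"

lemma signed_list_Cons:
  "signed_list n (a # as) \<longleftrightarrow> a \<in> support_set n \<and> \<bar>a\<bar> \<notin> abs ` set as \<and> signed_list n as"
  by (auto simp: signed_list_def)

lemma signed_list_append:
  "signed_list n (as @ bs) \<longleftrightarrow>
    signed_list n as \<and> signed_list n bs \<and> abs ` set as \<inter> abs ` set bs = {}"
  by (auto simp: signed_list_def)

lemma signed_list_map_uminus: "signed_list n (map uminus as) \<longleftrightarrow> signed_list n as"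
  by (auto simp: signed_list_def comp_def)

lemma signed_list_nz: "signed_list n as \<Longrightarrow> a \<in> set as \<Longrightarrow> a \<noteq> 0"
  by (auto simp: signed_list_def)

lemma signed_list_hd_last:
  assumes "signed_list n as" "as \<noteq> []"
  shows "hd as \<in> support_set n" "last as \<in> support_set n" "hd as \<noteq> 0" "last as \<noteq> 0"
proof -
  have "set as \<subseteq> support_set n"
    using assms(1) by (simp add: signed_list_def)
  with assms(2) show "hd as \<in> support_set n" "last as \<in> support_set n"
    using hd_in_set last_in_set by blast+
  then show "hd as \<noteq> 0" "last as \<noteq> 0"
    by auto
qed

lemma abs_in_image_abs_iff: "\<bar>x :: int\<bar> \<in> abs ` A \<longleftrightarrow> x \<in> A \<or> - x \<in> A"
proof
  assume "\<bar>x\<bar> \<in> abs ` A"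
  then obtain y where "y \<in> A" "\<bar>x\<bar> = \<bar>y\<bar>" by blast
  then show "x \<in> A \<or> - x \<in> A"
    by (auto simp: abs_eq_iff)
next
  assume "x \<in> A \<or> - x \<in> A"
  then show "\<bar>x\<bar> \<in> abs ` A"
    by (metis abs_minus_cancel imageI)
qed

lemma signed_list_uminus_notin:
  assumes "signed_list n as" "a \<in> set as"
  shows "- a \<notin> set as"
proof
  assume "- a \<in> set as"
  moreover have "inj_on abs (set as)"
    using assms by (simp add: signed_list_def distinct_map)
  ultimately have "- a = a"
    using assms(2) by (metis abs_minus_cancel inj_onD)
  then show False
    using signed_list_nz[OF assms] by simp
qed

lemma pcyc_hyperoctahedral: "signed_list n as \<Longrightarrow> pcyc as \<in> hyperoctahedral n"
  by (induction as rule: pcyc.induct) (auto simp: signed_list_Cons intro!: hyperoctahedral_comp srefl_hyperoctahedral)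

lemma srefl_fixes: "x \<notin> {p, z, - p, - z} \<Longrightarrow> srefl p z x = x"
  by (auto simp: srefl_def)

lemma pcyc_fixes: "x \<notin> set as \<Longrightarrow> - x \<notin> set as \<Longrightarrow> pcyc as x = x"
  by (induction as rule: pcyc.induct) (auto simp: srefl_def)

lemma pcyc_last: "signed_list n as \<Longrightarrow> as \<noteq> [] \<Longrightarrow> pcyc as (last as) = hd as"
  by (induction as rule: pcyc.induct) (auto simp: signed_list_Cons)

lemma pcyc_nth:
  "signed_list n as \<Longrightarrow> Suc i < length as \<Longrightarrow> pcyc as (as ! i) = as ! Suc i"
proof (induction as arbitrary: i rule: pcyc.induct)
  case (3 a b as)
  note v = 3(2)[unfolded signed_list_Cons[of n a] abs_in_image_abs_iff de_Morgan_disj]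
  show ?case
  proof (cases i)
    case 0
    then show ?thesis
      using v by (auto simp: pcyc_fixes)
  next
    case (Suc j)
    with 3 v have "pcyc (b # as) ((b # as) ! j) = as ! j"
      by auto
    moreover have "as ! j \<in> set as"
      using 3(3) Suc by simp
    then have "as ! j \<notin> {a, b, - a, - b}"
      using 3(2) by (auto simp: signed_list_Cons abs_in_image_abs_iff)
    ultimately show ?thesis
      using Suc by (simp add: srefl_fixes)
  qed
qed auto

lemma pcyc_append:
  "as \<noteq> [] \<Longrightarrow> bs \<noteq> [] \<Longrightarrow> pcyc (as @ bs) = pcyc as \<circ> srefl (last as) (hd bs) \<circ> pcyc bs"
proof (induction as rule: pcyc.induct)
  case (2 a)
  then show ?case
    by (cases bs) (auto simp: fun_eq_iff)
next
  case (3 a b as)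
  then show ?case
    by (simp add: fun_eq_iff)
qed simp

lemma pcyc_srefl:
  assumes "signed_list n as" "as \<noteq> []" "z \<notin> set as" "- z \<notin> set as"
  shows "pcyc as \<circ> srefl (last as) z = srefl (hd as) z \<circ> pcyc as"
  using hyperoctahedral_conj[OF pcyc_hyperoctahedral[OF assms(1)]] pcyc_last[OF assms(1,2)]
    pcyc_fixes[OF assms(3,4)] by simp

lemma pcyc_srefl_neg:
  assumes "signed_list n as" "as \<noteq> []"
  shows "pcyc as \<circ> srefl (last as) (- last as) = srefl (hd as) (- hd as) \<circ> pcyc as"
  using hyperoctahedral_conj[OF pcyc_hyperoctahedral[OF assms(1)]] pcyc_last[OF assms]
    hyperoctahedralD(2)[OF pcyc_hyperoctahedral[OF assms(1)]] by simp

lemma signed_list_append_notin: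
  assumes "signed_list n (as @ bs)"
  shows "b \<in> set bs \<Longrightarrow> b \<notin> set as \<and> - b \<notin> set as" "a \<in> set as \<Longrightarrow> a \<notin> set bs \<and> - a \<notin> set bs"
  using assms unfolding signed_list_append disjoint_iff
  by (metis abs_in_image_abs_iff image_eqI)+

text \<open>The reflection that joins the two blocks inside \<open>pcyc (as @ bs)\<close> becomes,
  conjugated through \<open>pcyc as\<close>, the one through the two heads, and cancels. So a
  reflection through two entries cuts a paired cycle in two.\<close>

lemma srefl_pcyc_append:
  assumes s: "signed_list n (as @ bs)" and ne: "as \<noteq> []" "bs \<noteq> []"
  shows "srefl (hd as) (hd bs) \<circ> pcyc (as @ bs) = pcyc as \<circ> pcyc bs"
proof -
  have "signed_list n as" "signed_list n bs"
    using s by (simp_all add: signed_list_append)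
  then have nz: "hd as \<noteq> 0" "hd bs \<noteq> 0"
    using ne signed_list_hd_last by blast+
  have "pcyc as \<circ> srefl (last as) (hd bs) = srefl (hd as) (hd bs) \<circ> pcyc as"
    using signed_list_append_notin(1)[OF s, of "hd bs"] ne \<open>signed_list n as\<close>
    by (intro pcyc_srefl) auto
  then have "pcyc (as @ bs) = srefl (hd as) (hd bs) \<circ> (pcyc as \<circ> pcyc bs)"
    using pcyc_append[OF ne] by (simp add: comp_assoc)
  then show ?thesis
    using nz by simp
qed

lemma bcyc_append:
  assumes "as \<noteq> []" "bs \<noteq> []"
  shows "bcyc (as @ bs) = pcyc as \<circ> srefl (last as) (hd bs) \<circ> bcyc bs"
  using assms pcyc_append[OF assms] by (simp add: bcyc_def comp_assoc)

lemma srefl_bcyc_append: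
  assumes s: "signed_list n (as @ bs)" and ne: "as \<noteq> []" "bs \<noteq> []"
  shows "srefl (hd as) (hd bs) \<circ> bcyc (as @ bs) = pcyc as \<circ> bcyc bs"
  using srefl_pcyc_append[OF assms] ne by (simp add: bcyc_def flip: comp_assoc)

lemma bcyc_eq:
  assumes "signed_list n as" "as \<noteq> []"
  shows "bcyc as = srefl (hd as) (- hd as) \<circ> pcyc as"
  using pcyc_srefl_neg[OF assms] assms by (simp add: bcyc_def)

lemma srefl_neg_bcyc:
  assumes "signed_list n as" "as \<noteq> []"
  shows "srefl (hd as) (- hd as) \<circ> bcyc as = pcyc as"
proof -
  have "hd as \<noteq> 0"
    using assms by (rule signed_list_hd_last)
  then show ?thesis
    by (simp add: bcyc_eq[OF assms])
qed

text \<open>A balanced cycle can be cut in two ways: with \<open>hd bs\<close> the block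
  \<open>bs\<close> remains balanced, as in \<open>srefl_bcyc_append\<close>, and with
  \<open>- hd bs\<close> the block \<open>as\<close> does.\<close>

lemma srefl_uminus_bcyc_append:
  assumes s: "signed_list n (as @ bs)" and ne: "as \<noteq> []" "bs \<noteq> []"
  shows "srefl (hd as) (- hd bs) \<circ> bcyc (as @ bs) = bcyc as \<circ> pcyc bs"
proof -
  let ?l = "last as" and ?h = "hd bs"
  have s': "signed_list n as" "signed_list n bs"
    using s by (simp_all add: signed_list_append)
  then have nz: "hd as \<noteq> 0" "?h \<noteq> 0" "?l \<noteq> 0"
    using ne signed_list_hd_last by blast+
  have h: "?h \<notin> set as" "- ?h \<notin> set as"
    using signed_list_append_notin(1)[OF s, of ?h] ne by auto
  have "?h \<noteq> ?l" "?h \<noteq> - ?l"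
    using h ne last_in_set[of as] by (metis, metis add.inverse_inverse)
  \<comment> \<open>Both sides equal [l] ((l, h)), where l is \<open>?l\<close> and h is
    \<open>?h\<close>.\<close>
  then have swap: "srefl ?l ?h \<circ> srefl ?h (- ?h) = srefl ?l (- ?h) \<circ> srefl ?l (- ?l)"
    using nz by (auto simp: srefl_def fun_eq_iff)
  have "bcyc (as @ bs) = pcyc as \<circ> (srefl ?l ?h \<circ> srefl ?h (- ?h)) \<circ> pcyc bs"
    unfolding bcyc_append[OF ne] bcyc_eq[OF s'(2) ne(2)] by (simp add: comp_assoc)
  also have "\<dots> = (pcyc as \<circ> srefl ?l (- ?h)) \<circ> srefl ?l (- ?l) \<circ> pcyc bs"
    unfolding swap by (simp add: comp_assoc)
  also have "pcyc as \<circ> srefl ?l (- ?h) = srefl (hd as) (- ?h) \<circ> pcyc as"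
    using h ne s' by (intro pcyc_srefl) auto
  finally show ?thesis
    using nz ne by (simp add: bcyc_def fun_eq_iff)
qed

lemma pcyc_map_uminus:
  assumes "0 \<notin> set as"
  shows "pcyc (map uminus as) = pcyc as"
  using assms by (induction as rule: pcyc.induct) (auto simp: srefl_uminus)

lemma bcyc_map_uminus:
  assumes "0 \<notin> set as"
  shows "bcyc (map uminus as) = bcyc as"
proof (cases "as = []")
  case False
  then have "last as \<noteq> 0"
    using assms last_in_set[of as] by metis
  then show ?thesis
    using False pcyc_map_uminus[OF assms] srefl_uminus[of "last as" "- last as"]
    by (simp add: bcyc_def last_map)
qed simp

text \<open>The underlying cycle passes through every entry and its negative, so it may be read from
  any of them; after one step the first entry reappears negated at the end.\<close>

lemma bcyc_rotate1:
  assumes s: "signed_list n (a # bs)"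
  shows "bcyc (bs @ [- a]) = bcyc (a # bs)"
proof (cases "bs = []")
  case True
  then show ?thesis
    using s by (simp add: bcyc_def signed_list_Cons srefl_commute)
next
  case ne: False
  let ?l = "last bs"
  have sb: "signed_list n bs" and a: "a \<noteq> 0" "a \<notin> set bs" "- a \<notin> set bs"
    using s by (auto simp: signed_list_Cons abs_in_image_abs_iff)
  have l: "?l \<noteq> a" "?l \<noteq> - a" "?l \<noteq> 0"
    using a(2,3) last_in_set[OF ne] signed_list_nz[OF sb last_in_set[OF ne]] by metis+
  have swap: "srefl ?l (- a) \<circ> srefl (- a) a = srefl ?l a \<circ> srefl ?l (- ?l)"
    using l a by (auto simp: srefl_def fun_eq_iff)
  have "bcyc (bs @ [- a]) = pcyc bs \<circ> (srefl ?l (- a) \<circ> srefl (- a) a)"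
    using bcyc_append[OF ne, of "[- a]"] by (simp add: bcyc_def comp_assoc)
  also have "\<dots> = (pcyc bs \<circ> srefl ?l a) \<circ> srefl ?l (- ?l)"
    unfolding swap by (simp add: comp_assoc)
  also have "pcyc bs \<circ> srefl ?l a = srefl (hd bs) a \<circ> pcyc bs"
    using a sb ne by (intro pcyc_srefl) auto
  also have "srefl (hd bs) a = srefl a (hd bs)"
    by (rule srefl_commute)
  also have "srefl a (hd bs) \<circ> pcyc bs = pcyc (a # bs)"
    using ne by (cases bs) auto
  finally show ?thesis
    using ne by (simp add: bcyc_def fun_eq_iff)
qed

lemma bcyc_rotate:
  "signed_list n (as @ bs) \<Longrightarrow> bcyc (bs @ map uminus as) = bcyc (as @ bs)"
proof (induction as arbitrary: bs)
  case (Cons a as)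
  have s: "signed_list n (a # as @ bs)"
    using Cons.prems by simp
  then have "signed_list n (as @ bs @ [- a])"
    by (auto simp: signed_list_Cons signed_list_append signed_list_def[of n "[]"])
  then have "bcyc ((bs @ [- a]) @ map uminus as) = bcyc (as @ bs @ [- a])"
    using Cons.IH[of "bs @ [- a]"] by (simp del: map_append)
  with bcyc_rotate1[OF s] show ?case
    by simp
qed simp

text \<open>With z = \<open>hd as\<close>, the identity ((p, z)) [p] [z] = ((p, -z)) merges two
  balanced cycles into one paired cycle. The negated entries come from the -z.\<close>

lemma srefl_merge_bcyc:
  assumes s: "signed_list n (p # as)" and ne: "as \<noteq> []"
  shows "srefl p (hd as) \<circ> (srefl p (- p) \<circ> bcyc as) = pcyc (p # map uminus as)"
proof -
  let ?z = "hd as"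
  have sa: "signed_list n as" and p: "p \<noteq> 0" "p \<notin> set as" "- p \<notin> set as"
    using s by (auto simp: signed_list_Cons abs_in_image_abs_iff)
  have z: "?z \<noteq> p" "?z \<noteq> - p" "?z \<noteq> 0"
    using p(2,3) hd_in_set[OF ne] signed_list_nz[OF sa hd_in_set[OF ne]] by metis+
  have swap: "srefl p ?z \<circ> (srefl p (- p) \<circ> srefl ?z (- ?z)) = srefl p (- ?z)"
    using z p by (auto simp: srefl_def fun_eq_iff)
  have "srefl p ?z \<circ> (srefl p (- p) \<circ> bcyc as) = srefl p ?z \<circ> (srefl p (- p) \<circ> srefl ?z (- ?z)) \<circ> pcyc as"
    unfolding bcyc_eq[OF sa ne] by (simp add: comp_assoc)
  also have "\<dots> = srefl p (- ?z) \<circ> pcyc (map uminus as)"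
    unfolding swap using pcyc_map_uminus[of as] signed_list_nz[OF sa] by fastforce
  also have "\<dots> = pcyc (p # map uminus as)"
    using ne by (cases as) auto
  finally show ?thesis .
qed

lemma bcyc_hyperoctahedral: "signed_list n as \<Longrightarrow> bcyc as \<in> hyperoctahedral n"
  using signed_list_hd_last(2)[of n as]
  by (auto simp: bcyc_def intro!: hyperoctahedral_comp srefl_hyperoctahedral pcyc_hyperoctahedral)

lemma bcyc_fixes: "x \<notin> set as \<Longrightarrow> - x \<notin> set as \<Longrightarrow> bcyc as x = x"
  using last_in_set[of as] by (cases "as = []") (auto simp: bcyc_def srefl_def pcyc_fixes)

lemma stabilizes_pcyc:
  assumes "set as \<subseteq> A" "\<And>a. a \<in> A \<Longrightarrow> - a \<notin> A"
  shows "stabilizes (pcyc as) A"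
  using assms(1)
proof (induction as rule: pcyc.induct)
  case (3 a b as)
  have "stabilizes (srefl a b) A"
    using 3(2) assms(2) unfolding stabilizes_def srefl_def by (smt (verit) insert_subset list.simps(15) minus_minus)
  with 3 have "stabilizes (srefl a b \<circ> pcyc (b # as)) A"
    by (intro stabilizes_comp) auto
  then show ?case
    by (simp add: comp_def)
qed (auto simp: stabilizes_def)

lemma absolute_length_pcyc: "signed_list n as \<Longrightarrow> absolute_length n (pcyc as) = length as - 1"
proof (induction as rule: pcyc.induct)
  case (3 a b as)
  have v: "a \<noteq> b" "a \<noteq> 0" "b \<noteq> 0"
    using 3(2) by (auto simp: signed_list_Cons)
  have a: "pcyc (a # b # as) a = b"
    using pcyc_nth[OF 3(2), of 0] by simp
  then have "absolute_length n (pcyc (a # b # as)) = Suc (absolute_length n (srefl a b \<circ> pcyc (a # b # as)))"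
    using absolute_length_srefl_comp[OF pcyc_hyperoctahedral[OF 3(2)], of a] v by simp
  also have "srefl a b \<circ> pcyc (a # b # as) = pcyc (b # as)"
    using v by simp
  finally show ?case
    using 3 by (simp add: signed_list_Cons)
qed (simp_all flip: id_def)

lemma absolute_length_bcyc: "signed_list n as \<Longrightarrow> absolute_length n (bcyc as) = length as"
proof (induction as rule: pcyc.induct)
  case (2 a)
  have a: "bcyc [a] = srefl a (- a)" "a \<noteq> 0"
    using 2 by (auto simp: bcyc_def signed_list_Cons)
  then have "srefl a (bcyc [a] a) \<circ> bcyc [a] = id"
    by simp
  with a show ?case
    using absolute_length_srefl_comp[OF bcyc_hyperoctahedral[OF 2], of a] by simp
next
  case (3 a b as)
  have v: "a \<noteq> b" "a \<noteq> 0" "b \<noteq> 0" "signed_list n (b # as)" "a \<notin> set (b # as)" "- a \<notin> set (b # as)"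
    using 3(2) by (auto simp: signed_list_Cons abs_in_image_abs_iff)
  have eq: "bcyc (a # b # as) = srefl a b \<circ> bcyc (b # as)"
    using bcyc_append[of "[a]" "b # as"] by simp
  then have "bcyc (a # b # as) a = b" "srefl a b \<circ> bcyc (a # b # as) = bcyc (b # as)"
    using bcyc_fixes[OF v(5,6)] v by simp_all
  with absolute_length_srefl_comp[OF bcyc_hyperoctahedral[OF 3(2)], of a] v 3(1)
  show ?case
    by simp
qed (simp add: bcyc_def)

section \<open>Counting minimal factorizations\<close>

text \<open>\<open>fuss m n s\<close> is the coefficient of \<open>x ^ n\<close> in \<open>T ^ s\<close>, where \<open>T = 1 + x T ^ m\<close>, and
  \<open>shifted_binomial m n s\<close> is the one in \<open>T ^ s / (1 - m x T ^ (m - 1))\<close>.\<close>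

fun fuss :: "nat \<Rightarrow> nat \<Rightarrow> nat \<Rightarrow> nat" where
  "fuss m 0 s = 1"
| "fuss m (Suc n) 0 = 0"
| "fuss m (Suc n) (Suc s) = fuss m (Suc n) s + fuss m n (s + m)"

definition shifted_binomial :: "nat \<Rightarrow> nat \<Rightarrow> nat \<Rightarrow> nat" where
  "shifted_binomial m n s = (m * n + s) choose n"

lemma shifted_binomial_0 [simp]: "shifted_binomial m 0 s = 1"
  by (simp add: shifted_binomial_def)

lemma shifted_binomial_Suc:
  "shifted_binomial m (Suc n) (Suc s) = shifted_binomial m (Suc n) s + shifted_binomial m n (s + m)"
  by (simp add: shifted_binomial_def algebra_simps)

text \<open>In terms of series this is T^s (T^t F) = T^(s+t) F, with F = 1 for \<open>fuss\<close>
  and F = 1 / (1 - m x T^(m-1)) for \<open>shifted_binomial\<close>. For fixed t both sides agree at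
  s = 0 and obey the same recursion in s.\<close>

lemma fuss_convolution_gen:
  fixes H :: "nat \<Rightarrow> nat \<Rightarrow> nat"
  assumes H0: "\<And>s. H 0 s = 1" and H: "\<And>n s. H (Suc n) (Suc s) = H (Suc n) s + H n (s + m)"
  shows "(\<Sum>i\<le>n. fuss m i s * H (n - i) t) = H n (s + t)"
proof (induction n arbitrary: s)
  case 0
  show ?case by (simp add: H0)
next
  case (Suc n)
  show ?case
  proof (induction s)
    case 0
    show ?case
      by (subst sum.atMost_Suc_shift) simp
  next
    case (Suc s)
    \<comment> \<open>The recursion of \<open>fuss\<close> applies to the summands with positive
      index only; the summand at 0 does not depend on s and stays in the first group.\<close>
    have "(\<Sum>i\<le>Suc n. fuss m i (Suc s) * H (Suc n - i) t) =
        (H (Suc n) t + (\<Sum>i\<le>n. fuss m (Suc i) s * H (n - i) t)) + (\<Sum>i\<le>n. fuss m i (s + m) * H (n - i) t)"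
      by (subst sum.atMost_Suc_shift) (simp add: sum.distrib algebra_simps)
    also have "H (Suc n) t + (\<Sum>i\<le>n. fuss m (Suc i) s * H (n - i) t) = (\<Sum>i\<le>Suc n. fuss m i s * H (Suc n - i) t)"
      by (subst sum.atMost_Suc_shift) simp
    also have "\<dots> = H (Suc n) (s + t)"
      by (rule Suc.IH)
    also have "(\<Sum>i\<le>n. fuss m i (s + m) * H (n - i) t) = H n (s + m + t)"
      by (rule \<open>\<And>s. (\<Sum>i\<le>n. fuss m i s * H (n - i) t) = H n (s + t)\<close>)
    also have "H (Suc n) (s + t) + H n (s + m + t) = H (Suc n) (Suc s + t)"
      using H[of n "s + t"] by (simp add: algebra_simps)
    finally show ?case .
  qed
qed

lemmas fuss_convolution = fuss_convolution_gen[where H = "fuss m" for m, OF fuss.simps(1,3)]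
lemmas shifted_binomial_convolution =
  fuss_convolution_gen[where H = "shifted_binomial m" for m, OF shifted_binomial_0 shifted_binomial_Suc]

lemma lowering_length:
  assumes w: "w \<in> hyperoctahedral n" and p: "p \<in> support_set n" and z: "z \<in> lowering n p w"
  shows "absolute_length n (srefl p z \<circ> (srefl p z \<circ> w)) =
    absolute_length n (srefl p z) + absolute_length n (srefl p z \<circ> w)"
proof -
  have z: "z \<in> support_set n" "z \<noteq> p" "Suc (absolute_length n (srefl p z \<circ> w)) = absolute_length n w"
    using z by (auto simp: lowering_def)
  have "absolute_length n (srefl p z) \<le> 1"
    using absolute_length_le[of "[srefl p z]" n] srefl_in_reflections[OF p z(1)] z(2) by simp
  moreover have "absolute_length n (srefl p z \<circ> (srefl p z \<circ> w)) \<le>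
      absolute_length n (srefl p z) + absolute_length n (srefl p z \<circ> w)"
    using w p z(1) by (intro absolute_length_comp_le hyperoctahedral_comp srefl_hyperoctahedral)
  moreover have "srefl p z \<circ> (srefl p z \<circ> w) = w"
    using p z by auto
  ultimately show ?thesis
    using z(3) by simp
qed

text \<open>A reflection in \<open>lowering\<close> is the first factor of a length-additive product
  equal to \<open>w\<close>, so it inherits A; a reflection that exchanges p and z does so only if
  both or neither lie in A.\<close>

lemma lowering_stabilizes:
  assumes w: "w \<in> hyperoctahedral n" and p: "p \<in> support_set n" and z: "z \<in> lowering n p w"
    and A: "A \<subseteq> support_set n" "\<And>a. a \<in> A \<Longrightarrow> - a \<notin> A" "stabilizes w A"
  shows "z \<in> A \<longleftrightarrow> p \<in> A"
proof -
  have zs: "z \<in> support_set n"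
    using z by (auto simp: lowering_def)
  then have "srefl p z \<circ> (srefl p z \<circ> w) = w"
    using p by auto
  then have "stabilizes (srefl p z \<circ> (srefl p z \<circ> w)) A"
    using A(3) by simp
  then have "stabilizes (srefl p z) A"
    using stabilizes_factors(1)[OF _ _ lowering_length[OF w p z] A(1,2)] p zs w by blast
  then have "srefl p z p \<in> A \<longleftrightarrow> p \<in> A"
    unfolding stabilizes_def by blast
  then show ?thesis
    by simp
qed

lemma lowering_moved:
  assumes w: "w \<in> hyperoctahedral n" and p: "p \<in> support_set n" and z: "z \<in> lowering n p w"
  shows "w z \<noteq> z"
proof
  assume "w z = z"
  then have "stabilizes w {z}"
    using stabilizes_singleton[OF hyperoctahedralD(4)[OF w]] by simp
  moreover have "z \<in> support_set n" "z \<noteq> p"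
    using z by (auto simp: lowering_def)
  ultimately show False
    using lowering_stabilizes[OF w p z, of "{z}"] by auto
qed

lemma absolute_length_pcyc_comp:
  assumes "signed_list n as" "v \<in> hyperoctahedral n" "\<And>x. x \<in> set as \<Longrightarrow> v x = x"
  shows "absolute_length n (pcyc as \<circ> v) = length as - 1 + absolute_length n v"
proof -
  have "v x = x" if "- x \<in> set as" for x
    using assms(3)[OF that] hyperoctahedralD(2)[OF assms(2)] by simp
  then show ?thesis
    using absolute_length_disjoint[OF pcyc_hyperoctahedral[OF assms(1)] assms(2),
        of "{x. x \<in> set as \<or> - x \<in> set as}"]
      assms(3) pcyc_fixes absolute_length_pcyc[OF assms(1)] by auto
qed

lemma card_factorizations_fixing_pcyc_comp:
  assumes "signed_list n as" "v \<in> hyperoctahedral n" "\<And>x. x \<in> set as \<Longrightarrow> v x = x"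
  shows "card (factorizations_fixing n m p s (pcyc as \<circ> v)) =
    card (factorizations_fixing n m p s (pcyc as)) * card (factorizations_fixing n m p s v)"
  using assms signed_list_uminus_notin[OF assms(1)] pcyc_fixes
  by (intro card_factorizations_fixing_disjoint[where A = "set as"] pcyc_hyperoctahedral stabilizes_pcyc)
    (auto simp: signed_list_def)

lemma bcyc_pcyc_commute:
  assumes "signed_list n (as @ bs)"
  shows "bcyc as \<circ> pcyc bs = pcyc bs \<circ> bcyc as"
proof (rule disjoint_commute[where S = "{x. x \<in> set as \<or> - x \<in> set as}"])
  have s: "signed_list n as" "signed_list n bs"
    using assms by (simp_all add: signed_list_append)
  then show "inj (bcyc as)" "inj (pcyc bs)"
    using hyperoctahedralD(4) bcyc_hyperoctahedral pcyc_hyperoctahedral by blast+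
  show "bcyc as x = x" if "x \<notin> {x. x \<in> set as \<or> - x \<in> set as}" for x
    using that by (intro bcyc_fixes) auto
  show "pcyc bs x = x" if "x \<in> {x. x \<in> set as \<or> - x \<in> set as}" for x
    using that signed_list_append_notin(2)[OF assms, of x] signed_list_append_notin(2)[OF assms, of "- x"]
    by (intro pcyc_fixes) auto
qed

text \<open>Invariance of the set of entries excludes all other z, in particular the negated
  entries. Conversely, an entry cuts the cycle in two, and the lengths of the pieces sum to one
  less.\<close>

lemma lowering_pcyc:
  assumes s: "signed_list n (p # as)"
  shows "lowering n p (pcyc (p # as)) = set as"
proof (intro equalityI subsetI)
  note w = pcyc_hyperoctahedral[OF s]
  have p: "p \<in> support_set n"
    using s by (simp add: signed_list_Cons)
  fix z
  assume z: "z \<in> lowering n p (pcyc (p # as))"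
  have "z \<in> set (p # as) \<longleftrightarrow> p \<in> set (p # as)"
    using s signed_list_uminus_notin[OF s]
    by (intro lowering_stabilizes[OF w p z] stabilizes_pcyc) (auto simp: signed_list_def)
  then show "z \<in> set as"
    using z by (auto simp: lowering_def)
next
  fix z
  assume "z \<in> set as"
  then obtain xs ys where as: "as = xs @ z # ys"
    by (auto dest: split_list)
  have s': "signed_list n ((p # xs) @ (z # ys))"
    using s by (simp add: as)
  have s'': "signed_list n (p # xs)" "signed_list n (z # ys)"
    using s' unfolding signed_list_append by blast+
  have "srefl p z \<circ> pcyc (p # as) = pcyc (p # xs) \<circ> pcyc (z # ys)"
    using srefl_pcyc_append[OF s'] by (simp add: as)
  moreover have "absolute_length n (pcyc (p # xs) \<circ> pcyc (z # ys)) = length xs + length ys"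
    using s'' absolute_length_pcyc[OF s''(2)] signed_list_append_notin(2)[OF s']
    by (subst absolute_length_pcyc_comp) (auto intro!: pcyc_hyperoctahedral pcyc_fixes)
  moreover have "absolute_length n (pcyc (p # as)) = Suc (length xs + length ys)"
    using absolute_length_pcyc[OF s] by (simp add: as)
  moreover have "z \<in> support_set n" "z \<noteq> p"
    using s by (auto simp: as signed_list_Cons signed_list_append)
  ultimately show "z \<in> lowering n p (pcyc (p # as))"
    by (simp add: lowering_def)
qed

lemma sum_set_distinct:
  assumes "distinct as"
  shows "(\<Sum>z\<in>set as. g z) = (\<Sum>i<length as. g (as ! i))"
  using assms by (intro sum.reindex_bij_betw[symmetric] bij_betw_nth) auto

lemma signed_list_distinct: "signed_list n as \<Longrightarrow> distinct as"
  by (auto simp: signed_list_def distinct_map)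

text \<open>Here d counts the trailing factors that may move p. Cutting at \<open>as ! i\<close>
  leaves a cycle of i + 1 entries through p, with d such factors, and a cycle away from p with all m
  factors free; summing over i is a convolution and yields the recursion of
  \<open>fuss\<close>.\<close>

lemma card_factorizations_fixing_pcyc:
  assumes "signed_list n (p # as)" "d \<le> m"
  shows "card (factorizations_fixing n m p (m - d) (pcyc (p # as))) = fuss m (length as) d"
  using assms
proof (induction "length as" arbitrary: p as d rule: less_induct)
  case (less as p d)
  have s: "signed_list n (p # as)"
    using less.prems by blast
  have p: "p \<in> support_set n"
    using s by (simp add: signed_list_Cons)
  show ?case
  proof (cases as)
    case Nil
    then show ?thesis
      by (simp add: factorizations_fixing_eq factorizations_id)
  next
    case (Cons b bs)
    let ?w = "pcyc (p # as)"
    have w: "?w \<in> hyperoctahedral n"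
      by (rule pcyc_hyperoctahedral[OF s])
    have moved: "?w p \<noteq> p"
      using pcyc_nth[OF s, of 0] s Cons by (auto simp: signed_list_Cons)
    from less.prems(2) show ?thesis
    proof (induction d)
      case 0
      show ?case
        using factorizations_fixing_all[of ?w p n m] moved by (simp add: Cons del: pcyc.simps)
    next
      case (Suc d)
      have summand: "card (factorizations_fixing n m p (m - d) (srefl p (as ! i) \<circ> ?w)) =
          fuss m i d * fuss m (length bs - i) m" if i: "i < length as" for i
      proof -
        let ?xs = "p # take i as" and ?ys = "drop i as"
        have ys: "?ys = as ! i # drop (Suc i) as"
          using i by (simp add: Cons_nth_drop_Suc)
        have s': "signed_list n (?xs @ ?ys)"
          using s by simp
        then have s'': "signed_list n ?xs" "signed_list n ?ys" and ne: "?ys \<noteq> []"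
          using ys unfolding signed_list_append by simp_all
        have pc: "pcyc ?ys x = x" if "x \<in> set ?xs" for x
          using signed_list_append_notin(2)[OF s' that] by (intro pcyc_fixes) auto
        have "srefl p (as ! i) \<circ> ?w = pcyc ?xs \<circ> pcyc ?ys"
          using srefl_pcyc_append[OF s'] ne i by (simp add: hd_drop_conv_nth)
        then have "card (factorizations_fixing n m p (m - d) (srefl p (as ! i) \<circ> ?w)) =
            card (factorizations_fixing n m p (m - d) (pcyc ?xs)) *
            card (factorizations_fixing n m p (m - d) (pcyc ?ys))"
          using pc s'' by (simp only: card_factorizations_fixing_pcyc_comp pcyc_hyperoctahedral)
        also have "card (factorizations_fixing n m p (m - d) (pcyc ?xs)) = fuss m i d"
          using less.hyps[of "take i as" p d] i s'' Suc.prems by simp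
        \<comment> \<open>This cycle fixes p, so the constraint is vacuous. Writing it as the
          vacuous constraint m - m = 0 at its own head brings it into the form of the induction
          hypothesis with d = m.\<close>
        also have "factorizations_fixing n m p (m - d) (pcyc ?ys) =
            factorizations_fixing n m (as ! i) (m - m) (pcyc ?ys)"
          using pc by (simp add: factorizations_fixing_eq factorizations_fixing_0)
        also have "card \<dots> = fuss m (length bs - i) m"
          using less.hyps[of "drop (Suc i) as" "as ! i" m] i s'' Suc.prems Cons ys by simp
        finally show ?thesis .
      qed
      have "card (factorizations_fixing n m p (m - Suc d) ?w) = card (factorizations_fixing n m p (m - d) ?w) +
          (\<Sum>z\<in>set as. card (factorizations_fixing n m p (m - d) (srefl p z \<circ> ?w)))"
        using card_factorizations_fixing_rec[OF w p, of "m - Suc d" m] Suc.prems lowering_pcyc[OF s]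
        by (simp add: Suc_diff_Suc)
      also have "(\<Sum>z\<in>set as. card (factorizations_fixing n m p (m - d) (srefl p z \<circ> ?w))) =
          (\<Sum>i<length as. fuss m i d * fuss m (length bs - i) m)"
        using s summand by (subst sum_set_distinct) (auto simp: signed_list_Cons signed_list_distinct)
      also have "\<dots> = fuss m (length bs) (d + m)"
        using fuss_convolution[of m d "length bs" m] by (simp add: Cons lessThan_Suc_atMost)
      finally show ?case
        using Suc by (simp add: Cons)
    qed
  qed
qed

section \<open>A single balanced cycle\<close>

lemma bcyc_hd_moved:
  assumes "signed_list n (p # as)"
  shows "bcyc (p # as) p \<noteq> p"
proof (cases as)
  case Nil
  then show ?thesis
    using assms by (simp add: bcyc_def signed_list_Cons)
next
  case (Cons b bs)
  have "bcyc as p = p"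
    using assms by (intro bcyc_fixes) (auto simp: signed_list_Cons abs_in_image_abs_iff)
  then have "bcyc (p # as) p = b"
    using bcyc_append[of "[p]" as] Cons by simp
  then show ?thesis
    using assms by (auto simp: signed_list_Cons Cons)
qed

text \<open>In contrast to a paired cycle, both signs of every entry occur, and so does -p: each
  moved point other than p gives a reflection below the cycle.\<close>

lemma lowering_bcyc:
  assumes s: "signed_list n (p # as)"
  shows "lowering n p (bcyc (p # as)) = set as \<union> uminus ` set as \<union> {- p}"
proof (intro equalityI subsetI)
  note w = bcyc_hyperoctahedral[OF s]
  have p: "p \<in> support_set n"
    using s by (simp add: signed_list_Cons)
  fix z
  assume z: "z \<in> lowering n p (bcyc (p # as))"
  have "z \<in> set (p # as) \<or> - z \<in> set (p # as)"
    using lowering_moved[OF w p z] bcyc_fixes by blast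
  moreover have "z \<noteq> p"
    using z by (auto simp: lowering_def)
  moreover have "z \<in> uminus ` set as \<longleftrightarrow> - z \<in> set as"
    by (force simp: image_iff)
  ultimately show "z \<in> set as \<union> uminus ` set as \<union> {- p}"
    by auto
next
  have p: "p \<in> support_set n"
    using s by (simp add: signed_list_Cons)
  have len: "absolute_length n (bcyc (p # as)) = Suc (length as)"
    using absolute_length_bcyc[OF s] by simp
  have low: "a \<in> lowering n p (bcyc (p # as)) \<and> - a \<in> lowering n p (bcyc (p # as))" if a: "a \<in> set as" for a
  proof -
    obtain xs ys where as: "as = xs @ a # ys"
      using a by (auto dest: split_list)
    have s': "signed_list n ((p # xs) @ (a # ys))"
      using s by (simp add: as)
    have s'': "signed_list n (p # xs)" "signed_list n (a # ys)"
      using s' unfolding signed_list_append by blast+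
    have 1: "srefl p a \<circ> bcyc (p # as) = pcyc (p # xs) \<circ> bcyc (a # ys)"
      using srefl_bcyc_append[OF s'] by (simp add: as)
    have 2: "srefl p (- a) \<circ> bcyc (p # as) = pcyc (a # ys) \<circ> bcyc (p # xs)"
      using srefl_uminus_bcyc_append[OF s'] bcyc_pcyc_commute[OF s'] by (simp add: as)
    have "absolute_length n (srefl p a \<circ> bcyc (p # as)) = length as"
      unfolding 1 using s'' absolute_length_bcyc[OF s''(2)] signed_list_append_notin(2)[OF s']
      by (subst absolute_length_pcyc_comp) (auto simp: as intro!: bcyc_hyperoctahedral bcyc_fixes)
    moreover have "absolute_length n (srefl p (- a) \<circ> bcyc (p # as)) = length as"
      unfolding 2 using s'' absolute_length_bcyc[OF s''(1)] signed_list_append_notin(1)[OF s']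
      by (subst absolute_length_pcyc_comp) (auto simp: as intro!: bcyc_hyperoctahedral bcyc_fixes)
    moreover have "a \<noteq> p" "a \<noteq> - p" "a \<in> support_set n"
      using s by (auto simp: as signed_list_Cons signed_list_append)
    ultimately show ?thesis
      using len by (auto simp: lowering_def)
  qed
  have "srefl p (- p) \<circ> bcyc (p # as) = pcyc (p # as)"
    using srefl_neg_bcyc[OF s] by simp
  then have "- p \<in> lowering n p (bcyc (p # as))"
    using p len absolute_length_pcyc[OF s] by (simp add: lowering_def)
  with low show "z \<in> lowering n p (bcyc (p # as))" if "z \<in> set as \<union> uminus ` set as \<union> {- p}" for z
    using that by auto
qed

lemma sum_signed_set:
  fixes g :: "int \<Rightarrow> nat"
  assumes "finite A" "\<And>a. a \<in> A \<Longrightarrow> - a \<notin> A"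
  shows "(\<Sum>z\<in>A \<union> uminus ` A. g z) = (\<Sum>z\<in>A. g z) + (\<Sum>z\<in>A. g (- z))"
  using assms by (subst sum.union_disjoint) (auto simp: sum.reindex inj_on_def)

text \<open>Absorption for binomial coefficients. The left side is what the constrained count for a
  balanced cycle becomes when all m factors are free.\<close>

lemma shifted_binomial_full: "m * shifted_binomial m n (m - 1) = shifted_binomial m (Suc n) 0"
proof (cases m)
  case (Suc m')
  have "Suc n * shifted_binomial m (Suc n) 0 = (m * Suc n) * ((m * Suc n - 1) choose n)"
    by (simp only: shifted_binomial_def binomial_absorption add_0_right)
  also have "m * Suc n - 1 = m * n + (m - 1)"
    using Suc by simp
  finally have "Suc n * shifted_binomial m (Suc n) 0 = Suc n * (m * shifted_binomial m n (m - 1))"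
    by (simp only: shifted_binomial_def mult_ac)
  then show ?thesis
    by (simp only: mult_cancel1) simp
qed (simp add: shifted_binomial_def)

text \<open>The points \<open>as ! i\<close> leave p in a paired cycle, the points
  \<open>- (as ! i)\<close> leave p in the balanced cycle, and -p turns the whole cycle into a
  paired one. At d = 0 the factor d makes the truncated d - 1 harmless.\<close>

lemma card_factorizations_fixing_bcyc:
  assumes "signed_list n (p # as)" "d \<le> m"
  shows "card (factorizations_fixing n m p (m - d) (bcyc (p # as))) =
    d * shifted_binomial m (length as) (d - 1)"
  using assms
proof (induction "length as" arbitrary: p as d rule: less_induct)
  case (less as p d)
  have s: "signed_list n (p # as)"
    using less.prems by blast
  have p: "p \<in> support_set n" and sas: "signed_list n as"
    using s by (simp_all add: signed_list_Cons)
  let ?w = "bcyc (p # as)" and ?L = "length as"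
  have w: "?w \<in> hyperoctahedral n"
    by (rule bcyc_hyperoctahedral[OF s])
  from less.prems(2) show ?case
  proof (induction d)
    case 0
    show ?case
      using factorizations_fixing_all[of ?w p n m] bcyc_hd_moved[OF s] by simp
  next
    case (Suc d)
    let ?c = "\<lambda>v. card (factorizations_fixing n m p (m - d) v)"
    have terms: "?c (srefl p (as ! i) \<circ> ?w) = fuss m i d * shifted_binomial m (?L - i) 0"
        "?c (srefl p (- (as ! i)) \<circ> ?w) = fuss m (?L - 1 - i) m * (d * shifted_binomial m i (d - 1))"
      if i: "i < ?L" for i
    proof -
      let ?xs = "p # take i as" and ?ys = "drop i as"
      have ys: "?ys = as ! i # drop (Suc i) as"
        using i by (simp add: Cons_nth_drop_Suc)
      have s': "signed_list n (?xs @ ?ys)"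
        using s by simp
      then have s'': "signed_list n ?xs" "signed_list n ?ys" and ne: "?ys \<noteq> []"
        using ys unfolding signed_list_append by simp_all
      have fx: "pcyc ?ys x = x" "bcyc ?ys x = x" if "x \<in> set ?xs" for x
        using signed_list_append_notin(2)[OF s' that] by (auto intro!: pcyc_fixes bcyc_fixes)
      have fy: "bcyc ?xs y = y" if "y \<in> set ?ys" for y
        using signed_list_append_notin(1)[OF s' that] by (auto intro!: bcyc_fixes)
      have hd: "hd ?ys = as ! i"
        using i by (simp add: hd_drop_conv_nth)
      have "srefl p (as ! i) \<circ> ?w = pcyc ?xs \<circ> bcyc ?ys"
        using srefl_bcyc_append[OF s'] ne hd by simp
      then have "?c (srefl p (as ! i) \<circ> ?w) = ?c (pcyc ?xs) * ?c (bcyc ?ys)"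
        using fx s'' by (simp only: card_factorizations_fixing_pcyc_comp bcyc_hyperoctahedral)
      also have "?c (pcyc ?xs) = fuss m i d"
        using card_factorizations_fixing_pcyc[OF s''(1), of d m] Suc.prems i by simp
      also have "factorizations_fixing n m p (m - d) (bcyc ?ys) =
          factorizations_fixing n m (as ! i) (m - m) (bcyc ?ys)"
        using fx by (simp add: factorizations_fixing_eq factorizations_fixing_0)
      also have "card \<dots> = m * shifted_binomial m (length (drop (Suc i) as)) (m - 1)"
        using less.hyps[of "drop (Suc i) as" "as ! i" m] i s'' ys by simp
      also have "\<dots> = shifted_binomial m (?L - i) 0"
        unfolding shifted_binomial_full using i by (simp add: Suc_diff_Suc)
      finally show "?c (srefl p (as ! i) \<circ> ?w) = fuss m i d * shifted_binomial m (?L - i) 0" .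
      have "srefl p (- (as ! i)) \<circ> ?w = pcyc ?ys \<circ> bcyc ?xs"
        using srefl_uminus_bcyc_append[OF s'] bcyc_pcyc_commute[OF s'] ne hd by simp
      then have "?c (srefl p (- (as ! i)) \<circ> ?w) = ?c (pcyc ?ys) * ?c (bcyc ?xs)"
        using fy s'' by (simp only: card_factorizations_fixing_pcyc_comp bcyc_hyperoctahedral)
      also have "?c (bcyc ?xs) = d * shifted_binomial m i (d - 1)"
        using less.hyps[of "take i as" p d] i s'' Suc.prems by simp
      also have "factorizations_fixing n m p (m - d) (pcyc ?ys) =
          factorizations_fixing n m (as ! i) (m - m) (pcyc ?ys)"
        using fx by (simp add: factorizations_fixing_eq factorizations_fixing_0)
      also have "card \<dots> = fuss m (?L - 1 - i) m"
        using card_factorizations_fixing_pcyc[OF s''(2)[unfolded ys], of m m] unfolding ys by simp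
      finally show "?c (srefl p (- (as ! i)) \<circ> ?w) = fuss m (?L - 1 - i) m * (d * shifted_binomial m i (d - 1))" .
    qed
    have last: "?c (srefl p (- p) \<circ> ?w) = fuss m ?L d"
      using srefl_neg_bcyc[OF s] card_factorizations_fixing_pcyc[OF s, of d m] Suc.prems by simp
    have "- p \<notin> set as \<union> uminus ` set as"
      using s by (auto simp: signed_list_Cons abs_in_image_abs_iff)
    then have "(\<Sum>z\<in>set as \<union> uminus ` set as \<union> {- p}. ?c (srefl p z \<circ> ?w)) =
        (\<Sum>z\<in>set as. ?c (srefl p z \<circ> ?w)) + (\<Sum>z\<in>set as. ?c (srefl p (- z) \<circ> ?w)) + ?c (srefl p (- p) \<circ> ?w)"
      using signed_list_uminus_notin[OF sas] by (subst sum.union_disjoint) (auto simp: sum_signed_set)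
    also have "(\<Sum>z\<in>set as. ?c (srefl p z \<circ> ?w)) = (\<Sum>i<?L. fuss m i d * shifted_binomial m (?L - i) 0)"
      using sas terms by (subst sum_set_distinct) (auto simp: signed_list_distinct)
    also have "(\<Sum>z\<in>set as. ?c (srefl p (- z) \<circ> ?w)) =
        d * (\<Sum>i<?L. fuss m (?L - 1 - i) m * shifted_binomial m i (d - 1))"
      using sas terms by (subst sum_set_distinct) (auto simp: signed_list_distinct sum_distrib_left mult_ac)
    also have "(\<Sum>i<?L. fuss m (?L - 1 - i) m * shifted_binomial m i (d - 1)) =
        (\<Sum>i<?L. fuss m i m * shifted_binomial m (?L - 1 - i) (d - 1))"
      by (subst sum.nat_diff_reindex[symmetric]) (auto intro!: sum.cong)
    finally have "(\<Sum>z\<in>set as \<union> uminus ` set as \<union> {- p}. ?c (srefl p z \<circ> ?w)) =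
        (\<Sum>i<?L. fuss m i d * shifted_binomial m (?L - i) 0) +
        d * (\<Sum>i<?L. fuss m i m * shifted_binomial m (?L - 1 - i) (d - 1)) + fuss m ?L d"
      by (simp only: last)
    \<comment> \<open>The point -p supplies the summand with i = \<open>?L\<close>, which completes
      the first sum to a full convolution.\<close>
    moreover have "(\<Sum>i\<le>?L. fuss m i d * shifted_binomial m (?L - i) 0) =
        (\<Sum>i<?L. fuss m i d * shifted_binomial m (?L - i) 0) + fuss m ?L d"
      by (simp flip: lessThan_Suc_atMost)
    ultimately have sum: "(\<Sum>z\<in>set as \<union> uminus ` set as \<union> {- p}. ?c (srefl p z \<circ> ?w)) =
        (\<Sum>i\<le>?L. fuss m i d * shifted_binomial m (?L - i) 0) +
        d * (\<Sum>i<?L. fuss m i m * shifted_binomial m (?L - 1 - i) (d - 1))"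
      by (simp only: add_ac)
    have "card (factorizations_fixing n m p (m - Suc d) ?w) = ?c ?w +
        (\<Sum>z\<in>set as \<union> uminus ` set as \<union> {- p}. ?c (srefl p z \<circ> ?w))"
      using card_factorizations_fixing_rec[OF w p, of "m - Suc d" m] Suc.prems lowering_bcyc[OF s]
      by (simp add: Suc_diff_Suc)
    also have "\<dots> = d * shifted_binomial m ?L (d - 1) + shifted_binomial m ?L d +
        d * (\<Sum>i<?L. fuss m i m * shifted_binomial m (?L - 1 - i) (d - 1))"
      unfolding sum using Suc shifted_binomial_convolution[of m d ?L 0] by simp
    also have "\<dots> = Suc d * shifted_binomial m ?L d"
    proof (cases ?L)
      case (Suc l)
      have "(\<Sum>i<?L. fuss m i m * shifted_binomial m (?L - 1 - i) (d - 1)) = shifted_binomial m l (m + (d - 1))"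
        using shifted_binomial_convolution[of m m l "d - 1"] Suc by (simp add: lessThan_Suc_atMost)
      moreover have "d * (shifted_binomial m (Suc l) (d - 1) + shifted_binomial m l (m + (d - 1))) =
          d * shifted_binomial m (Suc l) d"
        using shifted_binomial_Suc[of m l "d - 1"] by (cases d) (simp_all add: add_ac)
      ultimately show ?thesis
        by (simp add: Suc distrib_left)
    qed simp
    finally show ?case by simp
  qed
qed

text \<open>This is the zeta polynomial of the noncrossing partitions of type B.\<close>

lemma card_factorizations_bcyc:
  assumes "signed_list n as"
  shows "card (factorizations n m (bcyc as)) = (m * length as) choose length as"
proof (cases as)
  case Nil
  then show ?thesis by (simp add: bcyc_def factorizations_id)
next
  case (Cons p bs)
  then have "card (factorizations n m (bcyc as)) = m * shifted_binomial m (length bs) (m - 1)"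
    using card_factorizations_fixing_bcyc[of n p bs m m] assms by (simp add: factorizations_fixing_0)
  then show ?thesis
    by (simp only: shifted_binomial_full) (simp add: Cons shifted_binomial_def)
qed

section \<open>A balanced cycle together with balanced singletons\<close>

lemma negate_hyperoctahedral:
  assumes "B \<subseteq> {1..int n}"
  shows "negate B \<in> hyperoctahedral n"
proof -
  have "bij (negate B)"
    by (rule o_bij[of "negate B"]) (auto simp: negate_def fun_eq_iff)
  moreover have "negate B x = x" if "x \<notin> support_set n" for x
    using assms that by (auto simp: negate_def)
  ultimately show ?thesis
    by (auto simp: hyperoctahedral_def permutes_def bij_iff negate_def)
qed

lemma negate_empty [simp]: "negate {} = id"
  by (auto simp: negate_def fun_eq_iff)

lemma negate_insert:
  assumes "p \<notin> B" "0 < p" "B \<subseteq> {1..}"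
  shows "negate (insert p B) = srefl p (- p) \<circ> negate B"
  using assms by (auto simp: negate_def srefl_def fun_eq_iff abs_if)

lemma negate_fixes: "\<bar>x\<bar> \<notin> B \<Longrightarrow> negate B x = x"
  by (simp add: negate_def)

lemma bcyc_negate_commute:
  assumes "abs ` set as \<inter> B = {}" "signed_list n as" "B \<subseteq> {1..int n}"
  shows "bcyc as \<circ> negate B = negate B \<circ> bcyc as"
proof (rule disjoint_commute[where S = "{x. \<bar>x\<bar> \<in> abs ` set as}"])
  show "inj (bcyc as)" "inj (negate B)"
    using hyperoctahedralD(4) bcyc_hyperoctahedral negate_hyperoctahedral assms by blast+
qed (use assms in \<open>auto simp: abs_in_image_abs_iff intro!: bcyc_fixes negate_fixes\<close>)

lemma bcyc_negate_insert:
  assumes "abs ` set as \<inter> insert p B = {}" "signed_list n as" "insert p B \<subseteq> {1..int n}" "p \<notin> B"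
  shows "bcyc as \<circ> negate (insert p B) = srefl p (- p) \<circ> (bcyc as \<circ> negate B)"
proof -
  have "B \<subseteq> {1..}" "0 < p"
    using assms(3) by auto
  then have neg: "negate (insert p B) = srefl p (- p) \<circ> negate B"
    using negate_insert[OF assms(4)] by blast
  have "bcyc as \<circ> negate (insert p B) = negate (insert p B) \<circ> bcyc as"
    using assms by (intro bcyc_negate_commute) auto
  also have "\<dots> = srefl p (- p) \<circ> (negate B \<circ> bcyc as)"
    unfolding neg by (simp add: comp_assoc)
  also have "negate B \<circ> bcyc as = bcyc as \<circ> negate B"
    using assms by (intro bcyc_negate_commute[symmetric]) auto
  finally show ?thesis .
qed

lemma absolute_length_bcyc_negate:
  assumes "signed_list n as" "B \<subseteq> {1..int n}" "abs ` set as \<inter> B = {}"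
  shows "absolute_length n (bcyc as \<circ> negate B) = length as + card B"
proof -
  have "finite B"
    using assms(2) finite_subset by blast
  then show ?thesis
    using assms(2,3)
  proof (induction B rule: finite_induct)
    case empty
    then show ?case
      using absolute_length_bcyc[OF assms(1)] by simp
  next
    case (insert p B)
    let ?w = "bcyc as \<circ> negate B" and ?w' = "bcyc as \<circ> negate (insert p B)"
    have eq: "?w' = srefl p (- p) \<circ> ?w"
      using insert assms(1) by (intro bcyc_negate_insert) auto
    have "\<bar>p\<bar> = p" "p \<notin> abs ` set as"
      using insert by auto
    then have "p \<notin> set as" "- p \<notin> set as"
      using abs_in_image_abs_iff[of p "set as"] by auto
    then have p: "p \<noteq> 0" "negate B p = p" "bcyc as p = p"
      using insert \<open>\<bar>p\<bar> = p\<close> by (auto intro!: negate_fixes bcyc_fixes)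
    then have p': "?w' p = - p" "?w' p \<noteq> p"
      unfolding eq by simp_all
    have "?w' \<in> hyperoctahedral n"
      using insert assms(1) by (intro hyperoctahedral_comp bcyc_hyperoctahedral negate_hyperoctahedral) auto
    then have "absolute_length n ?w' = Suc (absolute_length n (srefl p (- p) \<circ> ?w'))"
      using absolute_length_srefl_comp p' by metis
    also have "srefl p (- p) \<circ> ?w' = ?w"
      using p unfolding eq by simp
    finally show ?case
      using insert by simp
  qed
qed

text \<open>Negating all entries does not change the balanced cycle, and rotation then brings z to
  the front.\<close>

lemma bcyc_rotate_to:
  assumes s: "signed_list n as" and z: "\<bar>z\<bar> \<in> abs ` set as"
  obtains bs where "signed_list n bs" "bs \<noteq> []" "hd bs = z" "bcyc bs = bcyc as"
    "abs ` set bs = abs ` set as" "length bs = length as"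
proof -
  note result = that
  have main: thesis if z: "z \<in> set cs" and cs: "signed_list n cs" "bcyc cs = bcyc as"
    "abs ` set cs = abs ` set as" "length cs = length as" for cs
  proof -
    obtain xs ys where xy: "cs = xs @ z # ys"
      using z by (auto dest: split_list)
    let ?bs = "(z # ys) @ map uminus xs"
    have "signed_list n ?bs"
      using cs(1) unfolding xy signed_list_append signed_list_map_uminus by (auto simp: image_image)
    moreover have "bcyc ?bs = bcyc cs"
      using cs(1) unfolding xy by (intro bcyc_rotate)
    moreover have "abs ` set ?bs = abs ` set cs"
      by (auto simp: xy image_Un image_image)
    ultimately show thesis
      using result[of ?bs] cs by (simp add: xy)
  qed
  have "z \<in> set as \<or> z \<in> set (map uminus as)"
    using z by (metis abs_in_image_abs_iff image_eqI minus_minus set_map)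
  then consider "z \<in> set as" | "z \<in> set (map uminus as)"
    by blast
  then show thesis
  proof cases
    case 1
    with main s show thesis by blast
  next
    case 2
    moreover have "0 \<notin> set as"
      using signed_list_nz[OF s] by blast
    ultimately show thesis
      using s by (intro main[of "map uminus as"])
        (simp_all add: signed_list_map_uminus bcyc_map_uminus image_image)
  qed
qed

text \<open>A reflection through p and a point of the cycle merges [p] with the whole cycle.
  Rotation and merging alter signs, so only the absolute values of \<open>bs\<close> are
  recorded.\<close>

lemma srefl_merge_negate:
  assumes s: "signed_list n as" and B: "insert p B \<subseteq> {1..int n}" "p \<notin> B"
    and disj: "abs ` set as \<inter> insert p B = {}"
    and z: "\<bar>z\<bar> \<in> abs ` set as"
  obtains bs where "signed_list n (p # bs)" "length bs = length as" "abs ` set bs = abs ` set as"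
    "srefl p z \<circ> (bcyc as \<circ> negate (insert p B)) = pcyc (p # bs) \<circ> negate B"
proof -
  obtain cs where cs: "signed_list n cs" "cs \<noteq> []" "hd cs = z" "bcyc cs = bcyc as"
    "abs ` set cs = abs ` set as" "length cs = length as"
    using bcyc_rotate_to[OF s z] .
  have p: "p \<in> support_set n" "\<bar>p\<bar> \<notin> abs ` set cs"
    using B disj cs(5) by auto
  then have s': "signed_list n (p # cs)" "signed_list n (p # map uminus cs)"
    using cs(1) by (auto simp: signed_list_Cons signed_list_map_uminus image_image)
  have "srefl p z \<circ> (bcyc as \<circ> negate (insert p B)) = srefl p (hd cs) \<circ> (srefl p (- p) \<circ> bcyc cs) \<circ> negate B"
    using bcyc_negate_insert[OF disj s B] cs by (simp add: comp_assoc)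
  also have "\<dots> = pcyc (p # map uminus cs) \<circ> negate B"
    using srefl_merge_bcyc[OF s'(1) cs(2)] by simp
  finally show thesis
    using that[of "map uminus cs"] s' cs by (simp add: image_image)
qed

text \<open>This is ((p, z)) [p] [z] = ((p, -z)); the singleton of z is that of
  \<bar>z\<bar>.\<close>

lemma srefl_merge_singletons:
  assumes s: "signed_list n as" and B: "insert p B \<subseteq> {1..int n}" "p \<notin> B"
    and disj: "abs ` set as \<inter> insert p B = {}"
    and z: "\<bar>z\<bar> \<in> B"
  shows "signed_list n [p, - z]"
    "srefl p z \<circ> (bcyc as \<circ> negate (insert p B)) = pcyc [p, - z] \<circ> (bcyc as \<circ> negate (B - {\<bar>z\<bar>}))"
proof -
  let ?B = "B - {\<bar>z\<bar>}"
  have zB: "B = insert \<bar>z\<bar> ?B"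
    using z by auto
  have pz: "\<bar>p\<bar> \<noteq> \<bar>z\<bar>" "p \<in> support_set n" "z \<in> support_set n"
  proof -
    have "\<bar>z\<bar> \<in> {1..int n}" "p \<in> {1..int n}"
      using B(1) z by blast+
    then show "\<bar>p\<bar> \<noteq> \<bar>z\<bar>" "p \<in> support_set n" "z \<in> support_set n"
      using B(2) z by auto
  qed
  then show "signed_list n [p, - z]"
    by (auto simp: signed_list_def)
  have "srefl \<bar>z\<bar> (- \<bar>z\<bar>) = srefl z (- z)"
    by (cases "z \<ge> 0") (simp_all add: srefl_commute)
  moreover have "srefl p z \<circ> (srefl p (- p) \<circ> srefl z (- z)) = srefl p (- z)"
  proof -
    have "z \<noteq> p" "z \<noteq> - p" "p \<noteq> 0" "z \<noteq> 0"
      using pz by auto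
    then show ?thesis
      by (auto simp: srefl_def fun_eq_iff)
  qed
  moreover have "bcyc as \<circ> negate B = srefl \<bar>z\<bar> (- \<bar>z\<bar>) \<circ> (bcyc as \<circ> negate ?B)"
    using B disj z s by (subst zB, intro bcyc_negate_insert) auto
  ultimately have "srefl p z \<circ> (srefl p (- p) \<circ> (bcyc as \<circ> negate B)) = srefl p (- z) \<circ> (bcyc as \<circ> negate ?B)"
    by (metis comp_assoc)
  then show "srefl p z \<circ> (bcyc as \<circ> negate (insert p B)) = pcyc [p, - z] \<circ> (bcyc as \<circ> negate ?B)"
    unfolding bcyc_negate_insert[OF disj s B] by simp
qed

text \<open>With p in one of the r + 1 singletons, the three terms belong to z = -p, to the 2k
  points of the cycle and to the 2r points of the other singletons. The index j counts the trailing
  factors that may move p; only the paired cycle created by the merge depends on it.\<close>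

fun interval_count :: "nat \<Rightarrow> nat \<Rightarrow> nat \<Rightarrow> nat" where
  "interval_count m k 0 = (m * k) choose k"
| "interval_count m k (Suc r) = m * interval_count m k r +
     2 * k * (\<Sum>j<m. fuss m k j) * interval_count m 0 r +
     2 * r * (\<Sum>j<m. fuss m 1 j) * interval_count m k (r - 1)"

lemma card_signed_set:
  assumes "finite A" "\<And>a. a \<in> A \<Longrightarrow> - a \<notin> (A :: int set)"
  shows "card (A \<union> uminus ` A) = 2 * card A"
  using assms by (subst card_Un_disjoint) (auto simp: card_image inj_on_def)

lemma lowering_bcyc_negate:
  assumes s: "signed_list n as" and B: "insert p B \<subseteq> {1..int n}" "p \<notin> B"
    and disj: "abs ` set as \<inter> insert p B = {}"
  shows "lowering n p (bcyc as \<circ> negate (insert p B)) = {z. \<bar>z\<bar> \<in> abs ` set as} \<union> {z. \<bar>z\<bar> \<in> B} \<union> {- p}"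
    (is "lowering n p ?w = _")
proof (intro equalityI subsetI)
  have w: "?w \<in> hyperoctahedral n"
    using B by (intro hyperoctahedral_comp bcyc_hyperoctahedral[OF s] negate_hyperoctahedral) auto
  have p: "p \<in> support_set n"
    using B by auto
  fix z
  assume z: "z \<in> lowering n p ?w"
  have "\<bar>z\<bar> \<in> abs ` set as \<or> \<bar>z\<bar> \<in> insert p B"
  proof (rule ccontr)
    assume "\<not> ?thesis"
    then have "?w z = z"
      using bcyc_fixes[of z as] negate_fixes[of z "insert p B"] by (simp add: abs_in_image_abs_iff)
    with lowering_moved[OF w p z] show False ..
  qed
  moreover have "z \<noteq> p"
    using z by (auto simp: lowering_def)
  ultimately show "z \<in> {z. \<bar>z\<bar> \<in> abs ` set as} \<union> {z. \<bar>z\<bar> \<in> B} \<union> {- p}"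
    by (auto simp: abs_if split: if_splits)
next
  have fin: "finite B"
    using B(1) finite_subset by fastforce
  have len: "absolute_length n ?w = Suc (length as + card B)"
    using absolute_length_bcyc_negate[OF s B(1) disj] B(2) fin by simp
  have p: "p \<in> support_set n" "- p \<noteq> p" "- p \<in> support_set n"
    using B by auto
  have B': "B \<subseteq> {1..int n}" "abs ` set as \<inter> B = {}"
    using B disj by auto
  fix z
  assume "z \<in> {z. \<bar>z\<bar> \<in> abs ` set as} \<union> {z. \<bar>z\<bar> \<in> B} \<union> {- p}"
  then consider "\<bar>z\<bar> \<in> abs ` set as" | "\<bar>z\<bar> \<in> B" | "z = - p"
    by blast
  then show "z \<in> lowering n p ?w"
  proof cases
    case 1
    then obtain bs where bs: "signed_list n (p # bs)" "length bs = length as" "abs ` set bs = abs ` set as"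
      "srefl p z \<circ> ?w = pcyc (p # bs) \<circ> negate B"
      using srefl_merge_negate[OF s B disj] by metis
    have "negate B x = x" if "x \<in> set (p # bs)" for x
    proof -
      have "\<bar>x\<bar> \<in> insert p (abs ` set as)"
        using that B(1) unfolding bs(3)[symmetric] by auto
      then show ?thesis
        using B(2) B'(2) by (intro negate_fixes) blast
    qed
    then have "absolute_length n (srefl p z \<circ> ?w) = length as + card B"
      unfolding bs(4) using bs B' absolute_length_bcyc_negate[of n "[]" B]
      by (subst absolute_length_pcyc_comp)
        (auto simp: bcyc_def signed_list_def[of n "[]"] intro!: negate_hyperoctahedral)
    moreover have "z \<in> support_set n"
      using 1 s by (auto simp: signed_list_def abs_in_image_abs_iff)
    moreover have "\<bar>p\<bar> = p"
      using B(1) by auto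
    then have "z \<noteq> p"
      using 1 disj by auto
    ultimately show ?thesis
      using len by (simp add: lowering_def)
  next
    case 2
    note eq = srefl_merge_singletons[OF s B disj 2]
    have B'': "B - {\<bar>z\<bar>} \<subseteq> {1..int n}" "abs ` set as \<inter> (B - {\<bar>z\<bar>}) = {}"
      using B' by auto
    have hyp: "bcyc as \<circ> negate (B - {\<bar>z\<bar>}) \<in> hyperoctahedral n"
      using B' by (intro hyperoctahedral_comp bcyc_hyperoctahedral[OF s] negate_hyperoctahedral) auto
    have "bcyc as x = x" "negate (B - {\<bar>z\<bar>}) x = x" if "x \<in> set [p, - z]" for x
    proof -
      have "\<bar>x\<bar> \<notin> abs ` set as" "\<bar>x\<bar> \<notin> B - {\<bar>z\<bar>}"
        using that 2 B disj by auto
      then show "bcyc as x = x" "negate (B - {\<bar>z\<bar>}) x = x"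
        by (auto simp: abs_in_image_abs_iff intro!: bcyc_fixes negate_fixes)
    qed
    then have "absolute_length n (srefl p z \<circ> ?w) = 1 + (length as + card (B - {\<bar>z\<bar>}))"
      unfolding eq(2) using B'' absolute_length_bcyc_negate[OF s, of "B - {\<bar>z\<bar>}"]
      by (subst absolute_length_pcyc_comp[OF eq(1) hyp]) auto
    moreover have "Suc (card (B - {\<bar>z\<bar>})) = card B"
      using card_Suc_Diff1[OF fin 2] .
    moreover have "\<bar>z\<bar> \<in> {1..int n}" "\<bar>p\<bar> = p"
      using 2 B by auto
    then have "z \<in> support_set n" "z \<noteq> p"
      using 2 B(2) by auto
    ultimately show ?thesis
      using len by (simp add: lowering_def)
  next
    case 3
    have "srefl p (- p) \<circ> ?w = bcyc as \<circ> negate B"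
      using bcyc_negate_insert[OF disj s B] p by simp
    then show ?thesis
      using 3 len p absolute_length_bcyc_negate[OF s B'] by (simp add: lowering_def)
  qed
qed

text \<open>The point p is taken from \<open>B\<close>, so the cycle is either kept whole or
  absorbed whole into a paired cycle, and what remains is again of the form \<open>bcyc\<close>
  times \<open>negate\<close> with fewer singletons.\<close>

lemma card_factorizations_bcyc_negate:
  assumes "signed_list n as" "B \<subseteq> {1..int n}" "abs ` set as \<inter> B = {}"
  shows "card (factorizations n m (bcyc as \<circ> negate B)) = interval_count m (length as) (card B)"
  using assms
proof (induction "card B" arbitrary: as B rule: less_induct)
  case (less B as)
  have s: "signed_list n as" and fin: "finite B"
    using less.prems(1) finite_subset[OF less.prems(2)] by simp_all
  show ?case
  proof (cases "B = {}")
    case True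
    then show ?thesis
      using card_factorizations_bcyc[OF s] by simp
  next
    case False
    then obtain p where "p \<in> B"
      by blast
    define C where "C = B - {p}"
    have BC: "B = insert p C" "p \<notin> C"
      using \<open>p \<in> B\<close> by (auto simp: C_def)
    have C: "insert p C \<subseteq> {1..int n}" "abs ` set as \<inter> insert p C = {}"
      using less.prems BC by auto
    then have C': "C \<subseteq> {1..int n}" "abs ` set as \<inter> C = {}"
      by auto
    have finC: "finite C" and cardB: "card B = Suc (card C)"
      using fin BC by auto
    let ?w = "bcyc as \<circ> negate B" and ?k = "length as" and ?r = "card C"
    let ?As = "{z. \<bar>z\<bar> \<in> abs ` set as}" and ?Cs = "{z. \<bar>z\<bar> \<in> C}"
    have w: "?w \<in> hyperoctahedral n"
      using less.prems by (intro hyperoctahedral_comp bcyc_hyperoctahedral[OF s] negate_hyperoctahedral) auto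
    have p: "p \<in> support_set n" "p \<noteq> 0"
      using C by auto
    have eq: "?w = srefl p (- p) \<circ> (bcyc as \<circ> negate C)"
      using bcyc_negate_insert[OF C(2) s C(1) BC(2)] by (simp add: BC(1))
    have fp: "(bcyc as \<circ> negate C) p = p"
    proof -
      have "\<bar>p\<bar> = p" "p \<notin> abs ` set as"
        using C by auto
      then have "p \<notin> set as" "- p \<notin> set as"
        using abs_in_image_abs_iff[of p "set as"] by auto
      with \<open>\<bar>p\<bar> = p\<close> BC(2) show ?thesis
        by (simp add: bcyc_fixes negate_fixes)
    qed
    then have moved: "?w p \<noteq> p"
      using p unfolding eq by simp
    have s0: "signed_list n []"
      by (simp add: signed_list_def)
    define t where "t j = interval_count m ?k ?r + 2 * ?k * (fuss m ?k j * interval_count m 0 ?r) +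
      2 * ?r * (fuss m 1 j * interval_count m ?k (?r - 1))" for j
    have sum: "(\<Sum>z\<in>lowering n p ?w. card (factorizations_fixing n m p (m - j) (srefl p z \<circ> ?w))) = t j"
      if j: "j < m" for j
    proof -
      let ?c = "\<lambda>z. card (factorizations_fixing n m p (m - j) (srefl p z \<circ> ?w))"
      have c1: "?c z = fuss m ?k j * interval_count m 0 ?r" if z: "z \<in> ?As" for z
      proof -
        obtain bs where bs: "signed_list n (p # bs)" "length bs = length as" "abs ` set bs = abs ` set as"
          "srefl p z \<circ> ?w = pcyc (p # bs) \<circ> negate C"
          using srefl_merge_negate[OF s C(1) BC(2) C(2), of z] z by (auto simp: BC(1))
        have fx: "negate C x = x" if "x \<in> set (p # bs)" for x
        proof -
          have "\<bar>x\<bar> \<in> insert p (abs ` set as)"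
            using that C(1) unfolding bs(3)[symmetric] by auto
          then show ?thesis
            using BC(2) C'(2) by (intro negate_fixes) blast
        qed
        have "?c z = card (factorizations_fixing n m p (m - j) (pcyc (p # bs))) *
            card (factorizations_fixing n m p (m - j) (negate C))"
          unfolding bs(4) using fx C' bs(1)
          by (intro card_factorizations_fixing_pcyc_comp negate_hyperoctahedral) auto
        also have "factorizations_fixing n m p (m - j) (negate C) = factorizations n m (bcyc [] \<circ> negate C)"
          using fx by (simp add: factorizations_fixing_eq bcyc_def)
        also have "card \<dots> = interval_count m 0 ?r"
          using less.hyps[of C "[]"] s0 C' cardB by simp
        also have "card (factorizations_fixing n m p (m - j) (pcyc (p # bs))) = fuss m ?k j"
          using card_factorizations_fixing_pcyc[OF bs(1), of j m] bs(2) j by simp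
        finally show ?thesis .
      qed
      have c2: "?c z = fuss m 1 j * interval_count m ?k (?r - 1)" if z: "z \<in> ?Cs" for z
      proof -
        have z: "\<bar>z\<bar> \<in> C" using z by simp
        note e = srefl_merge_singletons[OF s C(1) BC(2) C(2) z]
        let ?v = "bcyc as \<circ> negate (C - {\<bar>z\<bar>})"
        have hyp: "?v \<in> hyperoctahedral n"
          using C' by (intro hyperoctahedral_comp bcyc_hyperoctahedral[OF s] negate_hyperoctahedral) auto
        have fx: "?v x = x" if "x \<in> set [p, - z]" for x
        proof -
          have "\<bar>x\<bar> \<notin> abs ` set as" "\<bar>x\<bar> \<notin> C - {\<bar>z\<bar>}"
            using that z BC C by auto
          then have "bcyc as x = x" "negate (C - {\<bar>z\<bar>}) x = x"
            by (auto simp: abs_in_image_abs_iff intro!: bcyc_fixes negate_fixes)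
          then show ?thesis by simp
        qed
        have "?c z = card (factorizations_fixing n m p (m - j) (pcyc [p, - z])) *
            card (factorizations_fixing n m p (m - j) ?v)"
          unfolding BC(1) e(2) using fx hyp e(1) by (intro card_factorizations_fixing_pcyc_comp) auto
        also have "factorizations_fixing n m p (m - j) ?v = factorizations n m ?v"
          using fx by (intro factorizations_fixing_eq) simp
        also have "card \<dots> = interval_count m ?k (card (C - {\<bar>z\<bar>}))"
          using s C' cardB finC z by (intro less.hyps) (auto simp: card_Diff_singleton_if)
        also have "card (C - {\<bar>z\<bar>}) = ?r - 1"
          using z by simp
        also have "card (factorizations_fixing n m p (m - j) (pcyc [p, - z])) = fuss m 1 j"
          using card_factorizations_fixing_pcyc[OF e(1), of j m] j by simp
        finally show ?thesis .
      qed
      have "srefl p (- p) \<circ> ?w = bcyc as \<circ> negate C"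
        unfolding eq using p by simp
      then have c3: "?c (- p) = interval_count m ?k ?r"
        using less.hyps[of C as] s C' cardB fp by (simp add: factorizations_fixing_eq)
      have As: "?As = set as \<union> uminus ` set as" and Cs: "?Cs = C \<union> uminus ` C"
        using C' by (auto simp: abs_in_image_abs_iff abs_if image_iff split: if_splits) (metis minus_minus)+
      have cA: "card ?As = 2 * ?k" "finite ?As"
        unfolding As using signed_list_uminus_notin[OF s] signed_list_distinct[OF s]
        by (simp_all add: card_signed_set distinct_card)
      have cC: "card ?Cs = 2 * ?r" "finite ?Cs"
      proof -
        have "- a \<notin> C" if "a \<in> C" for a
          using that subsetD[OF C'(1), of a] subsetD[OF C'(1), of "- a"] by auto
        then show "card ?Cs = 2 * ?r" "finite ?Cs"
          unfolding Cs using finC by (simp_all add: card_signed_set)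
      qed
      have "\<bar>- p\<bar> = p"
        using C(1) by auto
      then have "- p \<notin> ?As \<union> ?Cs" "?As \<inter> ?Cs = {}"
        using C(2) BC(2) by auto
      then have "(\<Sum>z\<in>?As \<union> ?Cs \<union> {- p}. ?c z) = (\<Sum>z\<in>?As. ?c z) + (\<Sum>z\<in>?Cs. ?c z) + ?c (- p)"
        using cA(2) cC(2) by (subst sum.union_disjoint) (auto simp: sum.union_disjoint)
      also have "\<dots> = t j"
        by (simp only: c1 c2 c3 sum_constant cA cC t_def cong: sum.cong) simp
      finally show ?thesis
        using lowering_bcyc_negate[OF s C(1) BC(2) C(2)] by (simp add: BC(1))
    qed
    have "card (factorizations_fixing n m p (m - d) ?w) = (\<Sum>j<d. t j)" if "d \<le> m" for d
      using that
    proof (induction d)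
      case 0
      show ?case
        using factorizations_fixing_all[of ?w p n m] moved by (simp add: comp_def)
    next
      case (Suc d)
      have "card (factorizations_fixing n m p (m - Suc d) ?w) =
          card (factorizations_fixing n m p (m - d) ?w) + t d"
        using card_factorizations_fixing_rec[OF w p(1), of "m - Suc d" m] sum[of d] Suc.prems
        by (simp add: Suc_diff_Suc)
      with Suc show ?case
        by (simp add: comp_def)
    qed
    from this[of m] have "card (factorizations n m ?w) = (\<Sum>j<m. t j)"
      by (simp add: factorizations_fixing_0)
    also have "\<dots> = interval_count m ?k (Suc ?r)"
      by (simp add: t_def sum.distrib sum_distrib_left sum_distrib_right mult_ac)
    finally show ?thesis
      by (simp only: cardB)
  qed
qed

section \<open>The zeta polynomial and the Moebius function of a bounded poset\<close>

lemma poly_eqI_Suc: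
  fixes p q :: "real poly"
  assumes "\<And>l :: nat. poly p (real l + a) = poly q (real l + a)"
  shows "p = q"
proof (rule ccontr)
  assume "p \<noteq> q"
  then have "finite {x. poly (p - q) x = 0}"
    by (intro poly_roots_finite) simp
  moreover have "range (\<lambda>l. real l + a) \<subseteq> {x. poly (p - q) x = 0}"
    using assms by auto
  moreover have "infinite (range (\<lambda>l. real l + a))"
    by (intro range_inj_infinite) (auto simp: inj_on_def)
  ultimately show False
    using finite_subset by blast
qed

text \<open>Subtracting the difference of a suitable monomial lowers the degree of \<open>q\<close>,
  or leaves 0.\<close>

lemma ex_antidifference:
  fixes q :: "real poly"
  shows "\<exists>p. \<forall>x. poly p (x + 1) - poly p x = poly q x"
proof (induction "degree q" arbitrary: q rule: less_induct)
  case less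
  show ?case
  proof (cases "q = 0")
    case True
    then show ?thesis by (intro exI[of _ 0]) simp
  next
    case False
    define d where "d = degree q"
    \<comment> \<open>The difference of x^(d+1) has leading term (d + 1) x^d, so this factor cancels
      the leading term of \<open>q\<close>.\<close>
    define g :: "real poly" where "g = smult (lead_coeff q / real (Suc d)) (monom 1 (Suc d))"
    define h where "h = q - (pcompose g [:1, 1:] - g)"
    have poly_g: "poly g x = lead_coeff q / real (Suc d) * x ^ Suc d" for x
      by (simp add: g_def poly_monom)
    have coeff: "coeff (pcompose (monom 1 (Suc d)) [:1, 1:] :: real poly) i = real (Suc d choose i)" for i
    proof -
      have "pcompose (monom 1 (Suc d)) [:1, 1:] = ([:1, 1:] :: real poly) ^ Suc d"
        by (intro poly_ext) (simp only: poly_pcompose poly_monom poly_power mult_1)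
      also have "\<dots> = (\<Sum>j\<le>Suc d. monom (real (Suc d choose j)) j)"
        by (intro poly_ext) (simp add: poly_sum poly_monom binomial_ring[of _ 1] add.commute[of 1] del: power_Suc)
      finally show ?thesis
        by (simp add: coeff_sum del: binomial_Suc_Suc)
    qed
    have g_coeff: "coeff (pcompose g [:1, 1:] - g) i =
        lead_coeff q / real (Suc d) * (real (Suc d choose i) - (if i = Suc d then 1 else 0))" for i
      by (simp add: g_def pcompose_smult coeff right_diff_distrib del: binomial_Suc_Suc)
    have h0: "coeff h i = 0" if "i \<ge> d" for i
    proof -
      have "i = d \<or> i = Suc d \<or> i > Suc d"
        using that by linarith
      then consider "i = d" | "i = Suc d" | "i > Suc d"
        by blast
      then show ?thesis
      proof cases
        case 1
        then show ?thesis
          by (simp only: h_def coeff_diff[of q] g_coeff) (simp add: d_def)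
      next
        case 2
        then show ?thesis
          by (simp only: h_def coeff_diff[of q] g_coeff) (simp add: d_def coeff_eq_0)
      next
        case 3
        then show ?thesis
          by (simp only: h_def coeff_diff[of q] g_coeff) (simp add: d_def coeff_eq_0 binomial_eq_0)
      qed
    qed
    have "\<exists>p. \<forall>x. poly p (x + 1) - poly p x = poly h x"
    proof (cases "h = 0")
      case False
      then have "degree h < d"
        using h0 leading_coeff_0_iff[of h] by (metis linorder_not_le)
      then show ?thesis
        using less d_def by blast
    qed (intro exI[of _ 0], simp)
    then obtain p where p: "poly p (x + 1) - poly p x = poly h x" for x
      by blast
    have "poly (p + g) (x + 1) - poly (p + g) x = poly q x" for x
      using p[of x] by (simp add: h_def poly_pcompose add.commute)
    then show ?thesis by blast
  qed
qed

section \<open>Multichains in a finite poset\<close>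

definition down :: "'a set \<Rightarrow> 'a rel \<Rightarrow> 'a \<Rightarrow> 'a set" where
  "down P r y = {z \<in> P. (z, y) \<in> r}"

lemma multichains_0: "multichains P r 0 = {[]}"
  by (auto simp: multichains_def)

context
  fixes P :: "'a set" and r :: "'a rel"
  assumes finite: "finite P" and po: "partial_order_on P (Restr r P)"
begin

lemma poset_refl: "x \<in> P \<Longrightarrow> (x, x) \<in> r"
  using po by (auto simp: partial_order_on_def preorder_on_def refl_on_def)

lemma poset_trans: "(x, y) \<in> r \<Longrightarrow> (y, z) \<in> r \<Longrightarrow> x \<in> P \<Longrightarrow> y \<in> P \<Longrightarrow> z \<in> P \<Longrightarrow> (x, z) \<in> r"
  using po unfolding partial_order_on_def preorder_on_def trans_def by blast

lemma poset_antisym: "(x, y) \<in> r \<Longrightarrow> (y, x) \<in> r \<Longrightarrow> x \<in> P \<Longrightarrow> y \<in> P \<Longrightarrow> x = y"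
  using po unfolding partial_order_on_def antisym_def by blast

lemma finite_down: "finite (down P r y)"
  using finite by (simp add: down_def)

lemma multichain_le_last:
  "successively (\<lambda>x y. (x, y) \<in> r) (xs @ [z]) \<Longrightarrow> set xs \<subseteq> P \<Longrightarrow> z \<in> P \<Longrightarrow> \<forall>x\<in>set xs. (x, z) \<in> r"
proof (induction xs)
  case (Cons a xs)
  have "successively (\<lambda>x y. (x, y) \<in> r) (xs @ [z])"
    using Cons.prems(1) by (auto simp: successively_Cons)
  with Cons have IH: "\<forall>x\<in>set xs. (x, z) \<in> r"
    by simp
  have "(a, z) \<in> r"
  proof (cases xs)
    case (Cons b ys)
    then have "(a, b) \<in> r" "(b, z) \<in> r" "a \<in> P" "b \<in> P"
      using IH \<open>successively _ ((a # xs) @ [z])\<close> \<open>set (a # xs) \<subseteq> P\<close> by auto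
    then show ?thesis
      using poset_trans \<open>z \<in> P\<close> by blast
  qed (use Cons.prems in simp)
  with IH show ?case
    by simp
qed simp

lemma card_multichains_Suc:
  assumes y: "y \<in> P"
  shows "card (multichains (down P r y) r (Suc l)) = (\<Sum>z\<in>down P r y. card (multichains (down P r z) r l))"
proof -
  let ?S = "SIGMA z:down P r y. multichains (down P r z) r l"
  have "bij_betw (\<lambda>(z, xs). xs @ [z]) ?S (multichains (down P r y) r (Suc l))"
  proof (rule bij_betw_imageI)
    show "inj_on (\<lambda>(z, xs). xs @ [z]) ?S"
      by (auto simp: inj_on_def)
    show "(\<lambda>(z, xs). xs @ [z]) ` ?S = multichains (down P r y) r (Suc l)"
    proof (intro equalityI subsetI)
      fix c
      assume "c \<in> (\<lambda>(z, xs). xs @ [z]) ` ?S"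
      then obtain z xs where c: "c = xs @ [z]" "z \<in> down P r y" "xs \<in> multichains (down P r z) r l"
        by auto
      then have "set xs \<subseteq> down P r y"
        using poset_trans y unfolding multichains_def down_def by blast
      moreover have "xs \<noteq> [] \<Longrightarrow> (last xs, z) \<in> r"
        using c(3) last_in_set[of xs] unfolding multichains_def down_def by blast
      ultimately show "c \<in> multichains (down P r y) r (Suc l)"
        using c by (auto simp: multichains_def successively_append_iff)
    next
      fix c
      assume c: "c \<in> multichains (down P r y) r (Suc l)"
      then have "c \<noteq> []"
        by (auto simp: multichains_def)
      then obtain xs z where xz: "c = xs @ [z]"
        by (metis rev_exhaust)
      have "set xs \<subseteq> P" "z \<in> P"
        using c by (auto simp: xz multichains_def down_def)
      then have "set xs \<subseteq> down P r z"
        using c multichain_le_last[of xs z] by (auto simp: xz multichains_def down_def)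
      then have "(z, xs) \<in> ?S"
        using c by (auto simp: xz multichains_def successively_append_iff)
      then show "c \<in> (\<lambda>(z, xs). xs @ [z]) ` ?S"
        using xz by force
    qed
  qed
  then have "card ?S = card (multichains (down P r y) r (Suc l))"
    by (rule bij_betw_same_card)
  moreover have "finite (multichains (down P r z) r l)" for z
    by (rule finite_subset[OF _ finite_lists_length_eq[OF finite_down[of z], of l]])
      (auto simp: multichains_def)
  ultimately show ?thesis
    using finite_down by simp
qed

lemma down_psubset:
  assumes "y \<in> P" "z \<in> down P r y" "z \<noteq> y"
  shows "card (down P r z) < card (down P r y)"
proof (rule psubset_card_mono[OF finite_down])
  have "down P r z \<subseteq> down P r y"
    using assms poset_trans by (auto simp: down_def)
  moreover have "y \<in> down P r y" "y \<notin> down P r z"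
    using assms poset_refl poset_antisym by (auto simp: down_def)
  ultimately show "down P r z \<subset> down P r y"
    by blast
qed

lemma sum_down:
  assumes "y \<in> P"
  shows "(\<Sum>z\<in>down P r y. g z) = g y + (\<Sum>z\<in>down P r y - {y}. g z :: 'b :: comm_monoid_add)"
  using assms poset_refl finite_down by (intro sum.remove) (auto simp: down_def)

text \<open>By \<open>card_multichains_Suc\<close>, the increment of the count in l is the sum of
  the counts for the z strictly below y. These are polynomial by induction on the size of the
  down-set, and antidifferences of polynomials are polynomials.\<close>

lemma ex_multichain_poly:
  assumes "y \<in> P"
  shows "\<exists>p :: real poly. \<forall>l. poly p (real l + 1) = real (card (multichains (down P r y) r l))"
  using assms
proof (induction "card (down P r y)" arbitrary: y rule: less_induct)
  case less
  have "\<forall>z\<in>down P r y - {y}. \<exists>p :: real poly. \<forall>l. poly p (real l + 1) = real (card (multichains (down P r z) r l))"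
    using less down_psubset by (auto simp: down_def)
  then obtain p :: "'a \<Rightarrow> real poly" where
    p: "\<And>z l. z \<in> down P r y - {y} \<Longrightarrow> poly (p z) (real l + 1) = real (card (multichains (down P r z) r l))"
    by metis
  obtain h where h: "poly h (x + 1) - poly h x = poly (\<Sum>z\<in>down P r y - {y}. p z) x" for x
    using ex_antidifference by blast
  \<comment> \<open>The constant adjusts the value at 1, where l = 0, to the single empty
    multichain.\<close>
  define q where "q = h + [:1 - poly h 1:]"
  have "poly q (real l + 1) = real (card (multichains (down P r y) r l))" for l
  proof (induction l)
    case 0
    show ?case
      by (simp add: q_def multichains_0)
  next
    case (Suc l)
    have "poly q (real (Suc l) + 1) = poly q (real l + 1) + (\<Sum>z\<in>down P r y - {y}. poly (p z) (real l + 1))"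
      using h[of "real l + 1"] by (simp add: q_def poly_sum add_ac)
    also have "\<dots> = real (\<Sum>z\<in>down P r y. card (multichains (down P r z) r l))"
      unfolding sum_down[OF less.prems] using Suc p by simp
    finally show ?case
      using card_multichains_Suc[OF less.prems] by simp
  qed
  then show ?case by blast
qed

text \<open>The relation p_y(x + 1) = \<Sum> p_z(x) over z \<le> y extends from the integers to all
  x. Going down from p_y(1) = 1 gives p_y(0) = 1 for y = b and 0 otherwise, and then p_y(-1)
  satisfies the recursion of the Moebius function.\<close>

lemma multichain_poly_moebius:
  assumes b: "b \<in> P" "\<And>y. y \<in> P \<Longrightarrow> (b, y) \<in> r"
    and p: "\<And>y l. y \<in> P \<Longrightarrow> poly (p y) (real l + 1) = real (card (multichains (down P r y) r l))"
    and y: "y \<in> P"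
  shows "poly (p y) (- 1) = real_of_int (moebius P r b y)"
proof -
  have step: "poly (p y) (x + 1) = (\<Sum>z\<in>down P r y. poly (p z) x)" if y: "y \<in> P" for x y
  proof -
    have "pcompose (p y) [:1, 1:] = (\<Sum>z\<in>down P r y. p z)"
    proof (rule poly_eqI_Suc[of _ 1])
      fix l
      have "poly (pcompose (p y) [:1, 1:]) (real l + 1) = poly (p y) (real (Suc l) + 1)"
        by (simp add: poly_pcompose add_ac)
      also have "\<dots> = (\<Sum>z\<in>down P r y. poly (p z) (real l + 1))"
        unfolding p[OF y] card_multichains_Suc[OF y] of_nat_sum
        by (intro sum.cong refl p[symmetric]) (simp add: down_def)
      finally show "poly (pcompose (p y) [:1, 1:]) (real l + 1) = poly (\<Sum>z\<in>down P r y. p z) (real l + 1)"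
        by (simp add: poly_sum)
    qed
    then have "poly (pcompose (p y) [:1, 1:]) x = poly (\<Sum>z\<in>down P r y. p z) x"
      by simp
    then show ?thesis
      by (simp add: poly_sum poly_pcompose add.commute)
  qed
  have at_1: "poly (p y) 1 = 1" if "y \<in> P" for y
    using p[OF that, of 0] by (simp add: multichains_0)
  have at_0: "poly (p y) 0 = (if y = b then 1 else 0)" if "y \<in> P" for y
    using that
  proof (induction "card (down P r y)" arbitrary: y rule: less_induct)
    case less
    have "poly (p z) 0 = (if z = b then 1 else 0)" if "z \<in> down P r y - {y}" for z
      using that less down_psubset by (auto simp: down_def)
    then have "(\<Sum>z\<in>down P r y - {y}. poly (p z) 0) = (\<Sum>z\<in>down P r y - {y}. if z = b then 1 else 0)"
      by (rule sum.cong[OF refl])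
    also have "\<dots> = (if b \<in> down P r y - {y} then 1 else 0)"
      using finite_down by simp
    also have "b \<in> down P r y - {y} \<longleftrightarrow> y \<noteq> b"
      using b less.prems by (auto simp: down_def)
    finally show ?case
      using step[OF less.prems, of 0] at_1[OF less.prems] sum_down[OF less.prems, of "\<lambda>z. poly (p z) 0"]
      by (simp split: if_splits)
  qed
  show ?thesis
    using y
  proof (induction "card (down P r y)" arbitrary: y rule: less_induct)
    case less
    have "poly (p z) (- 1) = real_of_int (moebius P r b z)" if "z \<in> down P r y - {y}" for z
      using that less down_psubset by (auto simp: down_def)
    then have "(\<Sum>z\<in>down P r y - {y}. poly (p z) (- 1)) = (\<Sum>z\<in>down P r y - {y}. real_of_int (moebius P r b z))"
      by (rule sum.cong[OF refl])
    then have eq: "poly (p y) (- 1) = (if y = b then 1 else 0) - (\<Sum>z\<in>down P r y - {y}. real_of_int (moebius P r b z))"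
      using step[OF less.prems, of "- 1"] at_0[OF less.prems] sum_down[OF less.prems, of "\<lambda>z. poly (p z) (- 1)"]
      by simp
    have set: "{z \<in> P. (b, z) \<in> r \<and> (z, y) \<in> r \<and> z \<noteq> y} = down P r y - {y}"
      using b by (auto simp: down_def)
    show ?case
    proof (cases "y = b")
      case True
      have "down P r b - {b} = {}"
        using b poset_antisym by (auto simp: down_def)
      with True eq b(1) finite po show ?thesis
        by (subst moebius.simps) simp
    next
      case False
      with eq b less.prems finite po show ?thesis
        by (subst moebius.simps) (simp add: set)
    qed
  qed
qed

lemma ex_zeta_poly:
  assumes b: "b \<in> P" "\<And>y. y \<in> P \<Longrightarrow> (b, y) \<in> r" and t: "t \<in> P" "\<And>y. y \<in> P \<Longrightarrow> (y, t) \<in> r"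
  obtains p :: "real poly" where
    "\<And>m. m \<ge> 2 \<Longrightarrow> poly p (real m) = real (card (multichains P r (m - 1)))"
    "poly p (- 1) = real_of_int (moebius P r b t)"
proof -
  obtain p :: "'a \<Rightarrow> real poly" where
    p: "\<And>y l. y \<in> P \<Longrightarrow> poly (p y) (real l + 1) = real (card (multichains (down P r y) r l))"
    using ex_multichain_poly by metis
  have "down P r t = P"
    using t by (auto simp: down_def)
  then have "poly (p t) (real m) = real (card (multichains P r (m - 1)))" if "m \<ge> 2" for m
    using p[OF t(1), of "m - 1"] that by (simp add: of_nat_diff)
  then show thesis
    using multichain_poly_moebius[OF b p t(1)] that by blast
qed

end

lemma zeta_poly_eqI:
  assumes "\<And>m. m \<ge> 2 \<Longrightarrow> poly p (real m) = real (card (multichains P r (m - 1)))"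
  shows "zeta_poly P r = p"
  unfolding zeta_poly_def
proof (rule the_equality)
  fix q :: "real poly"
  assume q: "\<forall>m\<ge>2. poly q (real m) = real (card (multichains P r (m - 1)))"
  show "q = p"
  proof (rule poly_eqI_Suc[of _ 2])
    fix l
    show "poly q (real l + 2) = poly p (real l + 2)"
      using q assms[of "l + 2"] by (metis le_add2 of_nat_add of_nat_numeral)
  qed
qed (use assms in blast)

section \<open>The intervals and their invariants\<close>

lemma map_bcyc: "signed_list n (a # as) \<Longrightarrow> map (bcyc (a # as)) (a # as) = as @ [- a]"
proof (induction as arbitrary: a)
  case Nil
  then show ?case by (simp add: bcyc_def)
next
  case (Cons b as)
  note s = Cons.prems
  have eq: "bcyc (a # b # as) = srefl a b \<circ> bcyc (b # as)"
    using bcyc_append[of "[a]" "b # as"] by simp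
  have IH: "map (bcyc (b # as)) (b # as) = as @ [- b]"
    using s by (intro Cons.IH) (simp add: signed_list_Cons)
  have "map (bcyc (a # b # as)) (b # as) = map (srefl a b) (as @ [- b])"
    unfolding eq IH[symmetric] by simp
  moreover have "map (srefl a b) as = as"
    using s by (intro map_idI srefl_fixes) (auto simp: signed_list_Cons abs_in_image_abs_iff)
  then have "map (srefl a b) (as @ [- b]) = as @ [- a]"
    using s by (auto simp: signed_list_Cons srefl_def)
  moreover have "bcyc (b # as) a = a"
    using s by (intro bcyc_fixes) (auto simp: signed_list_Cons abs_in_image_abs_iff)
  then have "bcyc (a # b # as) a = b"
    unfolding eq by simp
  ultimately show ?case
    by simp
qed

text \<open>Both sides map the list of all entries followed by their negatives to its rotation by
  one place, and both fix every other point.\<close>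

lemma balanced_cycle_eq_bcyc:
  assumes s: "signed_list n as"
  shows "balanced_cycle as = bcyc as"
proof (cases as)
  case Nil
  then show ?thesis
    by (simp add: balanced_cycle_def bcyc_def)
next
  case (Cons a bs)
  let ?cs = "as @ map uminus as"
  have "distinct as"
    using signed_list_distinct[OF s] .
  moreover have "set as \<inter> uminus ` set as = {}"
    using signed_list_uminus_notin[OF s] by auto
  ultimately have dist: "cycle ?cs"
    by (auto simp: distinct_map inj_on_def)
  have odd: "bcyc as (- x) = - bcyc as x" for x
    using hyperoctahedralD(2)[OF bcyc_hyperoctahedral[OF s]] .
  have map: "map (bcyc as) as = bs @ [- a]"
    using map_bcyc[of n a bs] s Cons by simp
  have "map (bcyc as) (map uminus as) = map uminus (map (bcyc as) as)"
    using odd by simp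
  also have "\<dots> = map uminus bs @ [a]"
    unfolding map by simp
  finally have "map (bcyc as) ?cs = rotate1 ?cs"
    using map Cons by simp
  also have "\<dots> = map (cycle_of_list ?cs) ?cs"
    using cyclic_rotation[OF dist, of 1] by (simp add: rotate1_rotate_swap)
  finally have on: "bcyc as x = cycle_of_list ?cs x" if "x \<in> set ?cs" for x
    using that by (simp only: map_eq_conv)
  have off: "bcyc as x = cycle_of_list ?cs x" if "x \<notin> set ?cs" for x
  proof -
    have "x \<notin> set as" "- x \<notin> set as"
      using that by (auto simp: image_iff)
    then show ?thesis
      using id_outside_supp[OF that] by (simp add: bcyc_fixes)
  qed
  show ?thesis
    unfolding balanced_cycle_def using on off by (intro ext) metis
qed

lemma comps_negate:
  "distinct is \<Longrightarrow> set is \<subseteq> {1..} \<Longrightarrow> comps (map (\<lambda>i. srefl i (- i)) is) = negate (set is)"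
  by (induction "is") (auto simp: negate_insert fun_eq_iff)

lemma L_top_eq: "L_top k r = bcyc [1..int k] \<circ> negate {int k + 1..int k + int r}"
proof -
  have "signed_list k [1..int k]"
    by (auto simp: signed_list_def distinct_map inj_on_def)
  then show ?thesis
    using comps_negate[of "[int k + 1..int k + int r]"]
    by (simp add: L_top_def balanced_cycle_eq_bcyc balanced_cycle_singleton comps_def[symmetric])
qed

lemma L_top_prems:
  "signed_list (k + r) [1..int k]" "{int k + 1..int k + int r} \<subseteq> {1..int (k + r)}"
  "abs ` set [1..int k] \<inter> {int k + 1..int k + int r} = {}"
  by (auto simp: signed_list_def distinct_map inj_on_def)

lemma L_top_hyperoctahedral: "L_top k r \<in> hyperoctahedral (k + r)"
  unfolding L_top_eq
  using L_top_prems by (intro hyperoctahedral_comp bcyc_hyperoctahedral negate_hyperoctahedral)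

lemma card_factorizations_L_top:
  "card (factorizations (k + r) m (L_top k r)) = interval_count m k r"
  unfolding L_top_eq using card_factorizations_bcyc_negate[OF L_top_prems] by simp

section \<open>The absolute order and its multichains\<close>

lemma inv_comp_cancel:
  assumes "u \<in> hyperoctahedral n"
  shows "u \<circ> (inv u \<circ> v) = v" "inv u \<circ> (u \<circ> v) = v" "inv u \<circ> u = id"
  using hyperoctahedralD(3,4)[OF assms] by (auto simp: fun_eq_iff bij_is_surj surj_f_inv_f)

lemma absolute_orderD:
  assumes "(u, v) \<in> absolute_order n"
  shows "u \<in> hyperoctahedral n" "v \<in> hyperoctahedral n"
    "absolute_length n u + absolute_length n (inv u \<circ> v) = absolute_length n v"
  using assms by (auto simp: absolute_order_def)

lemma absolute_order_refl: "u \<in> hyperoctahedral n \<Longrightarrow> (u, u) \<in> absolute_order n"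
  by (simp add: absolute_order_def inv_comp_cancel)

lemma absolute_order_id: "u \<in> hyperoctahedral n \<Longrightarrow> (id, u) \<in> absolute_order n"
  by (simp add: absolute_order_def inv_id)

lemma absolute_order_trans:
  assumes uv: "(u, v) \<in> absolute_order n" and vw: "(v, w) \<in> absolute_order n"
  shows "(u, w) \<in> absolute_order n"
proof -
  note D = absolute_orderD[OF uv] absolute_orderD[OF vw]
  have "inv u \<circ> w = (inv u \<circ> v) \<circ> (inv v \<circ> w)"
    using inv_comp_cancel(1)[OF D(2), of w] by (simp add: comp_assoc)
  then have "absolute_length n (inv u \<circ> w) \<le> absolute_length n (inv u \<circ> v) + absolute_length n (inv v \<circ> w)"
    using D by (metis absolute_length_comp_le hyperoctahedral_comp hyperoctahedral_inv)
  moreover have "absolute_length n (u \<circ> (inv u \<circ> w)) \<le> absolute_length n u + absolute_length n (inv u \<circ> w)"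
    using D by (intro absolute_length_comp_le hyperoctahedral_comp hyperoctahedral_inv)
  ultimately show ?thesis
    using D inv_comp_cancel(1)[OF D(1), of w] by (simp add: absolute_order_def)
qed

lemma absolute_order_antisym:
  assumes uv: "(u, v) \<in> absolute_order n" and vu: "(v, u) \<in> absolute_order n"
  shows "u = v"
proof -
  note D = absolute_orderD[OF uv] absolute_orderD[OF vu]
  have "inv u \<circ> v = id"
    using D by (intro absolute_length_eq_0[of _ n] hyperoctahedral_comp hyperoctahedral_inv) simp_all
  then show ?thesis
    using inv_comp_cancel(1)[OF D(1), of v] by simp
qed

lemma partial_order_absolute_order:
  assumes "P \<subseteq> hyperoctahedral n"
  shows "partial_order_on P (Restr (absolute_order n) P)"
  unfolding partial_order_on_def preorder_on_def
proof (intro conjI)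
  show "refl_on P (Restr (absolute_order n) P)"
    using assms absolute_order_refl by (auto simp: refl_on_def)
  show "trans (Restr (absolute_order n) P)"
    using absolute_order_trans by (intro transI) blast
  show "antisym (Restr (absolute_order n) P)"
    using absolute_order_antisym by (intro antisymI) blast
qed auto

lemma factorizations_snoc:
  assumes ts: "ts @ [t] \<in> factorizations n (Suc m) w"
  shows "(comps ts, w) \<in> absolute_order n" "ts \<in> factorizations n m (comps ts)" "t = inv (comps ts) \<circ> w"
proof -
  note D = factorizationsD[OF ts]
  let ?u = "comps ts"
  have u: "?u \<in> hyperoctahedral n" and t: "t \<in> hyperoctahedral n"
    using D(2) by (auto intro: comps_hyperoctahedral)
  have w: "?u \<circ> t = w"
    using D(3) by (simp add: comps_append)
  then show t_eq: "t = inv ?u \<circ> w"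
    using inv_comp_cancel(2)[OF u, of t] by simp
  have "absolute_length n ?u \<le> total_length n ts"
    using D(2) by (intro absolute_length_comps_le) auto
  moreover have "absolute_length n w \<le> absolute_length n ?u + absolute_length n t"
    using absolute_length_comp_le[OF u t] w by simp
  ultimately have "total_length n ts = absolute_length n ?u" "absolute_length n ?u + absolute_length n t = absolute_length n w"
    using D(4) by simp_all
  then show "(?u, w) \<in> absolute_order n" "ts \<in> factorizations n m ?u"
    using u D t_eq by (auto simp: absolute_order_def factorizations_def)
qed

lemma snoc_factorizations:
  assumes uw: "(u, w) \<in> absolute_order n" and ts: "ts \<in> factorizations n m u"
  shows "ts @ [inv u \<circ> w] \<in> factorizations n (Suc m) w"
proof -
  note D = absolute_orderD[OF uw] factorizationsD[OF ts]
  have "inv u \<circ> w \<in> hyperoctahedral n"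
    using D by (intro hyperoctahedral_comp hyperoctahedral_inv)
  then show ?thesis
    using D inv_comp_cancel(1)[OF D(1), of w] by (simp add: factorizations_def comps_append)
qed

text \<open>The last factor is determined by the product u of the others. Minimality of the word
  amounts to u lying below w together with minimality of the shortened word for u.\<close>

lemma card_factorizations_Suc:
  "card (factorizations n (Suc m) w) = (\<Sum>u\<in>{u. (u, w) \<in> absolute_order n}. card (factorizations n m u))"
proof -
  let ?S = "SIGMA u:{u. (u, w) \<in> absolute_order n}. factorizations n m u"
  have "card (factorizations n (Suc m) w) = card ?S"
  proof (rule card_eq_witness)
    fix ts
    assume ts: "ts \<in> factorizations n (Suc m) w"
    then have "ts \<noteq> []"
      by (auto simp: factorizations_def)
    then obtain us t where "ts = us @ [t]"
      by (metis rev_exhaust)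
    with ts factorizations_snoc[of us t n m w]
    show "(comps (butlast ts), butlast ts) \<in> ?S \<and>
        (\<lambda>(u, us). us @ [inv u \<circ> w]) (comps (butlast ts), butlast ts) = ts"
      by auto
  next
    fix x
    assume "x \<in> ?S"
    then obtain u us where "x = (u, us)" "(u, w) \<in> absolute_order n" "us \<in> factorizations n m u"
      by auto
    then show "(\<lambda>(u, us). us @ [inv u \<circ> w]) x \<in> factorizations n (Suc m) w \<and>
        (comps (butlast ((\<lambda>(u, us). us @ [inv u \<circ> w]) x)), butlast ((\<lambda>(u, us). us @ [inv u \<circ> w]) x)) = x"
      using snoc_factorizations factorizationsD(3) by auto
  qed
  moreover have "finite {u. (u, w) \<in> absolute_order n}"
    by (rule finite_subset[OF _ finite_hyperoctahedral[of n]]) (auto simp: absolute_order_def)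
  ultimately show ?thesis
    using finite_factorizations by simp
qed

lemma factorizations_1: "w \<in> hyperoctahedral n \<Longrightarrow> factorizations n 1 w = {[w]}"
  by (auto simp: factorizations_def length_Suc_conv)

lemma L_interval_eq: "L_interval k r = {u. (u, L_top k r) \<in> absolute_order (k + r)}"
  using absolute_order_id by (auto simp: L_interval_def absolute_order_def)

lemma L_interval_poset:
  "finite (L_interval k r)" "L_interval k r \<subseteq> hyperoctahedral (k + r)"
  "partial_order_on (L_interval k r) (Restr (absolute_order (k + r)) (L_interval k r))"
proof -
  show sub: "L_interval k r \<subseteq> hyperoctahedral (k + r)"
    by (auto simp: L_interval_eq absolute_order_def)
  then show "finite (L_interval k r)"
    using finite_hyperoctahedral finite_subset by blast
  show "partial_order_on (L_interval k r) (Restr (absolute_order (k + r)) (L_interval k r))"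
    using sub by (rule partial_order_absolute_order)
qed

lemma down_L_interval:
  assumes "u \<in> L_interval k r"
  shows "down (L_interval k r) (absolute_order (k + r)) u = {v. (v, u) \<in> absolute_order (k + r)}"
  using assms absolute_order_trans by (auto simp: down_def L_interval_eq)

text \<open>The multichain consists of the proper partial products, hence one factor more than
  elements. Both counts satisfy the same recursion; at l = 0 the empty multichain matches the
  one-factor word.\<close>

lemma card_multichains_L_interval:
  assumes "u \<in> L_interval k r"
  shows "card (multichains (down (L_interval k r) (absolute_order (k + r)) u) (absolute_order (k + r)) l) =
    card (factorizations (k + r) (Suc l) u)"
  using assms
proof (induction l arbitrary: u)
  case 0
  then have "u \<in> hyperoctahedral (k + r)"
    using L_interval_poset by blast
  then show ?case
    using factorizations_1[of u "k + r"] by (simp add: multichains_0)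
next
  case (Suc l)
  have "down (L_interval k r) (absolute_order (k + r)) u \<subseteq> L_interval k r"
    by (auto simp: down_def)
  with Suc.IH show ?case
    using card_multichains_Suc[OF L_interval_poset(1,3) Suc.prems]
      card_factorizations_Suc[of "k + r" "Suc l" u] down_L_interval[OF Suc.prems]
    by (simp add: subset_iff)
qed

lemma L_interval_bounds:
  "id \<in> L_interval k r" "L_top k r \<in> L_interval k r"
  "u \<in> L_interval k r \<Longrightarrow> (id, u) \<in> absolute_order (k + r)"
  "u \<in> L_interval k r \<Longrightarrow> (u, L_top k r) \<in> absolute_order (k + r)"
  using L_top_hyperoctahedral absolute_order_id absolute_order_refl
  by (auto simp: L_interval_eq absolute_order_def)

lemma card_multichains_L_interval_top:
  assumes "m \<ge> 2"
  shows "card (multichains (L_interval k r) (absolute_order (k + r)) (m - 1)) = interval_count m k r"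
proof -
  have "down (L_interval k r) (absolute_order (k + r)) (L_top k r) = L_interval k r"
    using L_interval_bounds by (auto simp: down_def)
  then show ?thesis
    using card_multichains_L_interval[OF L_interval_bounds(2), of k r "m - 1"] assms
    by (simp add: card_factorizations_L_top)
qed

lemma card_L_interval: "card (L_interval k r) = interval_count 2 k r"
proof -
  have "multichains (L_interval k r) (absolute_order (k + r)) 1 = (\<lambda>x. [x]) ` L_interval k r"
    by (auto simp: multichains_def length_Suc_conv)
  then have "card (multichains (L_interval k r) (absolute_order (k + r)) 1) = card (L_interval k r)"
    by (simp add: card_image inj_on_def)
  then show ?thesis
    using card_multichains_L_interval_top[of 2 k r] by simp
qed

lemma L_moebius_eq: "real_of_int (L_moebius k r) = poly (L_zeta k r) (- 1)"
proof -
  obtain p where p: "\<And>m. m \<ge> 2 \<Longrightarrow>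
      poly p (real m) = real (card (multichains (L_interval k r) (absolute_order (k + r)) (m - 1)))"
    "poly p (- 1) = real_of_int (moebius (L_interval k r) (absolute_order (k + r)) id (L_top k r))"
    using ex_zeta_poly[OF L_interval_poset(1,3), of id k r "L_top k r"] L_interval_bounds by metis
  then show ?thesis
    using zeta_poly_eqI[OF p(1)] by (simp add: L_moebius_def L_zeta_def)
qed

lemma L_zeta_eqI:
  assumes "\<And>m. m \<ge> 2 \<Longrightarrow> poly p (real m) = real (interval_count m k r)"
  shows "L_zeta k r = p"
  unfolding L_zeta_def using assms by (intro zeta_poly_eqI) (simp only: card_multichains_L_interval_top)

section \<open>Closed forms\<close>

text \<open>The closed form of \<open>fuss m (Suc N)\<close>, at real arguments because the sum in \<open>sum_fuss\<close> telescopes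
  over the interval from \<open>- m\<close> to \<open>0\<close>.\<close>

definition fuss_real :: "nat \<Rightarrow> nat \<Rightarrow> real \<Rightarrow> real" where
  "fuss_real m N a = a / real (Suc N) * ((real m * real (Suc N) + a - 1) gchoose N)"

lemma fuss_real_diff: "fuss_real m (Suc N) (a + 1) - fuss_real m (Suc N) a = fuss_real m N (a + real m)"
proof -
  define x where "x = real m * real (Suc (Suc N)) + a - 1"
  define G where "G = x gchoose N"
  define H where "H = x gchoose Suc N"
  have "x * G = real N * G + real (Suc N) * H"
    using gbinomial_mult_1[of x N] by (simp add: G_def H_def)
  then have H: "H = (x - real N) * G / real (Suc N)"
    by (simp add: field_simps)
  have "fuss_real m (Suc N) (a + 1) = (a + 1) / real (Suc (Suc N)) * (G + H)"
    using gbinomial_Suc_Suc[of x N] by (simp add: fuss_real_def x_def G_def H_def add_ac)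
  moreover have "fuss_real m (Suc N) a = a / real (Suc (Suc N)) * H"
    by (simp add: fuss_real_def x_def H_def)
  moreover have "fuss_real m N (a + real m) = (a + real m) / real (Suc N) * G"
    by (simp add: fuss_real_def x_def G_def algebra_simps)
  moreover have "(a + 1) / real (Suc (Suc N)) * (G + H) - a / real (Suc (Suc N)) * H =
      (a + real m) / real (Suc N) * G"
    by (simp add: H x_def divide_simps) (simp add: algebra_simps)
  ultimately show ?thesis
    by simp
qed

text \<open>These are the Raney numbers, usually written s / (m n + s) times binomial (m n + s) n,
  with n = \<open>Suc N\<close>. Both sides vanish at s = 0 and obey the same recursion.\<close>

lemma fuss_eq_fuss_real: "real (fuss m (Suc N) s) = fuss_real m N (real s)"
proof (induction N arbitrary: s)
  case 0
  show ?case
    by (induction s) (simp_all add: fuss_real_def)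
next
  case (Suc N)
  show ?case
  proof (induction s)
    case 0
    show ?case by (simp add: fuss_real_def)
  next
    case (Suc s)
    with \<open>\<And>s. real (fuss m (Suc N) s) = fuss_real m N (real s)\<close>[of "s + m"]
    show ?case
      using fuss_real_diff[of m N "real s"] by (simp add: add_ac)
  qed
qed

text \<open>This evaluates the coefficient with which the cycle absorbs a singleton in
  \<open>interval_count\<close>.\<close>

lemma sum_fuss: "k * (\<Sum>j<m. fuss m k j) = (m * k) choose Suc k"
proof (cases k)
  case (Suc N)
  have "real (\<Sum>j<m. fuss m k j) = (\<Sum>j<m. fuss_real m N (real j))"
    by (simp add: Suc fuss_eq_fuss_real del: fuss.simps)
  also have "\<dots> = (\<Sum>j<m. fuss_real m (Suc N) (real (Suc j) - real m) - fuss_real m (Suc N) (real j - real m))"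
  proof (rule sum.cong)
    fix j
    show "fuss_real m N (real j) =
        fuss_real m (Suc N) (real (Suc j) - real m) - fuss_real m (Suc N) (real j - real m)"
      using fuss_real_diff[of m N "real j - real m"] by (simp add: algebra_simps)
  qed simp
  also have "\<dots> = fuss_real m (Suc N) 0 - fuss_real m (Suc N) (- real m)"
    by (subst sum_lessThan_telescope) simp
  \<comment> \<open>The value at 0 vanishes, and at -m the upper entry m (k + 1) - m - 1 equals m k
    - 1.\<close>
  also have "\<dots> = real m / real (Suc k) * ((real m * real k - 1) gchoose k)"
    by (simp add: fuss_real_def Suc algebra_simps)
  finally have "real (k * (\<Sum>j<m. fuss m k j)) = real m * real k * ((real m * real k - 1) gchoose k) / real (Suc k)"
    by simp
  also have "\<dots> = (real m * real k) gchoose Suc k"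
    using gbinomial_absorption[of k "real m * real k"] by (simp add: field_simps del: of_nat_Suc)
  also have "\<dots> = real ((m * k) choose Suc k)"
    by (simp add: binomial_gbinomial)
  finally show ?thesis
    by (simp only: of_nat_eq_iff)
qed simp

text \<open>For fixed k the recursion in r is that of k = 0 plus a source term. Writing b for
  \<open>interval_count m 0\<close> and S for the sum of \<open>fuss m 1\<close>, the second part
  solves it since s (m b(s-1) + 2 (s-1) S b(s-2)) = s b(s), and the source raises the factor s to s
  + 1.\<close>

lemma interval_count_eq:
  "interval_count m k r = ((m * k) choose k) * interval_count m 0 r +
    2 * r * ((m * k) choose Suc k) * interval_count m 0 (r - 1)"
proof (induction r rule: less_induct)
  case (less r)
  show ?case
  proof (cases r)
    case 0
    then show ?thesis by simp
  next
    case (Suc s)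
    let ?c = "(m * k) choose k" and ?d = "(m * k) choose Suc k" and ?S = "\<Sum>j<m. fuss m 1 j"
    let ?b = "interval_count m 0"
    have b: "?b (Suc s) = m * ?b s + 2 * s * ?S * ?b (s - 1)" for s
      by simp
    have "interval_count m k (Suc s) = m * interval_count m k s +
        2 * (k * (\<Sum>j<m. fuss m k j)) * ?b s + 2 * s * ?S * interval_count m k (s - 1)"
      by (simp add: mult_ac)
    also have "\<dots> = m * (?c * ?b s + 2 * s * ?d * ?b (s - 1)) + 2 * ?d * ?b s +
        2 * s * ?S * interval_count m k (s - 1)"
      unfolding sum_fuss using less[of s] Suc by simp
    also have "\<dots> = ?c * ?b (Suc s) + 2 * Suc s * ?d * ?b s"
    proof (cases s)
      case 0
      then show ?thesis by simp
    next
      case (Suc t)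
      have "interval_count m k t = ?c * ?b t + 2 * t * ?d * ?b (t - 1)"
        using less[of t] Suc \<open>r = Suc s\<close> by simp
      then show ?thesis
        unfolding Suc diff_Suc_1 b[of "Suc t"] b[of t] by (simp add: algebra_simps)
    qed
    finally show ?thesis
      using Suc by simp
  qed
qed

text \<open>The polynomial form of the recursion for k = 0, where the sum of \<open>fuss m 1\<close>
  is m (m - 1) / 2. At 2 it gives 1, 2, 6, 20, 76, ..., the numbers of involutions (with the
  identity) in the hyperoctahedral groups.\<close>

fun involution_poly :: "nat \<Rightarrow> real poly" where
  "involution_poly 0 = 1"
| "involution_poly (Suc r) = [:0, 1:] * involution_poly r +
     smult (real r) ([:0, 1:] * [:-1, 1:] * involution_poly (r - 1))"

lemma poly_involution_poly: "poly (involution_poly r) (real m) = real (interval_count m 0 r)"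
proof (induction r rule: less_induct)
  case (less r)
  have "fuss m 1 j = j" for j
    by (induction j) auto
  moreover have "2 * real (\<Sum>j<m. j) = real m * (real m - 1)"
    by (induction m) (simp_all add: algebra_simps)
  ultimately have sum: "2 * real (\<Sum>j<m. fuss m 1 j) = real m * (real m - 1)"
    by simp
  show ?case
  proof (cases r)
    case (Suc s)
    have "real (interval_count m 0 (Suc s)) = real m * real (interval_count m 0 s) +
        real s * (2 * real (\<Sum>j<m. fuss m 1 j)) * real (interval_count m 0 (s - 1))"
      by simp
    also have "\<dots> = poly (involution_poly (Suc s)) (real m)"
      unfolding sum using less Suc by (simp add: algebra_simps)
    finally show ?thesis
      using Suc by simp
  qed simp
qed

definition gbinomial_poly :: "nat \<Rightarrow> real poly" where
  "gbinomial_poly k = smult (1 / fact k) (\<Prod>i<k. [:- real i, real k:])"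

lemma poly_gbinomial_poly: "poly (gbinomial_poly k) x = (x * real k) gchoose k"
  by (simp add: gbinomial_poly_def gbinomial_prod_rev poly_prod atLeast0LessThan algebra_simps)

text \<open>The quotient of the two neighbouring coefficients is (m k - k) / (k + 1), the origin of
  k / (k + 1) and m - 1 in the theorem.\<close>

lemma binomial_Suc_right:
  "real ((m * k) choose Suc k) = real ((m * k) choose k) * (real k / (real k + 1) * (real m - 1))"
proof -
  have "(real m * real k) * (real m * real k gchoose k) =
      real k * (real m * real k gchoose k) + real (Suc k) * (real m * real k gchoose Suc k)"
    by (rule gbinomial_mult_1)
  then show ?thesis
    by (simp add: binomial_gbinomial field_simps)
qed

lemma poly_L_zeta:
  "poly (L_zeta k r) x = ((x * real k) gchoose k) *
    (2 * real r * real k / (real k + 1) * (x - 1) * poly (involution_poly (r - 1)) x + poly (involution_poly r) x)"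
proof -
  define p where "p = gbinomial_poly k * (smult (2 * real r * real k / (real k + 1)) ([:-1, 1:] * involution_poly (r - 1)) +
    involution_poly r)"
  have p: "poly p x = ((x * real k) gchoose k) *
    (2 * real r * real k / (real k + 1) * (x - 1) * poly (involution_poly (r - 1)) x + poly (involution_poly r) x)" for x
  proof -
    have "poly [:- 1, 1:] x = x - 1"
      by simp
    then show ?thesis
      unfolding p_def poly_mult poly_add poly_smult poly_gbinomial_poly by (simp only: mult.assoc)
  qed
  have "L_zeta k r = p"
  proof (rule L_zeta_eqI)
    fix m :: nat
    have "poly p (real m) = real ((m * k) choose k) * (2 * real r * real k / (real k + 1) * (real m - 1) *
        real (interval_count m 0 (r - 1)) + real (interval_count m 0 r))"
      by (simp add: p poly_involution_poly binomial_gbinomial)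
    also have "\<dots> = real ((m * k) choose k) * real (interval_count m 0 r) +
        2 * real r * real ((m * k) choose Suc k) * real (interval_count m 0 (r - 1))"
      unfolding binomial_Suc_right by (simp add: algebra_simps)
    also have "\<dots> = real (interval_count m k r)"
      by (subst interval_count_eq[of m k r]) simp
    finally show "poly p (real m) = real (interval_count m k r)" .
  qed
  then show ?thesis
    by (simp add: p)
qed

lemma beta_seq_eq: "beta_seq r x = poly (involution_poly r) x"
  by (simp add: beta_seq_def poly_L_zeta)

lemma card_L_interval_eq: "real (card (L_interval k r)) = poly (L_zeta k r) 2"
proof -
  have "real (card (L_interval k r)) = real ((2 * k) choose k) * real (interval_count 2 0 r) +
      2 * real r * real ((2 * k) choose Suc k) * real (interval_count 2 0 (r - 1))"
    unfolding card_L_interval by (subst interval_count_eq[of 2 k r]) simp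
  also have "\<dots> = poly (L_zeta k r) 2"
    using binomial_Suc_right[of 2 k] poly_involution_poly[of _ 2]
    by (simp add: poly_L_zeta binomial_gbinomial algebra_simps)
  finally show ?thesis .
qed

text \<open>At -1 the product x (x - 1) is 2, so after multiplication by (-1)^r all terms of the
  recursion are nonnegative. This identifies the absolute values of the Moebius numbers.\<close>

lemma involution_poly_sign: "(- 1) ^ r * poly (involution_poly r) (- 1) \<ge> 0"
proof (induction r rule: less_induct)
  case (less r)
  show ?case
  proof (cases r)
    case (Suc s)
    have "(- 1) ^ r * poly (involution_poly r) (- 1) =
        (- 1) ^ s * poly (involution_poly s) (- 1) + 2 * real s * ((- 1) ^ (s - 1) * poly (involution_poly (s - 1)) (- 1))"
      by (cases s) (simp_all add: Suc algebra_simps)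
    with less[of s] less[of "s - 1"] Suc show ?thesis
      by simp
  qed simp
qed

lemma abs_mu_seq: "real_of_int \<bar>mu_seq r\<bar> = (- 1) ^ r * poly (involution_poly r) (- 1)"
proof -
  have "real_of_int (mu_seq r) = poly (involution_poly r) (- 1)"
    by (simp add: mu_seq_def L_moebius_eq poly_L_zeta)
  then have "real_of_int \<bar>mu_seq r\<bar> = \<bar>(- 1) ^ r * poly (involution_poly r) (- 1)\<bar>"
    by (simp add: abs_mult)
  then show ?thesis
    using involution_poly_sign[of r] by simp
qed

theorem proposition7p1:
  fixes k r n :: nat
  assumes "k + r = n"
  shows
    "real (card (L_interval k r)) =
       real ((2 * k) choose k) *
         (2 * real r * real k / (real k + 1) * real (alpha_seq (r - 1)) + real (alpha_seq r)) \<and>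
     (\<forall>m :: real. poly (L_zeta k r) m =
       ((m * real k) gchoose k) *
         (2 * real r * real k / (real k + 1) * (m - 1) * beta_seq (r - 1) m + beta_seq r m)) \<and>
     real_of_int (L_moebius k r) =
       (- 1) ^ n * ((2 * real k - 1) gchoose k) *
         (4 * real r * real k / (real k + 1) * real_of_int \<bar>mu_seq (r - 1)\<bar> +
          real_of_int \<bar>mu_seq r\<bar>)"
proof (intro conjI allI)
  have alpha: "real (alpha_seq s) = poly (involution_poly s) 2" for s
    by (simp add: alpha_seq_def card_L_interval_eq poly_L_zeta)
  show "real (card (L_interval k r)) = real ((2 * k) choose k) *
      (2 * real r * real k / (real k + 1) * real (alpha_seq (r - 1)) + real (alpha_seq r))"
    by (simp add: card_L_interval_eq poly_L_zeta alpha binomial_gbinomial)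
  show "poly (L_zeta k r) m = ((m * real k) gchoose k) *
      (2 * real r * real k / (real k + 1) * (m - 1) * beta_seq (r - 1) m + beta_seq r m)" for m
    by (simp add: poly_L_zeta beta_seq_eq)
  define c where "c s = (- 1) ^ s * poly (involution_poly s) (- 1)" for s
  have c: "poly (involution_poly s) (- 1) = (- 1) ^ s * c s" for s
    by (simp add: c_def)
  have neg: "(- real k) gchoose k = (- 1) ^ k * ((2 * real k - 1) gchoose k)"
    using gbinomial_minus[of "real k" k] by simp
  \<comment> \<open>The index r - 1 costs one sign, which cancels that of x - 1 = -2; at r = 0 both
    sides vanish.\<close>
  have "real r * (- 1) ^ (r - 1) = - (real r * (- 1) ^ r)"
    by (cases r) simp_all
  then have "2 * real r * real k / (real k + 1) * (- 1 - 1) * ((- 1) ^ (r - 1) * c (r - 1)) =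
      (- 1) ^ r * (4 * real r * real k / (real k + 1) * c (r - 1))"
    by (cases r) (simp_all add: algebra_simps)
  then have "poly (L_zeta k r) (- 1) = ((- real k) gchoose k) * ((- 1) ^ r *
      (4 * real r * real k / (real k + 1) * c (r - 1) + c r))"
    unfolding poly_L_zeta c by (simp add: distrib_left)
  then show "real_of_int (L_moebius k r) = (- 1) ^ n * ((2 * real k - 1) gchoose k) *
      (4 * real r * real k / (real k + 1) * real_of_int \<bar>mu_seq (r - 1)\<bar> + real_of_int \<bar>mu_seq r\<bar>)"
    unfolding L_moebius_eq neg abs_mu_seq c_def assms[symmetric] by (simp add: power_add mult_ac)
qed

end
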